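(* Let $\mathfrak{L}_1$ and $\mathfrak{L}_2$ be two isospectral lens spaces with associated lattices $T_1$ and $T_2$. Then $\mu_{T_1}=\mu_{T_2}$.
   Context: Let $q$ be a positive integer and $p_1,\dots,p_n$ integers each coprime to $q$. Let $R(\theta)=\begin{pmatrix}\cos\theta&-\sin\theta\\ \sin\theta&\cos\theta\end{pmatrix}$, let $g=R(2\pi p_1/q)\oplus\cdots\oplus R(2\pi p_n/q)\in O(2n)$, and let $G$ be the finite cyclic group generated by $g$, which acts freely by isometries on the unit sphere $S^{2n-1}$. The quotient Riemannian manifold $\mathfrak{L}(p_1,\dots,p_n;q)=S^{2n-1}/G$ is called a lens space, and its associated lattice is $$T=\Big\{(a_1,\dots,a_n)\in\mathbb{Z}^n \;\Big|\; \sum_{j=1}^n a_jp_j\equiv 0 \pmod q\Big\}.$$ Two lens spaces are isospectral if their Laplace-Beltrami operators have the same eigenvalues, counted with multiplicities (in particular they have the same dimension $2n-1$). For $U\subseteq\mathbb{R}^n$ let $C(U)=\{tx\mid t\in\mathbb{R}^+,\ x\in U\}$, and let $B_{l_1}(0,1)$ be the $l_1$-ball of radius $1$ centred at the origin in $\mathbb{R}^n$. For a lattice $T\subseteq\mathbb{Z}^n$ of rank $n$, the lattice-counting measure $\mu_T$ is the finite measure on the sphere $S^{n-1}$ defined by $$\mu_T(U)=\lim_{s\to\infty}\frac{\mathrm{card}\big(T\cap s\,(C(U)\cap B_{l_1}(0,1))\big)}{s^n},$$ that is, the limit of $s^{-n}$ times the number of points of $T\cap C(U)$ with $l_1$-norm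 at most $s$.
   Formalization: The limit formula does not define a measure on all U (each single point gets 0, the countable set of lattice directions gets a positive value); μ_T is taken as the unique finite Borel measure satisfying it for Borel U whose cone C(U) has boundary of Lebesgue measure zero. *)

theory Defs
  imports
    "HOL-Analysis.Analysis"
    "HOL-Library.Function_Algebras"
    "HOL-Number_Theory.Cong"
begin

section \<open>The Laplace-Beltrami operator of the unit sphere\<close>

text \<open>On open sets this is the usual notion of a \<open>C\<^sup>k\<close> function: iterated directional
  derivatives exist in the Frechet sense and are continuous.\<close>

primrec Ck_on :: "nat \<Rightarrow> 'a::real_normed_vector set \<Rightarrow> ('a \<Rightarrow> 'b::real_normed_vector) \<Rightarrow> bool" where
  "Ck_on 0 S f \<longleftrightarrow> continuous_on S f"
| "Ck_on (Suc k) S f \<longleftrightarrow>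
     (\<forall>x\<in>S. f differentiable at x) \<and> (\<forall>v. Ck_on k S (\<lambda>x. frechet_derivative f (at x) v))"

definition smooth_on :: "'a::real_normed_vector set \<Rightarrow> ('a \<Rightarrow> 'b::real_normed_vector) \<Rightarrow> bool" where
  "smooth_on S f \<longleftrightarrow> (\<forall>k. Ck_on k S f)"

text \<open>The extension of a function from the unit sphere to the punctured space that is constant
  along rays: \<^term>\<open>sgn x = x /\<^sub>R norm x\<close> is the radial retraction. The retraction is a smooth
  submersion, so a function on the sphere is smooth iff its radial extension is.\<close>

definition radial :: "('a::euclidean_space \<Rightarrow> 'b) \<Rightarrow> 'a \<Rightarrow> 'b" where
  "radial f = (\<lambda>x. f (sgn x))"

definition smooth_on_sphere :: "('a::euclidean_space \<Rightarrow> real) \<Rightarrow> bool" where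
  "smooth_on_sphere f \<longleftrightarrow> smooth_on (- {0}) (radial f)"

text \<open>A radial extension has derivative zero in the normal direction \<open>x\<close> at a point \<open>x\<close> of the
  sphere. Hence its Euclidean gradient is tangent to the sphere and is the Riemannian gradient for
  the induced metric. The Levi-Civita connection of the sphere is the tangential part of the
  Euclidean derivative, so the Riemannian divergence of a tangent field \<open>X\<close> is the sum of
  \<open>D\<^sub>e X \<bullet> e\<close> over an orthonormal basis of the tangent space; for the radial extension the normal
  direction contributes \<open>0\<close>, and this is the trace over the standard basis of the ambient space.\<close>

definition sphere_grad :: "('a::euclidean_space \<Rightarrow> real) \<Rightarrow> 'a \<Rightarrow> 'a" where
  "sphere_grad f x = (\<Sum>b\<in>Basis. frechet_derivative (radial f) (at x) b *\<^sub>R b)"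

definition sphere_div :: "('a::euclidean_space \<Rightarrow> 'a) \<Rightarrow> 'a \<Rightarrow> real" where
  "sphere_div X x = (\<Sum>b\<in>Basis. frechet_derivative (radial X) (at x) b \<bullet> b)"

definition sphere_laplacian :: "('a::euclidean_space \<Rightarrow> real) \<Rightarrow> 'a \<Rightarrow> real" where
  "sphere_laplacian f = sphere_div (sphere_grad f)"

section \<open>Lens spaces and isospectrality\<close>

text \<open>The Euclidean space of dimension \<open>2n\<close> is \<^typ>\<open>real^2^'n\<close>, with \<open>n = CARD('n)\<close> planes.\<close>

definition rot :: "real \<Rightarrow> real^2^2" where
  "rot \<theta> = vector [vector [cos \<theta>, - sin \<theta>], vector [sin \<theta>, cos \<theta>]]"

definition lens_gen :: "('n::finite \<Rightarrow> int) \<Rightarrow> nat \<Rightarrow> real^2^'n \<Rightarrow> real^2^'n" where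
  "lens_gen p q x = (\<chi> j. rot (2 * pi * of_int (p j) / of_nat q) *v (x $ j))"

text \<open>The generator has finite order, so its powers with natural exponents form the group.\<close>

definition lens_orbit :: "('n::finite \<Rightarrow> int) \<Rightarrow> nat \<Rightarrow> real^2^'n \<Rightarrow> (real^2^'n) set" where
  "lens_orbit p q x = {(lens_gen p q ^^ k) x | k. True}"

definition lens_space :: "('n::finite \<Rightarrow> int) \<Rightarrow> nat \<Rightarrow> (real^2^'n) set set" where
  "lens_space p q = lens_orbit p q ` sphere 0 1"

text \<open>The projection \<^term>\<open>lens_orbit p q\<close> from the sphere is a Riemannian covering, so smoothness
  and the Laplace-Beltrami operator on the quotient are those of the pullback to the sphere.
  Functions on the quotient are represented by functions vanishing outside it.\<close>

definition lens_eigenspace ::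
  "('n::finite \<Rightarrow> int) \<Rightarrow> nat \<Rightarrow> real \<Rightarrow> ((real^2^'n) set \<Rightarrow> real) set" where
  "lens_eigenspace p q \<nu> =
     {f. (\<forall>X. X \<notin> lens_space p q \<longrightarrow> f X = 0) \<and>
         smooth_on_sphere (f \<circ> lens_orbit p q) \<and>
         (\<forall>x\<in>sphere 0 1. - sphere_laplacian (f \<circ> lens_orbit p q) x = \<nu> * f (lens_orbit p q x))}"

definition fun_scale :: "real \<Rightarrow> ('a \<Rightarrow> real) \<Rightarrow> 'a \<Rightarrow> real" where
  "fun_scale c f = (\<lambda>x. c * f x)"

lemma vector_space_fun_scale: "vector_space fun_scale"
  by unfold_locales (auto simp: fun_scale_def fun_eq_iff algebra_simps)

text \<open>The eigenspaces are finite-dimensional because the lens space is compact, so the convention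
  \<open>dim = 0\<close> for infinite dimension plays no role; the multiplicity is \<open>0\<close> iff \<open>\<nu>\<close> is not an
  eigenvalue.\<close>

definition eigenvalue_multiplicity :: "('n::finite \<Rightarrow> int) \<Rightarrow> nat \<Rightarrow> real \<Rightarrow> nat" where
  "eigenvalue_multiplicity p q \<nu> = vector_space.dim fun_scale (lens_eigenspace p q \<nu>)"

definition isospectral ::
  "('n::finite \<Rightarrow> int) \<Rightarrow> nat \<Rightarrow> ('n \<Rightarrow> int) \<Rightarrow> nat \<Rightarrow> bool" where
  "isospectral p1 q1 p2 q2 \<longleftrightarrow>
     (\<forall>\<nu>. eigenvalue_multiplicity p1 q1 \<nu> = eigenvalue_multiplicity p2 q2 \<nu>)"

section \<open>The associated lattice and the lattice-counting measure\<close>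

definition lens_lattice :: "('n::finite \<Rightarrow> int) \<Rightarrow> nat \<Rightarrow> (real^'n) set" where
  "lens_lattice p q =
     {\<chi> j. of_int (a j) | a. [(\<Sum>j\<in>UNIV. a j * p j) = 0] (mod int q)}"

definition pos_cone :: "(real^'n::finite) set \<Rightarrow> (real^'n) set" where
  "pos_cone U = {t *\<^sub>R x | t x. 0 < t \<and> x \<in> U}"

definition l1_cball :: "(real^'n::finite) set" where
  "l1_cball = {x. (\<Sum>j\<in>UNIV. \<bar>x $ j\<bar>) \<le> 1}"

text \<open>On arbitrary Borel sets \<open>U\<close> the limit may fail to exist and is not countably additive: it is
  \<open>0\<close> on every single point, but positive on the countable set of all directions of lattice
  points. As usual for such limits, the formula is required on the sets \<open>U\<close> whose cone has a
  boundary of Lebesgue measure zero. These form a \<open>\<inter>\<close>-stable generator of the Borel sets of the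
  sphere that contains the whole sphere, so at most one finite Borel measure satisfies it.\<close>

definition is_lattice_counting_measure ::
  "(real^'n::finite) set \<Rightarrow> (real^'n) measure \<Rightarrow> bool" where
  "is_lattice_counting_measure T M \<longleftrightarrow>
     finite_measure M \<and>
     space M = sphere 0 1 \<and>
     sets M = sets (restrict_space borel (sphere 0 1)) \<and>
     (\<forall>U\<in>sets M. negligible (frontier (pos_cone U)) \<longrightarrow>
        ((\<lambda>s::real. real (card (T \<inter> (*\<^sub>R) s ` (pos_cone U \<inter> l1_cball))) / s ^ CARD('n))
           \<longlongrightarrow> measure M U) at_top)"

definition lattice_counting_measure :: "(real^'n::finite) set \<Rightarrow> (real^'n) measure" where
  "lattice_counting_measure T = (THE M. is_lattice_counting_measure T M)"

end

(* The eigenvalues of the sphere Laplacian on R^N are k (k + N - 2), and its eigenfunctions are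
   restrictions of polynomials: the Laplacian preserves the polynomials of degree below m, acts on the
   quotients of this filtration by these scalars, and is symmetric for an L2 product, so the
   Stone-Weierstrass theorem leaves no other eigenfunctions. Hence the spectrum of a lens space
   determines the dimensions D(m) of the spaces of invariant polynomials of degree at most m.
   Let d(m) be the dimension of all polynomials of degree at most m on the sphere, let g be the generator
   of order q, and let u be a coordinate taking distinct values on generic orbits. By Vandermonde, the map
   (f_r) |-> sum f_r u^r on q-tuples of invariant polynomials and the map f |-> (sum over the group
   of u^r f) are injective, so q D(m) <= d(m + q) and d(m) <= q D(m + q). As d grows polynomially,
   isospectral lens spaces have the same q. The associated lattice has index q in Z^n, and for sets whose
   cone has a negligible boundary the limit defining the measure is 1/q times the one for Z^n. *)

theory Submission
  imports Defs "HOL-Real_Asymp.Real_Asymp"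
begin

section \<open>Smooth functions on the sphere and their tangential derivatives\<close>

text \<open>The multiplicities count all smooth eigenfunctions, while the Vandermonde maps act on
  polynomials only; hence the effort spent on completeness. Three encodings carry it. Polynomials
  and eigenfunctions on the sphere are functions on the ambient space that vanish off the sphere, so
  that equality, span and dimension refer to restrictions. Derivatives are taken of radial
  extensions, which are homogeneous of degree 0. The surface integral becomes a Lebesgue integral
  against a radial weight on an annulus, so that the divergence theorem reduces to translation
  invariance of Lebesgue measure. The two dimension inequalities lose only a bounded shift of
  degree. Alternating them k times turns q1 > q2 into growth of the invariant dimensions like
  (q1/q2)^k at degree k (q1 + q2), against the crude bound by a power of that degree. In the lattice
  part, cosets are compared by translation. Points that a fixed translation moves out of s A lie in
  a layer of bounded width at the boundary of s A, and the negligible frontier makes their number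
  o(s^n).\<close>

lemma differentiable_has_frechet_derivative:
  "f differentiable (at x) \<Longrightarrow> (f has_derivative frechet_derivative f (at x)) (at x)"
  by (simp add: frechet_derivative_works)

section \<open>Calculus of k times differentiable functions on open sets\<close>

lemma Ck_on_cong:
  assumes "open S" "\<And>x. x \<in> S \<Longrightarrow> f x = g x" "Ck_on k S f"
  shows "Ck_on k S g"
  using assms(2,3)
proof (induction k arbitrary: f g)
  case 0
  then show ?case using continuous_on_eq by fastforce
next
  case (Suc k)
  have fr: "frechet_derivative f (at x) = frechet_derivative g (at x)" if "x \<in> S" for x
    using Suc.prems that by (intro frechet_derivative_transform_within_open[OF _ assms(1)]) auto
  have "g differentiable at x" if "x \<in> S" for x
    using has_derivative_transform_within_open[OF _ assms(1) that, of f _ UNIV g] Suc.prems that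
    by (fastforce simp: differentiable_def)
  moreover have "Ck_on k S (\<lambda>x. frechet_derivative g (at x) v)" for v
    by (rule Suc.IH[of "\<lambda>x. frechet_derivative f (at x) v"]) (use Suc.prems fr in auto)
  ultimately show ?case by simp
qed

text \<open>Lets the derivative be given by a formula instead of the choice made by
  \<open>frechet_derivative\<close>; the closure properties below use it in inductions on the order
  of differentiability.\<close>

lemma Ck_on_SucI:
  assumes "open S" "\<And>x. x \<in> S \<Longrightarrow> (f has_derivative f' x) (at x)"
    "\<And>v. Ck_on k S (\<lambda>x. f' x v)"
  shows "Ck_on (Suc k) S f"
proof -
  have "frechet_derivative f (at x) = f' x" if "x \<in> S" for x
    using frechet_derivative_at[OF assms(2)[OF that]] by simp
  then have "Ck_on k S (\<lambda>x. frechet_derivative f (at x) v)" for v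
    by (intro Ck_on_cong[OF assms(1) _ assms(3)[of v]]) auto
  then show ?thesis using assms(2) by (auto simp: differentiable_def)
qed

lemma Ck_on_Suc_imp: "Ck_on (Suc k) S f \<Longrightarrow> Ck_on k S f"
proof (induction k arbitrary: f)
  case 0
  then show ?case
    by (auto intro!: continuous_at_imp_continuous_on differentiable_imp_continuous_within)
next
  case (Suc k)
  then show ?case by (metis Ck_on.simps(2))
qed

lemma Ck_on_const: "open S \<Longrightarrow> Ck_on k S (\<lambda>x. c)"
proof (induction k arbitrary: c)
  case (Suc k)
  show ?case
    by (rule Ck_on_SucI[where f'="\<lambda>x v. 0"]) (use Suc in \<open>auto simp: has_derivative_const\<close>)
qed auto

lemma Ck_on_add:
  assumes "open S" "Ck_on k S f" "Ck_on k S g"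
  shows "Ck_on k S (\<lambda>x. f x + g x)"
  using assms(2,3)
proof (induction k arbitrary: f g)
  case 0
  then show ?case by (auto intro: continuous_intros)
next
  case (Suc k)
  show ?case
    by (rule Ck_on_SucI[OF assms(1),
      where f'="\<lambda>x v. frechet_derivative f (at x) v + frechet_derivative g (at x) v"])
      (use Suc in \<open>auto intro!: has_derivative_add simp: differentiable_has_frechet_derivative\<close>)
qed

lemma Ck_on_mult:
  fixes f g :: "'a::real_normed_vector \<Rightarrow> real"
  assumes "open S" "Ck_on k S f" "Ck_on k S g"
  shows "Ck_on k S (\<lambda>x. f x * g x)"
  using assms(2,3)
proof (induction k arbitrary: f g)
  case 0
  then show ?case by (auto intro: continuous_intros)
next
  case (Suc k)
  \<comment> \<open>The product rule contains \<open>f\<close> and \<open>g\<close>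
    undifferentiated, so both are also needed one order lower.\<close>
  have fg: "Ck_on k S f" "Ck_on k S g" using Suc.prems Ck_on_Suc_imp by blast+
  show ?case
    by (rule Ck_on_SucI[OF assms(1),
      where f'="\<lambda>x v. f x * frechet_derivative g (at x) v + frechet_derivative f (at x) v * g x"])
      (use Suc fg in \<open>auto intro!: has_derivative_mult Ck_on_add[OF assms(1)] simp: differentiable_has_frechet_derivative\<close>)
qed

lemma Ck_on_sum:
  assumes "open S" "\<And>i. i \<in> I \<Longrightarrow> Ck_on k S (f i)"
  shows "Ck_on k S (\<lambda>x. \<Sum>i\<in>I. f i x)"
  using assms(2)
  by (induction I rule: infinite_finite_induct) (auto intro: Ck_on_const Ck_on_add assms(1))

lemma Ck_on_inner:
  fixes b :: "'a::real_inner"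
  assumes "open S"
  shows "Ck_on k S (\<lambda>x. x \<bullet> b)"
proof (cases k)
  case 0
  then show ?thesis by (auto intro: continuous_intros)
next
  case (Suc k)
  show ?thesis unfolding Suc
    by (rule Ck_on_SucI[where f'="\<lambda>x v. v \<bullet> b"])
      (use assms in \<open>auto intro!: derivative_eq_intros Ck_on_const\<close>)
qed

text \<open>The derivative is a product of a linear function and powers of the function itself, so
  the induction on \<open>k\<close> closes under \<open>Ck_on_mult\<close>.\<close>

lemma Ck_on_inverse_norm: "Ck_on k (- {0}) (\<lambda>x::'a::euclidean_space. inverse (norm x))"
proof (induction k)
  case 0
  show ?case by (auto intro!: continuous_intros)
next
  case (Suc k)
  have "((\<lambda>x. inverse (norm x)) has_derivative
      (\<lambda>v. - 1 * ((x \<bullet> v) * (inverse (norm x) * (inverse (norm x) * inverse (norm x)))))) (at x)"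
    if "x \<noteq> 0" for x :: 'a
    using that by (auto intro!: derivative_eq_intros has_derivative_norm simp: sgn_div_norm inner_commute field_simps fun_eq_iff)
  moreover have "Ck_on k (- {0}) (\<lambda>x::'a. - 1 * ((x \<bullet> v) * (inverse (norm x) * (inverse (norm x) * inverse (norm x)))))" for v
    by (intro Ck_on_mult Ck_on_const Suc.IH Ck_on_inner) auto
  ultimately show ?case by (intro Ck_on_SucI) auto
qed

lemma Ck_on_norm: "Ck_on k (- {0}) (norm :: 'a::euclidean_space \<Rightarrow> real)"
proof (rule Ck_on_cong)
  have "Ck_on k (- {0}) (\<lambda>x::'a. (\<Sum>b\<in>Basis. (x \<bullet> b) * (x \<bullet> b)) * inverse (norm x))"
    by (intro Ck_on_mult Ck_on_inverse_norm Ck_on_sum Ck_on_inner) auto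
  then show "Ck_on k (- {0}) (\<lambda>x::'a. (x \<bullet> x) * inverse (norm x))"
    by (simp flip: euclidean_inner)
qed (auto simp: dot_square_norm power2_eq_square)

section \<open>Smooth functions on the sphere\<close>

lemma radial_eqI:
  assumes "\<And>x. norm x = 1 \<Longrightarrow> f x = g x" "x \<noteq> 0"
  shows "radial f x = radial g x"
  using assms by (simp add: radial_def norm_sgn)

lemma smooth_on_sphere_cong:
  assumes "\<And>x. norm x = 1 \<Longrightarrow> f x = g x" "smooth_on_sphere f"
  shows "smooth_on_sphere g"
  using assms Ck_on_cong[of "- {0}" "radial f" "radial g"] radial_eqI[of f g]
  by (auto simp: smooth_on_sphere_def smooth_on_def)

lemma smooth_on_sphere_const: "smooth_on_sphere (\<lambda>x. c)"
  by (auto simp: smooth_on_sphere_def smooth_on_def radial_def intro!: Ck_on_const)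

lemma smooth_on_sphere_add:
  "smooth_on_sphere f \<Longrightarrow> smooth_on_sphere g \<Longrightarrow> smooth_on_sphere (\<lambda>x. f x + g x)"
  by (auto simp: smooth_on_sphere_def smooth_on_def radial_def intro!: Ck_on_add)

lemma smooth_on_sphere_mult:
  "smooth_on_sphere f \<Longrightarrow> smooth_on_sphere g \<Longrightarrow> smooth_on_sphere (\<lambda>x. f x * g x)"
  by (auto simp: smooth_on_sphere_def smooth_on_def radial_def intro!: Ck_on_mult)

lemma smooth_on_sphere_diff:
  assumes "smooth_on_sphere f" "smooth_on_sphere g"
  shows "smooth_on_sphere (\<lambda>x. f x - g x)"
  using smooth_on_sphere_add[OF assms(1) smooth_on_sphere_mult[OF smooth_on_sphere_const[of "-1"] assms(2)]]
  by simp

lemma smooth_on_sphere_sum: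
  "(\<And>i. i \<in> I \<Longrightarrow> smooth_on_sphere (f i)) \<Longrightarrow> smooth_on_sphere (\<lambda>x. \<Sum>i\<in>I. f i x)"
  by (induction I rule: infinite_finite_induct)
    (auto intro: smooth_on_sphere_const smooth_on_sphere_add)

lemma smooth_on_sphere_inner: "smooth_on_sphere (\<lambda>x. x \<bullet> b)"
proof -
  have "Ck_on k (- {0}) (\<lambda>x. inverse (norm x) * (x \<bullet> b))" for k
    by (intro Ck_on_mult Ck_on_inverse_norm Ck_on_inner) auto
  then show ?thesis
    by (simp add: smooth_on_sphere_def smooth_on_def radial_def sgn_div_norm inverse_eq_divide)
qed

text \<open>The derivative of a function on the sphere along the tangential part of \<open>b\<close>.\<close>

definition sderiv :: "'a::euclidean_space \<Rightarrow> ('a \<Rightarrow> real) \<Rightarrow> 'a \<Rightarrow> real" where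
  "sderiv b f x = (if norm x = 1 then frechet_derivative (radial f) (at x) b else 0)"

text \<open>The working form of \<open>sphere_laplacian\<close>: scalar second derivatives only, and
  value 0 off the sphere, so that identities can be stated for all points.\<close>

definition slap :: "('a::euclidean_space \<Rightarrow> real) \<Rightarrow> 'a \<Rightarrow> real" where
  "slap f x = (\<Sum>b\<in>Basis. sderiv b (sderiv b f) x)"

lemma radial_has_derivative:
  assumes "smooth_on_sphere f" "x \<noteq> 0"
  shows "(radial f has_derivative frechet_derivative (radial f) (at x)) (at x)"
proof -
  have "Ck_on (Suc 0) (- {0}) (radial f)"
    using assms unfolding smooth_on_sphere_def smooth_on_def by blast
  then show ?thesis using assms(2) by (simp add: differentiable_has_frechet_derivative)
qed

lemma radial_scaleR: "0 < c \<Longrightarrow> radial f (c *\<^sub>R x) = radial f x"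
  by (simp add: radial_def sgn_scaleR)

text \<open>A radial extension is unchanged by the scaling with \<open>inverse (norm x)\<close>; the
  chain rule then makes its derivative homogeneous of degree -1.\<close>

lemma frechet_derivative_radial:
  assumes "smooth_on_sphere f" "x \<noteq> 0"
  shows "frechet_derivative (radial f) (at x) b = sderiv b f (sgn x) / norm x"
proof -
  have eq: "radial f \<circ> (\<lambda>y. inverse (norm x) *\<^sub>R y) = radial f"
    using assms(2) by (auto simp: radial_scaleR)
  have "(radial f \<circ> (\<lambda>y. inverse (norm x) *\<^sub>R y) has_derivative
      frechet_derivative (radial f) (at (inverse (norm x) *\<^sub>R x)) \<circ> (\<lambda>y. inverse (norm x) *\<^sub>R y)) (at x)"
    using assms by (intro diff_chain_at radial_has_derivative) (auto intro!: derivative_eq_intros)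
  then have "(radial f has_derivative
      frechet_derivative (radial f) (at (sgn x)) \<circ> (\<lambda>y. inverse (norm x) *\<^sub>R y)) (at x)"
    unfolding eq by (simp add: sgn_div_norm)
  then have *: "frechet_derivative (radial f) (at x) b
      = frechet_derivative (radial f) (at (sgn x)) (inverse (norm x) *\<^sub>R b)"
    by (metis comp_apply frechet_derivative_at)
  have "linear (frechet_derivative (radial f) (at (sgn x)))"
    using radial_has_derivative[of f "sgn x"] assms
    by (auto intro: has_derivative_linear simp: sgn_zero_iff)
  from linear_scale[OF this] show ?thesis
    using assms(2) by (simp add: * sderiv_def norm_sgn divide_inverse mult.commute)
qed

text \<open>Multiplying by \<open>norm\<close> turns a coordinate derivative of
  \<open>radial f\<close>, homogeneous of degree -1, into the radial extension of
  \<open>sderiv b f\<close>. This is what allows derivatives to be iterated.\<close>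

lemma smooth_on_sphere_sderiv:
  assumes "smooth_on_sphere f"
  shows "smooth_on_sphere (sderiv b f)"
proof -
  have "Ck_on k (- {0}) (radial (sderiv b f))" for k
  proof (rule Ck_on_cong)
    have "Ck_on (Suc k) (- {0}) (radial f)"
      using assms unfolding smooth_on_sphere_def smooth_on_def by blast
    then show "Ck_on k (- {0}) (\<lambda>x. norm x * frechet_derivative (radial f) (at x) b)"
      by (intro Ck_on_mult Ck_on_norm) auto
  qed (use assms in \<open>auto simp: frechet_derivative_radial radial_def[of "sderiv b f"]\<close>)
  then show ?thesis by (simp add: smooth_on_sphere_def smooth_on_def)
qed

lemma smooth_on_sphere_slap: "smooth_on_sphere f \<Longrightarrow> smooth_on_sphere (slap f)"
  unfolding slap_def [abs_def] by (intro smooth_on_sphere_sum smooth_on_sphere_sderiv)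

lemma sderiv_off_sphere [simp]: "norm x \<noteq> 1 \<Longrightarrow> sderiv b f x = 0"
  by (simp add: sderiv_def)

lemma slap_off_sphere [simp]: "norm x \<noteq> 1 \<Longrightarrow> slap f x = 0"
  by (simp add: slap_def)

text \<open>The computation rule: any \<open>F\<close> that agrees with the radial extension off the
  origin may be differentiated instead.\<close>

lemma sderivI:
  assumes "(F has_derivative D) (at x)" "norm x = 1" "\<And>y. y \<noteq> 0 \<Longrightarrow> F y = radial f y"
  shows "sderiv b f x = D b"
proof -
  have r: "(radial f has_derivative D) (at x)"
    by (rule has_derivative_transform_within_open[OF assms(1), of "- {0}"]) (use assms in auto)
  show ?thesis using assms(2) frechet_derivative_at[OF r] by (simp add: sderiv_def)
qed

lemma radial_has_sderiv:
  assumes "smooth_on_sphere f" "norm x = 1"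
  shows "(radial f has_derivative (\<lambda>b. sderiv b f x)) (at x)"
proof -
  have "x \<noteq> 0" using assms(2) by auto
  then show ?thesis using radial_has_derivative[OF assms(1), of x] assms(2) by (simp add: sderiv_def)
qed

lemma sderiv_cong:
  assumes "smooth_on_sphere f" "\<And>x. norm x = 1 \<Longrightarrow> f x = g x"
  shows "sderiv b f = sderiv b g"
proof
  fix x
  show "sderiv b f x = sderiv b g x"
  proof (cases "norm x = 1")
    case True
    have "radial g y = radial f y" if "y \<noteq> 0" for y
      using radial_eqI[of g f y] assms(2) that by simp
    then show ?thesis
      using sderivI[OF radial_has_sderiv[OF smooth_on_sphere_cong[OF assms(2) assms(1)] True] True, of f b]
      by simp
  qed simp
qed

lemma sderiv_add:
  assumes "smooth_on_sphere f" "smooth_on_sphere g"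
  shows "sderiv b (\<lambda>x. f x + g x) x = sderiv b f x + sderiv b g x"
proof (cases "norm x = 1")
  case True
  from has_derivative_add[OF radial_has_sderiv[OF assms(1) True] radial_has_sderiv[OF assms(2) True]]
  show ?thesis by (rule sderivI) (use True in \<open>auto simp: radial_def\<close>)
qed simp

lemma sderiv_mult:
  assumes "smooth_on_sphere f" "smooth_on_sphere g"
  shows "sderiv b (\<lambda>x. f x * g x) x = f x * sderiv b g x + sderiv b f x * g x"
proof (cases "norm x = 1")
  case True
  from has_derivative_mult[OF radial_has_sderiv[OF assms(1) True] radial_has_sderiv[OF assms(2) True]]
  have "((\<lambda>x. radial f x * radial g x) has_derivative
     (\<lambda>b. f x * sderiv b g x + sderiv b f x * g x)) (at x)"
    using True by (simp add: radial_def sgn_div_norm)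
  then show ?thesis by (rule sderivI) (use True in \<open>auto simp: radial_def\<close>)
qed simp

lemma sderiv_const [simp]: "sderiv b (\<lambda>x. c) x = 0"
proof (cases "norm x = 1")
  case True
  show ?thesis by (rule sderivI[OF has_derivative_const]) (use True in \<open>auto simp: radial_def\<close>)
qed simp

lemma sderiv_cmult:
  "smooth_on_sphere f \<Longrightarrow> sderiv b (\<lambda>x. c * f x) x = c * sderiv b f x"
  by (subst sderiv_mult) (auto intro: smooth_on_sphere_const)

lemma sderiv_diff:
  assumes "smooth_on_sphere f" "smooth_on_sphere g"
  shows "sderiv b (\<lambda>x. f x - g x) x = sderiv b f x - sderiv b g x"
  using sderiv_add[OF assms(1) smooth_on_sphere_mult[OF smooth_on_sphere_const[of "-1"] assms(2)], of b x]
    sderiv_cmult[OF assms(2), of b "-1" x] by simp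

lemma sderiv_sum:
  assumes "\<And>i. i \<in> I \<Longrightarrow> smooth_on_sphere (f i)"
  shows "sderiv b (\<lambda>x. \<Sum>i\<in>I. f i x) x = (\<Sum>i\<in>I. sderiv b (f i) x)"
  using assms
  by (induction I rule: infinite_finite_induct) (auto simp: sderiv_add smooth_on_sphere_sum)

text \<open>The gradient of a linear function is the tangential part
  \<open>c - (x \<bullet> c) x\<close> of \<open>c\<close>.\<close>

lemma sderiv_inner:
  assumes "norm x = 1"
  shows "sderiv b (\<lambda>x. x \<bullet> c) x = b \<bullet> c - (x \<bullet> b) * (x \<bullet> c)"
proof -
  have "((\<lambda>x. inverse (norm x) * (x \<bullet> c)) has_derivative (\<lambda>b. b \<bullet> c - (x \<bullet> b) * (x \<bullet> c))) (at x)"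
    using assms by (auto intro!: derivative_eq_intros has_derivative_norm simp: sgn_div_norm inner_commute fun_eq_iff)
  then show ?thesis
    by (rule sderivI) (use assms in \<open>auto simp: radial_def sgn_div_norm\<close>)
qed

lemma linear_sderiv:
  assumes "smooth_on_sphere f" shows "linear (\<lambda>b. sderiv b f x)"
proof (cases "norm x = 1")
  case True
  then show ?thesis using assms radial_has_sderiv has_derivative_linear by blast
qed (simp add: linear_zero)

text \<open>A radial extension is constant along rays.\<close>

lemma sderiv_tangential:
  assumes "smooth_on_sphere f"
  shows "(\<Sum>b\<in>Basis. (x \<bullet> b) * sderiv b f x) = 0"
proof (cases "norm x = 1")
  case True
  have "(\<Sum>b\<in>Basis. (x \<bullet> b) * sderiv b f x) = sderiv (\<Sum>b\<in>Basis. (x \<bullet> b) *\<^sub>R b) f x"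
    using linear_sum[OF linear_sderiv[OF assms, of x], of "\<lambda>b. (x \<bullet> b) *\<^sub>R b" Basis]
      linear_scale[OF linear_sderiv[OF assms, of x]] by simp
  also have "\<dots> = sderiv x f x" by (simp add: euclidean_representation)
  also have "\<dots> = 0"
  proof -
    have "((\<lambda>t. x + t *\<^sub>R x) has_derivative (\<lambda>t. t *\<^sub>R x)) (at 0)"
      by (auto intro!: derivative_eq_intros)
    from diff_chain_at[OF this, of "radial f" "\<lambda>b. sderiv b f x"] radial_has_sderiv[OF assms True]
    have "((\<lambda>t. radial f (x + t *\<^sub>R x)) has_derivative (\<lambda>t. sderiv (t *\<^sub>R x) f x)) (at 0)"
      by (simp add: comp_def)
    \<comment> \<open>For these \<open>t\<close> the point \<open>x + t x\<close> stays on the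
      positive ray of \<open>x\<close>.\<close>
    moreover have "((\<lambda>t. radial f (x + t *\<^sub>R x)) has_derivative (\<lambda>t. 0)) (at (0::real))"
    proof (rule has_derivative_transform_within_open[OF has_derivative_const])
      show "radial f x = radial f (x + t *\<^sub>R x)" if "t \<in> {-1<..<1}" for t
        using that radial_scaleR[of "1 + t" f x] by (simp add: scaleR_add_left)
    qed auto
    ultimately have "(\<lambda>t::real. sderiv (t *\<^sub>R x) f x) = (\<lambda>t. 0)" using has_derivative_unique by blast
    from fun_cong[OF this, of 1] show ?thesis by simp
  qed
  finally show ?thesis .
qed simp

text \<open>On the sphere the components of \<open>sphere_grad f\<close> are the functions
  \<open>sderiv b f\<close>, and the trace in \<open>sphere_div\<close> differentiates each of them
  along its own \<open>b\<close>.\<close>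

lemma sphere_laplacian_eq_slap:
  assumes "smooth_on_sphere f" "norm x = 1"
  shows "sphere_laplacian f x = slap f x"
proof -
  have g: "((radial (sphere_grad f)) has_derivative
     (\<lambda>v. \<Sum>b\<in>Basis. sderiv v (sderiv b f) x *\<^sub>R b)) (at x)"
  proof (rule has_derivative_transform_within_open)
    show "((\<lambda>y. \<Sum>b\<in>Basis. radial (sderiv b f) y *\<^sub>R b) has_derivative
     (\<lambda>v. \<Sum>b\<in>Basis. sderiv v (sderiv b f) x *\<^sub>R b)) (at x)"
      by (intro has_derivative_sum has_derivative_scaleR_left radial_has_sderiv smooth_on_sphere_sderiv assms)
    show "(\<Sum>b\<in>Basis. radial (sderiv b f) y *\<^sub>R b) = radial (sphere_grad f) y" if "y \<in> - {0}" for y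
      using that by (simp add: radial_def sphere_grad_def sderiv_def norm_sgn)
  qed (use assms in auto)
  show ?thesis
    unfolding sphere_laplacian_def sphere_div_def slap_def
    by (simp add: frechet_derivative_at[OF g, symmetric] inner_sum_left inner_Basis if_distrib
      cong: if_cong)
qed

section \<open>Polynomials on the sphere\<close>

interpretation fs: vector_space fun_scale
  by (rule vector_space_fun_scale)

lemma fs_subspaceI:
  assumes "(\<lambda>x. 0) \<in> S" "\<And>f g. f \<in> S \<Longrightarrow> g \<in> S \<Longrightarrow> (\<lambda>x. f x + g x) \<in> S"
    "\<And>c f. f \<in> S \<Longrightarrow> (\<lambda>x. c * f x) \<in> S"
  shows "fs.subspace S"
  using assms by (intro fs.subspaceI) (simp_all add: zero_fun_def plus_fun_def fun_scale_def)

lemma fs_subspace_zero: "fs.subspace S \<Longrightarrow> (\<lambda>x. 0) \<in> S"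
  using fs.subspace_0[of S] by (simp add: zero_fun_def)

lemma fs_subspace_add: "fs.subspace S \<Longrightarrow> f \<in> S \<Longrightarrow> g \<in> S \<Longrightarrow> (\<lambda>x. f x + g x) \<in> S"
  using fs.subspace_add[of S f g] by (simp add: plus_fun_def)

lemma fs_subspace_scale: "fs.subspace S \<Longrightarrow> f \<in> S \<Longrightarrow> (\<lambda>x. c * f x) \<in> S"
  using fs.subspace_scale[of S f c] by (simp add: fun_scale_def)

lemma fs_subspace_diff:
  assumes "fs.subspace S" "f \<in> S" "g \<in> S"
  shows "(\<lambda>x. f x - g x) \<in> S"
  using fs.subspace_diff[OF assms] by (simp add: fun_diff_def)

lemma fs_subspace_sum:
  assumes "fs.subspace S" "\<And>i. i \<in> I \<Longrightarrow> f i \<in> S"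
  shows "(\<lambda>x. \<Sum>i\<in>I. f i x) \<in> S"
  using assms(2)
  by (induction I rule: infinite_finite_induct)
    (auto intro: fs_subspace_zero fs_subspace_add assms(1))

text \<open>Cutting off outside the sphere makes relations such as \<open>x \<bullet> x = 1\<close>
  identities of functions, so that \<open>fs.dim\<close> counts polynomials modulo those vanishing
  on the sphere.\<close>

definition smono :: "('a::euclidean_space \<Rightarrow> nat) \<Rightarrow> 'a \<Rightarrow> real" where
  "smono e x = (if norm x = 1 then \<Prod>b\<in>Basis. (x \<bullet> b) ^ e b else 0)"

text \<open>The bound on the degree is strict, so that \<open>spoly 0\<close> is trivial.\<close>

definition spoly :: "nat \<Rightarrow> ('a::euclidean_space \<Rightarrow> real) set" where
  "spoly m = fs.span {smono e | e. (\<Sum>b\<in>Basis. e b) < m}"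

lemma subspace_spoly: "fs.subspace (spoly m)"
  by (simp add: spoly_def fs.subspace_span)

lemmas spoly_zero = fs_subspace_zero[OF subspace_spoly]
  and spoly_add = fs_subspace_add[OF subspace_spoly]
  and spoly_scale = fs_subspace_scale[OF subspace_spoly]
  and spoly_diff = fs_subspace_diff[OF subspace_spoly]
  and spoly_sum = fs_subspace_sum[OF subspace_spoly]

lemma smono_in_spoly: "(\<Sum>b\<in>Basis. e b) < m \<Longrightarrow> smono e \<in> spoly m"
  unfolding spoly_def by (rule fs.span_base) auto

lemma spoly_mono: "m \<le> m' \<Longrightarrow> spoly m \<subseteq> spoly m'"
  unfolding spoly_def by (rule fs.span_mono) auto

lemma spoly_0: "spoly 0 = {\<lambda>x. 0}"
  by (simp add: spoly_def zero_fun_def)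

lemma spoly_induct [consumes 1, case_names zero step]:
  assumes "f \<in> spoly m" "P (\<lambda>x. 0)"
    "\<And>c e g. (\<Sum>b\<in>Basis. e b) < m \<Longrightarrow> g \<in> spoly m \<Longrightarrow> P g \<Longrightarrow> P (\<lambda>x. c * smono e x + g x)"
  shows "P f"
proof -
  have "f \<in> spoly m \<and> P f"
    using assms(1) unfolding spoly_def
  proof (induction rule: fs.span_induct_alt)
    case base
    then show ?case using assms(2) by (simp add: fs.span_zero flip: zero_fun_def)
  next
    case (step c x y)
    then obtain e where e: "x = smono e" "(\<Sum>b\<in>Basis. e b) < m" by auto
    then have "fun_scale c x + y = (\<lambda>z. c * smono e z + y z)"
      by (auto simp: fun_scale_def)
    moreover have "fun_scale c x + y \<in> fs.span {smono e | e. (\<Sum>b\<in>Basis. e b) < m}"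
      using step by (intro fs.span_add[OF fs.span_scale[OF fs.span_base]]) auto
    ultimately show ?case
      using assms(3)[OF e(2), of y c] step by (simp add: spoly_def)
  qed
  then show ?thesis ..
qed

lemma smono_off_sphere [simp]: "norm x \<noteq> 1 \<Longrightarrow> smono e x = 0"
  by (simp add: smono_def)

lemma spoly_off_sphere: "f \<in> spoly m \<Longrightarrow> norm x \<noteq> 1 \<Longrightarrow> f x = 0"
  by (induction rule: spoly_induct) (auto simp: smono_def)

lemma smono_mult: "smono e x * smono e' x = smono (\<lambda>b. e b + e' b) x"
  by (simp add: smono_def power_add prod.distrib)

lemma spoly_mult:
  assumes "f \<in> spoly (Suc m)" "g \<in> spoly (Suc n)"
  shows "(\<lambda>x. f x * g x) \<in> spoly (Suc (m + n))"
  using assms(1)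
proof (induction rule: spoly_induct)
  case (step c e f)
  have "(\<lambda>x. smono e x * g x) \<in> spoly (Suc (m + n))"
    using assms(2)
  proof (induction rule: spoly_induct)
    case (step c e' g)
    have "smono (\<lambda>b. e b + e' b) \<in> spoly (Suc (m + n))"
      using step \<open>sum e Basis < Suc m\<close> by (intro smono_in_spoly) (simp add: sum.distrib)
    then have "(\<lambda>x. c * smono (\<lambda>b. e b + e' b) x + smono e x * g x) \<in> spoly (Suc (m + n))"
      using step by (intro spoly_add spoly_scale)
    then show ?case by (simp add: smono_mult[symmetric] algebra_simps)
  qed (simp add: spoly_zero)
  then have "(\<lambda>x. c * (smono e x * g x) + f x * g x) \<in> spoly (Suc (m + n))"
    using step by (intro spoly_add spoly_scale)
  then show ?case by (simp add: algebra_simps)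
qed (simp add: spoly_zero)

lemma spoly_const: "(\<lambda>x. if norm x = 1 then c else 0) \<in> spoly (Suc m)"
  using spoly_scale[OF smono_in_spoly[of "\<lambda>b. 0" "Suc m"], of c]
  by (simp add: smono_def if_distrib cong: if_cong)

lemma smono_Suc:
  assumes "c \<in> Basis" "e c = Suc k"
  shows "smono e x = (x \<bullet> c) * smono (e(c := k)) x"
proof -
  have "(\<Prod>b\<in>Basis. (x \<bullet> b) ^ e b) = (x \<bullet> c) * (\<Prod>b\<in>Basis. (x \<bullet> b) ^ (e(c := k)) b)"
    using assms by (simp add: prod.remove[of _ c])
  then show ?thesis by (simp add: smono_def)
qed

lemma spoly_inner: "(\<lambda>x. if norm x = 1 then x \<bullet> c else 0) \<in> spoly (Suc (Suc m))"
proof -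
  have "smono (\<lambda>b. if b = c then 1 else 0) = (\<lambda>x. if norm x = 1 then x \<bullet> c else 0)"
    if "c \<in> Basis" for c :: 'a
    using that by (auto simp: smono_def if_distrib prod.If_cases cong: if_cong)
  then have B: "(\<lambda>x. if norm x = 1 then x \<bullet> c else 0) \<in> spoly (Suc (Suc m))" if "c \<in> Basis" for c :: 'a
    using that smono_in_spoly[of "\<lambda>b. if b = c then 1 else 0"] by simp
  have "(\<lambda>x. \<Sum>b\<in>Basis. (c \<bullet> b) * (if norm x = 1 then x \<bullet> b else 0)) \<in> spoly (Suc (Suc m))"
    by (intro spoly_sum spoly_scale B)
  also have "(\<lambda>x. \<Sum>b\<in>Basis. (c \<bullet> b) * (if norm x = 1 then x \<bullet> b else 0))
    = (\<lambda>x. if norm x = 1 then x \<bullet> c else 0)"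
    by (auto simp: fun_eq_iff euclidean_inner[of _ c] mult.commute)
  finally show ?thesis .
qed

lemma spoly_inner_mult:
  assumes "f \<in> spoly m" shows "(\<lambda>x. (x \<bullet> c) * f x) \<in> spoly (Suc m)"
proof (cases m)
  case 0
  with assms show ?thesis by (simp add: spoly_0 spoly_zero)
next
  case (Suc k)
  have "(\<lambda>x. (if norm x = 1 then x \<bullet> c else 0) * f x) \<in> spoly (Suc (Suc 0 + k))"
    using assms by (intro spoly_mult spoly_inner) (simp add: Suc)
  also have "(\<lambda>x. (if norm x = 1 then x \<bullet> c else 0) * f x) = (\<lambda>x. (x \<bullet> c) * f x)"
    using spoly_off_sphere[OF assms] by (auto simp: fun_eq_iff)
  finally show ?thesis by (simp add: Suc)
qed

text \<open>A monomial of positive degree is a coordinate times a monomial of one degree less. The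
  induction tracks the degree, and its step matches the Leibniz rule for a linear factor.\<close>

lemma smono_degree_induct [consumes 1, case_names zero Suc]:
  fixes e :: "'a::euclidean_space \<Rightarrow> nat"
  assumes "(\<Sum>b\<in>Basis. e b) = m"
    "P 0 (\<lambda>x. if norm x = 1 then 1 else 0)"
    "\<And>m c e. (\<Sum>b\<in>Basis. e b) = m \<Longrightarrow> P m (smono e) \<Longrightarrow> P (Suc m) (\<lambda>x. (x \<bullet> c) * smono e x)"
  shows "P m (smono e)"
  using assms(1)
proof (induction m arbitrary: e)
  case 0
  then have "smono e = (\<lambda>x. if norm x = 1 then 1 else 0)"
    by (auto simp: smono_def fun_eq_iff)
  with assms(2) show ?case by simp
next
  case (Suc m)
  then obtain c where c: "c \<in> Basis" "e c \<noteq> 0"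
    by (metis nat.simps(3) sum.neutral)
  then obtain k where k: "e c = Suc k" using not0_implies_Suc by blast
  have "(\<Sum>b\<in>Basis. (e(c := k)) b) = m"
    using Suc.prems c k by (simp add: sum.remove[of _ c])
  with Suc.IH assms(3) have "P (Suc m) (\<lambda>x. (x \<bullet> c) * smono (e(c := k)) x)" by blast
  also have "(\<lambda>x. (x \<bullet> c) * smono (e(c := k)) x) = smono e"
    using smono_Suc[of c e k] c(1) k by auto
  finally show ?case .
qed

lemma smooth_smono: "smooth_on_sphere (smono e)"
proof (rule smono_degree_induct[OF refl, where P = "\<lambda>m. smooth_on_sphere"])
  show "smooth_on_sphere (\<lambda>x. if norm x = 1 then 1 else 0)"
    by (rule smooth_on_sphere_cong[OF _ smooth_on_sphere_const[of 1]]) auto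
qed (intro smooth_on_sphere_mult smooth_on_sphere_inner)

lemma smooth_spoly: "f \<in> spoly m \<Longrightarrow> smooth_on_sphere f"
  by (induction rule: spoly_induct)
    (auto intro!: smooth_on_sphere_const smooth_on_sphere_add smooth_on_sphere_mult smooth_smono)

section \<open>Derivatives and Laplacian of polynomials\<close>

lemma sderiv_inner_mult:
  assumes "smooth_on_sphere f"
  shows "sderiv b (\<lambda>x. (x \<bullet> c) * f x) x
    = (x \<bullet> c) * sderiv b f x + (if norm x = 1 then (b \<bullet> c - (x \<bullet> b) * (x \<bullet> c)) * f x else 0)"
  using assms by (simp add: sderiv_mult smooth_on_sphere_inner sderiv_inner)

lemma sderiv_if_const [simp]: "sderiv b (\<lambda>x. if norm x = 1 then c else 0) x = 0"
proof -
  have "sderiv b (\<lambda>x. c) = sderiv b (\<lambda>x. if norm x = 1 then c else 0)"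
    by (rule sderiv_cong) (auto intro: smooth_on_sphere_const)
  then show ?thesis by (metis sderiv_const)
qed

text \<open>The radial extension of a monomial \<open>f\<close> of degree \<open>m\<close> is
  \<open>f / norm^m\<close>; the quotient rule gives the ordinary partial derivative, of lower
  degree, minus \<open>m (x \<bullet> b) f\<close>.\<close>

lemma sderiv_smono:
  assumes "(\<Sum>b\<in>Basis. e b) = m"
  shows "(\<lambda>x. sderiv b (smono e) x + real m * ((x \<bullet> b) * smono e x)) \<in> spoly m"
  using assms
proof (induction rule: smono_degree_induct)
  case zero
  show ?case by (simp add: spoly_zero)
next
  case (Suc m c e)
  have "(\<lambda>x. (x \<bullet> c) * (sderiv b (smono e) x + real m * ((x \<bullet> b) * smono e x)) + (b \<bullet> c) * smono e x)
    \<in> spoly (Suc m)"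
    by (rule spoly_add[OF spoly_inner_mult[OF Suc(2)] spoly_scale[OF smono_in_spoly]]) (use Suc(1) in auto)
  also have "(\<lambda>x. (x \<bullet> c) * (sderiv b (smono e) x + real m * ((x \<bullet> b) * smono e x)) + (b \<bullet> c) * smono e x)
    = (\<lambda>x. sderiv b (\<lambda>x. (x \<bullet> c) * smono e x) x + real (Suc m) * ((x \<bullet> b) * ((x \<bullet> c) * smono e x)))"
    unfolding sderiv_inner_mult[OF smooth_smono] by (auto simp: fun_eq_iff algebra_simps)
  finally show ?case .
qed

lemma slap_zero [simp]: "slap (\<lambda>x. 0) x = 0"
proof -
  have "sderiv b (\<lambda>x. 0) = (\<lambda>x. 0)" for b :: 'a by auto
  then show ?thesis by (simp add: slap_def)
qed

lemma slap_add:
  assumes "smooth_on_sphere f" "smooth_on_sphere g"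
  shows "slap (\<lambda>x. f x + g x) x = slap f x + slap g x"
proof -
  have "sderiv b (\<lambda>x. f x + g x) = (\<lambda>x. sderiv b f x + sderiv b g x)" for b
    using sderiv_add[OF assms] by auto
  then show ?thesis
    using assms by (simp add: slap_def sderiv_add smooth_on_sphere_sderiv sum.distrib)
qed

lemma slap_cmult:
  assumes "smooth_on_sphere f"
  shows "slap (\<lambda>x. c * f x) x = c * slap f x"
proof -
  have "sderiv b (\<lambda>x. c * f x) = (\<lambda>x. c * sderiv b f x)" for b
    using sderiv_cmult[OF assms] by auto
  then show ?thesis
    using assms by (simp add: slap_def sderiv_cmult smooth_on_sphere_sderiv sum_distrib_left)
qed

lemma slap_diff:
  assumes "smooth_on_sphere f" "smooth_on_sphere g"
  shows "slap (\<lambda>x. f x - g x) x = slap f x - slap g x"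
  using slap_add[OF assms(1) smooth_on_sphere_mult[OF smooth_on_sphere_const[of "-1"] assms(2)], of x]
    slap_cmult[OF assms(2), of "-1" x] by simp

lemma slap_sum:
  assumes "\<And>i. i \<in> I \<Longrightarrow> smooth_on_sphere (f i)"
  shows "slap (\<lambda>x. \<Sum>i\<in>I. f i x) x = (\<Sum>i\<in>I. slap (f i) x)"
  using assms
proof (induction I rule: infinite_finite_induct)
  case (insert i I)
  then show ?case by (simp add: slap_add smooth_on_sphere_sum)
qed simp_all

lemma slap_mult:
  assumes "smooth_on_sphere f" "smooth_on_sphere g"
  shows "slap (\<lambda>x. f x * g x) x
    = f x * slap g x + slap f x * g x + 2 * (\<Sum>b\<in>Basis. sderiv b f x * sderiv b g x)"
proof -
  have "sderiv b (\<lambda>x. f x * g x) = (\<lambda>x. f x * sderiv b g x + sderiv b f x * g x)" for b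
    using sderiv_mult[OF assms] by auto
  then show ?thesis
    using assms
    by (simp add: slap_def sderiv_add sderiv_mult smooth_on_sphere_mult smooth_on_sphere_sderiv
        sum.distrib sum_distrib_left sum_distrib_right algebra_simps)
qed

text \<open>The case of degree 1, where \<open>sev\<close> is \<open>DIM('a) - 1\<close>; it feeds
  the induction over monomials.\<close>

lemma slap_inner:
  fixes x :: "'a::euclidean_space"
  assumes "norm x = 1"
  shows "slap (\<lambda>x. x \<bullet> c) x = - (real DIM('a) - 1) * (x \<bullet> c)"
proof -
  \<comment> \<open>Over the orthonormal basis the three terms add up to 2, \<open>- DIM('a)\<close>
    and -1 times \<open>x \<bullet> c\<close>.\<close>
  have eq: "sderiv b (sderiv b (\<lambda>x. x \<bullet> c)) x = (x \<bullet> b)^2 * (x \<bullet> c) * 2 - (x \<bullet> c) * (b \<bullet> b) - (b \<bullet> c) * (x \<bullet> b)" for b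
  proof -
    have "sderiv b (\<lambda>x. b \<bullet> c - (x \<bullet> b) * (x \<bullet> c)) = sderiv b (sderiv b (\<lambda>x. x \<bullet> c))"
      by (rule sderiv_cong)
        (auto simp: sderiv_inner intro!: smooth_on_sphere_diff smooth_on_sphere_const
           smooth_on_sphere_mult smooth_on_sphere_inner)
    moreover have "sderiv b (\<lambda>x. b \<bullet> c - (x \<bullet> b) * (x \<bullet> c)) x
      = (x \<bullet> b)^2 * (x \<bullet> c) * 2 - (x \<bullet> c) * (b \<bullet> b) - (b \<bullet> c) * (x \<bullet> b)"
      using assms
      by (subst sderiv_diff)
       (auto simp: sderiv_mult sderiv_inner smooth_on_sphere_const
           smooth_on_sphere_mult smooth_on_sphere_inner algebra_simps power2_eq_square)
    ultimately show ?thesis by simp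
  qed
  have "(\<Sum>b\<in>Basis. (x \<bullet> b)^2) = 1"
    using assms by (simp add: power2_eq_square norm_eq_1 flip: euclidean_inner)
  moreover have "(\<Sum>b\<in>Basis. (b \<bullet> c) * (x \<bullet> b)) = x \<bullet> c"
    unfolding euclidean_inner[of x c] by (intro sum.cong refl) (metis inner_commute mult.commute)
  ultimately show ?thesis
    unfolding slap_def eq
    by (simp add: sum_subtractf flip: sum_distrib_left sum_distrib_right)
      (simp add: algebra_simps)
qed

text \<open>The eigenvalues of the sphere of dimension \<open>DIM('a) - 1\<close>.\<close>

definition sev :: "'a::euclidean_space itself \<Rightarrow> nat \<Rightarrow> real" where
  "sev _ k = real k * (real k + real DIM('a) - 2)"

text \<open>A further linear factor contributes \<open>DIM('a) - 1\<close> from its own Laplacian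
  and \<open>2 m\<close> from the gradient product, modulo lower degree; indeed
  \<open>sev (m + 1) = sev m + (DIM('a) - 1) + 2 m\<close>.\<close>

lemma slap_smono:
  fixes e :: "'a::euclidean_space \<Rightarrow> nat"
  assumes "(\<Sum>b\<in>Basis. e b) = m"
  shows "(\<lambda>x. slap (smono e) x + sev TYPE('a) m * smono e x) \<in> spoly m"
  using assms
proof (induction rule: smono_degree_induct)
  case zero
  have "sderiv b (\<lambda>x::'a. if norm x = 1 then 1 else 0) = (\<lambda>x. 0)" for b by auto
  then have "slap (\<lambda>x::'a. if norm x = 1 then 1 else 0) x = 0" for x
    by (simp add: slap_def)
  then show ?case by (simp add: sev_def spoly_zero)
next
  case (Suc m c e)
  have sl: "slap (\<lambda>x. (x \<bullet> c) * smono e x) x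
    = (x \<bullet> c) * slap (smono e) x - (real DIM('a) - 1) * (x \<bullet> c) * smono e x + 2 * sderiv c (smono e) x"
    if "norm x = 1" for x
  proof -
    \<comment> \<open>The normal correction in the gradient of \<open>x \<bullet> c\<close> drops
      out because the other gradient is tangential; what remains is the derivative along
      \<open>c\<close>.\<close>
    have "(\<Sum>b\<in>Basis. sderiv b (\<lambda>x. x \<bullet> c) x * sderiv b (smono e) x)
      = (\<Sum>b\<in>Basis. (c \<bullet> b) * sderiv b (smono e) x)
        - (x \<bullet> c) * (\<Sum>b\<in>Basis. (x \<bullet> b) * sderiv b (smono e) x)"
      using that by (simp add: sderiv_inner algebra_simps sum_subtractf sum_distrib_left inner_commute)
    also have "\<dots> = (\<Sum>b\<in>Basis. (c \<bullet> b) * sderiv b (smono e) x)"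
      using sderiv_tangential[OF smooth_smono[of e], of x] by simp
    also have "\<dots> = sderiv (\<Sum>b\<in>Basis. (c \<bullet> b) *\<^sub>R b) (smono e) x"
      using linear_sum[OF linear_sderiv[OF smooth_smono[of e], of x], of "\<lambda>b. (c \<bullet> b) *\<^sub>R b" Basis]
        linear_scale[OF linear_sderiv[OF smooth_smono[of e], of x]] by simp
    finally show ?thesis
      using that by (simp add: slap_mult smooth_on_sphere_inner smooth_smono slap_inner
          euclidean_representation algebra_simps)
  qed
  have "(\<lambda>x. ((x \<bullet> c) * (slap (smono e) x + sev TYPE('a) m * smono e x))
    + 2 * (sderiv c (smono e) x + real m * ((x \<bullet> c) * smono e x))) \<in> spoly (Suc m)"
    using spoly_mono[of m "Suc m"] sderiv_smono[OF Suc(1), of c]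
    by (intro spoly_add[OF spoly_inner_mult[OF Suc(2)] spoly_scale] subsetD[of "spoly m" "spoly (Suc m)"]) auto
  also have "(\<lambda>x. ((x \<bullet> c) * (slap (smono e) x + sev TYPE('a) m * smono e x))
    + 2 * (sderiv c (smono e) x + real m * ((x \<bullet> c) * smono e x)))
    = (\<lambda>x. slap (\<lambda>x. (x \<bullet> c) * smono e x) x + sev TYPE('a) (Suc m) * ((x \<bullet> c) * smono e x))"
  proof
    fix x show "((x \<bullet> c) * (slap (smono e) x + sev TYPE('a) m * smono e x))
    + 2 * (sderiv c (smono e) x + real m * ((x \<bullet> c) * smono e x))
    = slap (\<lambda>x. (x \<bullet> c) * smono e x) x + sev TYPE('a) (Suc m) * ((x \<bullet> c) * smono e x)"
    proof (cases "norm x = 1")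
      case True
      show ?thesis unfolding sl[OF True] sev_def by (simp add: algebra_simps)
    qed simp
  qed
  finally show ?case .
qed

text \<open>Both the degree bounds for eigenfunctions and the decomposition of polynomials into
  eigenfunctions rest on this triangular form.\<close>

lemma slap_spoly:
  fixes f :: "'a::euclidean_space \<Rightarrow> real"
  assumes "f \<in> spoly (Suc m)"
  shows "(\<lambda>x. slap f x + sev TYPE('a) m * f x) \<in> spoly m"
  using assms
proof (induction rule: spoly_induct)
  case zero
  have "(\<lambda>x::'a. slap (\<lambda>x. 0) x + sev TYPE('a) m * 0) = (\<lambda>x. 0)" by simp
  then show ?case by (simp only: spoly_zero)
next
  case (step c e g)
  have "(\<lambda>x. slap (smono e) x + sev TYPE('a) m * smono e x) \<in> spoly m"
  proof (cases "sum e Basis = m")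
    case True then show ?thesis by (rule slap_smono)
  next
    case False
    \<comment> \<open>Below the top degree, replacing \<open>sev k\<close> by \<open>sev m\<close>
      only adds a multiple of \<open>smono e\<close>, which already lies in
      \<open>spoly m\<close>.\<close>
    define k where "k = sum e Basis"
    have k: "k < m" using False step(1) by (simp add: k_def)
    have "(\<lambda>x. slap (smono e) x + sev TYPE('a) k * smono e x) \<in> spoly m"
      using slap_smono[of e k] k_def k spoly_mono[of k m] by auto
    moreover have "smono e \<in> spoly m" using k by (intro smono_in_spoly) (simp add: k_def)
    ultimately have "(\<lambda>x. (slap (smono e) x + sev TYPE('a) k * smono e x)
      + (sev TYPE('a) m - sev TYPE('a) k) * smono e x) \<in> spoly m"
      by (rule spoly_add[OF _ spoly_scale])
    then show ?thesis by (simp add: algebra_simps)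
  qed
  then have "(\<lambda>x. c * (slap (smono e) x + sev TYPE('a) m * smono e x) + (slap g x + sev TYPE('a) m * g x))
    \<in> spoly m"
    by (rule spoly_add[OF spoly_scale step(3)])
  moreover have "smooth_on_sphere g" using step(2) smooth_spoly by blast
  then have "slap (\<lambda>x. c * smono e x + g x) x = c * slap (smono e) x + slap g x" for x
    using slap_add[of "\<lambda>x. c * smono e x" g x] slap_cmult[OF smooth_smono, of c e x]
    by (simp add: smooth_on_sphere_mult smooth_on_sphere_const smooth_smono)
  ultimately show ?case
    by (simp add: distrib_left add.assoc add.left_commute mult.left_commute)
qed

section \<open>The divergence theorem on the sphere\<close>

lemma integrable_compact_support:
  fixes f :: "'a::euclidean_space \<Rightarrow> real"
  assumes "continuous_on UNIV f" "\<And>x. norm x > R \<Longrightarrow> f x = 0"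
  shows "integrable lborel f"
proof -
  have "integrable lborel (\<lambda>x. indicator (cball 0 R) x *\<^sub>R f x)"
    using assms(1) by (intro borel_integrable_compact) (auto intro: continuous_on_subset)
  moreover have "(\<lambda>x. indicator (cball 0 R) x *\<^sub>R f x) = f"
    using assms(2) by (auto simp: fun_eq_iff indicator_def not_le)
  ultimately show ?thesis by simp
qed

lemma integral_lborel_translate:
  fixes f :: "'a::euclidean_space \<Rightarrow> real"
  assumes "f \<in> borel_measurable borel"
  shows "(\<integral>x. f (x + c) \<partial>lborel) = (\<integral>x. f x \<partial>lborel)"
proof -
  have "(\<integral>x. f x \<partial>lborel) = (\<integral>x. f x \<partial>distr lborel borel ((+) c))"
    by (simp add: lborel_distr_plus)
  also have "\<dots> = (\<integral>x. f (c + x) \<partial>lborel)"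
    using assms by (intro integral_distr) auto
  finally show ?thesis by (simp add: add.commute)
qed

text \<open>Difference quotients have integral 0 by translation invariance. The mean value theorem
  bounds them by a constant on a fixed ball, so dominated convergence carries this over to the
  derivative.\<close>

lemma integral_directional_derivative:
  fixes w :: "'a::euclidean_space \<Rightarrow> real"
  assumes w: "\<And>x. (w has_derivative w' x) (at x)"
    and cont: "continuous_on UNIV (\<lambda>x. w' x b)"
    and supp: "\<And>x. norm x > R \<Longrightarrow> w x = 0"
  shows "(\<integral>x. w' x b \<partial>lborel) = 0"
proof -
  have contw: "continuous_on UNIV w"
    by (intro continuous_at_imp_continuous_on ballI has_derivative_continuous[OF w])
  have line: "((\<lambda>t. w (x + t *\<^sub>R b)) has_real_derivative w' (x + t *\<^sub>R b) b) (at t)" for x t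
  proof -
    have "((\<lambda>t. x + t *\<^sub>R b) has_derivative (\<lambda>t. t *\<^sub>R b)) (at t)"
      by (auto intro!: derivative_eq_intros)
    from diff_chain_at[OF this w]
    have "((\<lambda>t. w (x + t *\<^sub>R b)) has_derivative (\<lambda>s. w' (x + t *\<^sub>R b) (s *\<^sub>R b))) (at t)"
      by (simp add: comp_def)
    moreover have "linear (w' (x + t *\<^sub>R b))" using w has_derivative_linear by blast
    ultimately show ?thesis
      by (simp add: has_field_derivative_def linear_scale mult.commute[of _ "w' _ _"])
  qed
  have w'0: "w' x b = 0" if "norm x > R" for x
  proof -
    have "(w has_derivative (\<lambda>v. 0)) (at x)"
    proof (rule has_derivative_transform_within_open[OF has_derivative_const])
      show "open {x. norm x > R}" by (intro open_Collect_less continuous_intros)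
    qed (use that supp in auto)
    then show ?thesis using w has_derivative_unique by metis
  qed
  obtain M where M: "\<And>x. \<bar>w' x b\<bar> \<le> M" "0 \<le> M"
  proof -
    have "compact ((\<lambda>x. w' x b) ` cball 0 R)"
      by (intro compact_continuous_image continuous_on_subset[OF cont]) auto
    then obtain M where "\<And>x. x \<in> cball 0 R \<Longrightarrow> \<bar>w' x b\<bar> \<le> M"
      using compact_imp_bounded by (force simp: bounded_iff)
    then have "\<bar>w' x b\<bar> \<le> max M 0" for x
      using w'0[of x] by (cases "norm x \<le> R") (auto simp: not_le le_max_iff_disj)
    then show ?thesis using that by (metis max.cobounded2)
  qed
  \<comment> \<open>Step sizes at most 1 keep the supports of all difference quotients in the ball
    of radius \<open>R + norm b\<close>.\<close>
  define h :: "nat \<Rightarrow> real" where "h n = inverse (real (Suc n))" for n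
  have h: "0 < h n" "h n \<le> 1" for n by (auto simp: h_def field_simps)
  have h0: "h \<longlonglongrightarrow> 0" unfolding h_def by (rule LIMSEQ_inverse_real_of_nat)
  define s where "s n x = (w (x + h n *\<^sub>R b) - w x) / h n" for n x
  have int: "integrable lborel w" "integrable lborel (\<lambda>x. w (x + c))" for c
  proof -
    show "integrable lborel w" using contw supp by (rule integrable_compact_support)
    show "integrable lborel (\<lambda>x. w (x + c))"
    proof (rule integrable_compact_support)
      show "continuous_on UNIV (\<lambda>x. w (x + c))"
        by (rule continuous_on_compose2[OF contw]) (auto intro!: continuous_intros)
      show "w (x + c) = 0" if "R + norm c < norm x" for x
        using that norm_triangle_ineq2[of x "- c"] by (intro supp) auto
    qed
  qed
  have s0: "(\<integral>x. s n x \<partial>lborel) = 0" for n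
    unfolding s_def using int integral_lborel_translate[of w "h n *\<^sub>R b"]
    by (simp add: borel_measurable_continuous_onI[OF contw])
  have "(\<lambda>n. \<integral>x. s n x \<partial>lborel) \<longlonglongrightarrow> (\<integral>x. w' x b \<partial>lborel)"
  proof (rule integral_dominated_convergence)
    show "(\<lambda>x. w' x b) \<in> borel_measurable lborel"
      using borel_measurable_continuous_onI[OF cont] by simp
    show "s n \<in> borel_measurable lborel" for n
      unfolding s_def using int by (auto intro!: borel_measurable_integrable)
    show "integrable lborel (\<lambda>x::'a. M * indicator (cball 0 (R + norm b)) x)"
      using borel_integrable_compact[of "cball (0::'a) (R + norm b)" "\<lambda>x. M"]
      by (simp add: mult.commute)
    show "AE x in lborel. (\<lambda>n. s n x) \<longlonglongrightarrow> w' x b"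
    proof (rule AE_I2)
      fix x
      have "((\<lambda>t. (w (x + t *\<^sub>R b) - w x) / t) \<longlongrightarrow> w' x b) (at 0)"
        using line[of x 0] by (simp add: has_field_derivative_iff)
      then have "(\<lambda>n. (w (x + h n *\<^sub>R b) - w x) / h n) \<longlonglongrightarrow> w' x b"
        using h0 h(1) by (elim filterlim_compose)
          (auto simp: filterlim_at less_imp_neq[symmetric] intro!: always_eventually less_imp_neq[THEN not_sym])
      then show "(\<lambda>n. s n x) \<longlonglongrightarrow> w' x b" by (simp add: s_def)
    qed
    show "AE x in lborel. norm (s n x) \<le> M * indicator (cball 0 (R + norm b)) x" for n
    proof (rule AE_I2)
      fix x :: 'a
      show "norm (s n x) \<le> M * indicator (cball 0 (R + norm b)) x"
      proof (cases "norm x \<le> R + norm b")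
        case True
        obtain z where "w (x + h n *\<^sub>R b) - w (x + 0 *\<^sub>R b) = (h n - 0) * w' (x + z *\<^sub>R b) b"
          using MVT2[OF h(1)[of n], of "\<lambda>t. w (x + t *\<^sub>R b)" "\<lambda>t. w' (x + t *\<^sub>R b) b"] line by blast
        then have "s n x = w' (x + z *\<^sub>R b) b" using h(1)[of n] by (simp add: s_def)
        then show ?thesis using M(1) True by (simp add: indicator_def)
      next
        case False
        have "norm (h n *\<^sub>R b) \<le> norm b" using h[of n] by (simp add: mult_left_le_one_le)
        then have "norm (x + h n *\<^sub>R b) > R" "norm x > R"
          using False norm_triangle_ineq2[of x "- (h n *\<^sub>R b)"] norm_ge_zero[of b]
          by (auto simp del: norm_ge_zero)
        then show ?thesis using supp False by (simp add: s_def)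
      qed
    qed
  qed
  then show ?thesis using s0 by (simp add: LIMSEQ_const_iff)
qed

text \<open>Squaring makes the positive part continuously differentiable, which suffices for a
  cut-off in the divergence theorem.\<close>

lemma has_real_derivative_max_0_power2:
  "((\<lambda>t::real. (max 0 t)\<^sup>2) has_real_derivative 2 * max 0 t) (at t)"
proof (cases t "0::real" rule: linorder_cases)
  case less
  have "((\<lambda>t. 0) has_real_derivative 2 * max 0 t) (at t)" using less by simp
  then show ?thesis
    by (rule has_field_derivative_transform_within_open[of _ _ _ "{..<0}"]) (use less in auto)
next
  case greater
  have "((\<lambda>t. t\<^sup>2) has_real_derivative 2 * max 0 t) (at t)"
    using greater by (auto intro!: derivative_eq_intros)
  then show ?thesis
    by (rule has_field_derivative_transform_within_open[of _ _ _ "{0<..}"]) (use greater in auto)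
next
  case equal
  have "((\<lambda>y::real. max 0 y) \<longlongrightarrow> max 0 0) (at 0)"
    by (intro tendsto_intros)
  then have "((\<lambda>y::real. (max 0 y)\<^sup>2 / y) \<longlongrightarrow> 0) (at 0)"
    by (rule filterlim_mono_eventually)
      (auto simp: eventually_at_filter max_def power2_eq_square intro!: always_eventually)
  then show ?thesis using equal by (simp add: has_field_derivative_iff)
qed

text \<open>A radial cut-off function supported on the annulus \<open>1 \<le> norm x \<le> 2\<close>: integrals over the
  sphere are replaced by weighted integrals of radial extensions.\<close>

definition bump :: "'a::euclidean_space \<Rightarrow> real" where
  "bump x = (max 0 ((x \<bullet> x - 1) * (4 - x \<bullet> x)))\<^sup>2"

text \<open>The gradient of \<open>bump\<close> is \<open>bump' x\<close> times \<open>x\<close>,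
  hence orthogonal to tangential fields.\<close>

definition bump' :: "'a::euclidean_space \<Rightarrow> real" where
  "bump' x = 4 * max 0 ((x \<bullet> x - 1) * (4 - x \<bullet> x)) * (5 - 2 * (x \<bullet> x))"

text \<open>The factor \<open>1 / norm x\<close> reflects homogeneity of degree -1:
  \<open>bump\<close> times a derivative of a radial extension is \<open>swt\<close> times the value
  of that derivative on the sphere.\<close>

definition swt :: "'a::euclidean_space \<Rightarrow> real" where
  "swt x = bump x / norm x"

text \<open>In polar coordinates this is a fixed positive multiple of the surface integral.\<close>

definition sint :: "('a::euclidean_space \<Rightarrow> real) \<Rightarrow> real" where
  "sint f = (\<integral>x. swt x * f (sgn x) \<partial>lborel)"

lemma bump_has_derivative: "(bump has_derivative (\<lambda>v. bump' x * (x \<bullet> v))) (at x)"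
proof -
  have "((\<lambda>x::'a. (x \<bullet> x - 1) * (4 - x \<bullet> x)) has_derivative (\<lambda>v. 2 * (5 - 2 * (x \<bullet> x)) * (x \<bullet> v))) (at x)"
    by (auto intro!: derivative_eq_intros simp: fun_eq_iff inner_commute algebra_simps)
  from diff_chain_at[OF this has_real_derivative_max_0_power2[unfolded has_field_derivative_def]]
  have "(bump has_derivative
    (\<lambda>v. 2 * max 0 ((x \<bullet> x - 1) * (4 - x \<bullet> x)) * (2 * (5 - 2 * (x \<bullet> x)) * (x \<bullet> v)))) (at x)"
    by (simp add: comp_def bump_def [abs_def])
  then show ?thesis
    by (rule has_derivative_eq_rhs) (simp add: fun_eq_iff bump'_def)
qed

lemma continuous_on_bump: "continuous_on S bump" "continuous_on S bump'"
  unfolding bump_def bump'_def by (intro continuous_intros)+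

lemma annulus_prod_nonpos:
  fixes x :: "'a::euclidean_space"
  assumes "norm x \<le> 1 \<or> 2 \<le> norm x"
  shows "(x \<bullet> x - 1) * (4 - x \<bullet> x) \<le> 0"
proof -
  have "x \<bullet> x = (norm x)\<^sup>2" by (simp add: dot_square_norm)
  moreover have "(norm x)\<^sup>2 \<le> 1 \<or> 4 \<le> (norm x)\<^sup>2"
    using assms power_mono[of "norm x" 1 2] power_mono[of 2 "norm x" 2] by auto
  ultimately show ?thesis
    by (auto intro: mult_nonpos_nonneg mult_nonneg_nonpos)
qed

lemma bump_eq_0:
  assumes "norm x \<le> 1 \<or> 2 \<le> norm x"
  shows "bump x = 0" "bump' x = 0"
  using annulus_prod_nonpos[OF assms] by (simp_all add: bump_def bump'_def)

lemma bump_nonneg: "0 \<le> bump x"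
  by (simp add: bump_def)

lemma swt_eq_0: "norm x \<le> 1 \<or> 2 \<le> norm x \<Longrightarrow> swt x = 0"
  by (simp add: swt_def bump_eq_0)

lemma swt_nonneg: "0 \<le> swt x"
  by (simp add: swt_def bump_nonneg)

lemma continuous_on_swt: "0 \<notin> S \<Longrightarrow> continuous_on S swt"
  unfolding swt_def [abs_def] by (intro continuous_intros continuous_on_bump) auto

text \<open>Radial extensions may be discontinuous at the origin; the weight removes the unit
  ball.\<close>

lemma continuous_on_glue:
  fixes F :: "'a::euclidean_space \<Rightarrow> real"
  assumes "continuous_on (- {0}) F" "\<And>x. norm x < 1 \<Longrightarrow> F x = 0"
  shows "continuous_on UNIV F"
proof -
  have "continuous_on (ball 0 1) F"
    using continuous_on_const[of "ball 0 1" 0] by (rule continuous_on_eq) (use assms in auto)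
  then have "continuous_on (- {0} \<union> ball 0 1) F"
    using assms(1) by (intro continuous_on_open_Un) auto
  moreover have "- {0} \<union> ball 0 1 = (UNIV :: 'a set)" by auto
  ultimately show ?thesis by simp
qed

lemma smooth_continuous_on_radial:
  assumes "smooth_on_sphere f"
  shows "continuous_on (- {0}) (radial f)"
proof -
  have "Ck_on 0 (- {0}) (radial f)"
    using assms unfolding smooth_on_sphere_def smooth_on_def by blast
  then show ?thesis by simp
qed

lemma smooth_continuous_on_sphere:
  assumes "smooth_on_sphere f"
  shows "continuous_on (sphere 0 1) f"
proof -
  have "continuous_on (sphere 0 1) (radial f)"
    using smooth_continuous_on_radial[OF assms] by (rule continuous_on_subset) auto
  then show ?thesis
    by (rule continuous_on_eq) (auto simp: radial_def sgn_div_norm)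
qed

lemma continuous_on_weighted:
  assumes "smooth_on_sphere f"
  shows "continuous_on UNIV (\<lambda>x. swt x * f (sgn x))"
  using smooth_continuous_on_radial[OF assms]
  by (intro continuous_on_glue continuous_intros continuous_on_swt)
    (auto simp: radial_def[abs_def] swt_eq_0)

lemma integrable_weighted:
  assumes "smooth_on_sphere f"
  shows "integrable lborel (\<lambda>x. swt x * f (sgn x))"
  by (rule integrable_compact_support[OF continuous_on_weighted[OF assms], of 2])
    (simp add: swt_eq_0)

lemma sint_cong:
  assumes "\<And>x. norm x = 1 \<Longrightarrow> f x = g x"
  shows "sint f = sint g"
proof -
  have "(\<lambda>x. swt x * f (sgn x)) = (\<lambda>x. swt x * g (sgn x))"
  proof
    show "swt x * f (sgn x) = swt x * g (sgn x)" for x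
      using assms[of "sgn x"] by (cases "x = 0") (auto simp: norm_sgn swt_eq_0)
  qed
  then show ?thesis by (simp add: sint_def)
qed

lemma sint_add:
  assumes "smooth_on_sphere f" "smooth_on_sphere g"
  shows "sint (\<lambda>x. f x + g x) = sint f + sint g"
  unfolding sint_def using assms
  by (simp add: distrib_left integrable_weighted)

lemma sint_diff:
  assumes "smooth_on_sphere f" "smooth_on_sphere g"
  shows "sint (\<lambda>x. f x - g x) = sint f - sint g"
  unfolding sint_def using assms
  by (simp add: right_diff_distrib integrable_weighted)

lemma sint_cmult: "sint (\<lambda>x. c * f x) = c * sint f"
  unfolding sint_def by (simp add: mult.left_commute)

lemma sint_bound:
  fixes f :: "'a::euclidean_space \<Rightarrow> real"
  assumes "smooth_on_sphere f" "\<And>x. norm x = 1 \<Longrightarrow> \<bar>f x\<bar> \<le> e"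
  shows "\<bar>sint f\<bar> \<le> e * sint (\<lambda>x::'a. 1)"
proof -
  have "\<bar>sint f\<bar> \<le> (\<integral>x. norm (swt x * f (sgn x)) \<partial>lborel)"
    unfolding sint_def real_norm_def[symmetric] by (rule integral_norm_bound)
  also have "\<dots> \<le> (\<integral>x. e * (swt x * 1) \<partial>(lborel :: 'a measure))"
  proof (rule integral_mono)
    fix x :: 'a
    show "norm (swt x * f (sgn x)) \<le> e * (swt x * 1)"
    proof (cases "x = 0")
      case False
      then have "\<bar>f (sgn x)\<bar> \<le> e" using assms(2) by (simp add: norm_sgn)
      then have "swt x * \<bar>f (sgn x)\<bar> \<le> swt x * e"
        by (rule mult_left_mono) (simp add: swt_nonneg)
      then show ?thesis
        by (simp add: abs_mult swt_nonneg mult.commute)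
    qed (simp add: swt_eq_0)
  next
    show "integrable lborel (\<lambda>x. norm (swt x * f (sgn x)))"
      using integrable_weighted[OF assms(1)] by (rule integrable_norm)
    show "integrable lborel (\<lambda>x::'a. e * (swt x * 1))"
      using integrable_weighted[OF smooth_on_sphere_const[of 1]] by (rule integrable_mult_right)
  qed
  finally show ?thesis by (simp add: sint_def)
qed

text \<open>A nonnegative continuous integrand with integral 0 is nonzero only on an open null set,
  that is, nowhere.\<close>

lemma sint_square_eq_0:
  fixes f :: "'a::euclidean_space \<Rightarrow> real"
  assumes "smooth_on_sphere f" "sint (\<lambda>x. f x * f x) = 0" "norm x = 1"
  shows "f x = 0"
proof -
  define H where "H x = swt x * (f (sgn x) * f (sgn x))" for x
  have sm: "smooth_on_sphere (\<lambda>x. f x * f x)"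
    using assms(1) by (intro smooth_on_sphere_mult)
  have cH: "continuous_on UNIV H" and iH: "integrable lborel H"
    unfolding H_def [abs_def]
    using continuous_on_weighted[OF sm] integrable_weighted[OF sm] by auto
  have "integral\<^sup>L lborel H = 0"
    using assms(2) by (simp add: H_def [abs_def] sint_def)
  moreover have "AE x in lborel. 0 \<le> H x"
    by (simp add: H_def swt_nonneg)
  ultimately have "AE x in lborel. H x = 0"
    using integral_nonneg_eq_0_iff_AE[OF iH] by blast
  moreover have op: "open {x. H x \<noteq> 0}"
    using cH by (intro open_Collect_neq continuous_on_const) auto
  ultimately have "{x. H x \<noteq> 0} \<in> null_sets lborel"
    using AE_iff_null_sets[of "{x. H x \<noteq> 0}" lborel] by simp
  then have "negligible {x. H x \<noteq> 0}"
    using null_sets_completionI negligible_iff_null_sets by blast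
  then have "{x. H x \<noteq> 0} = {}" using op open_not_negligible by blast
  \<comment> \<open>The factor 3/2 moves \<open>x\<close> along its ray into the interior of the
    annulus, where the weight is positive.\<close>
  then have "H ((3/2) *\<^sub>R x) = 0" by blast
  moreover have "bump ((3/2) *\<^sub>R x) \<noteq> 0"
    using assms(3) by (simp add: bump_def dot_square_norm power_divide)
  moreover have "sgn ((3/2) *\<^sub>R x) = x" using assms(3) by (simp add: sgn_div_norm)
  moreover have "x \<noteq> 0" using assms(3) by auto
  ultimately show ?thesis by (simp add: H_def swt_def)
qed

text \<open>\<open>bump\<close> times the radial extension of the field has compact support, so its
  divergence has integral 0. Differentiating the field yields \<open>swt\<close> times the spherical
  divergence; differentiating \<open>bump\<close> yields a multiple of the normal component, which
  vanishes.\<close>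

lemma sint_divergence:
  fixes X :: "'a::euclidean_space \<Rightarrow> 'a \<Rightarrow> real"
  assumes sm: "\<And>b. smooth_on_sphere (X b)"
    and tang: "\<And>x. norm x = 1 \<Longrightarrow> (\<Sum>b\<in>Basis. (x \<bullet> b) * X b x) = 0"
  shows "sint (\<lambda>x. \<Sum>b\<in>Basis. sderiv b (X b) x) = 0"
proof -
  define W where "W b x = bump x * radial (X b) x" for b x
  define W' where "W' b x v = (if x = 0 then 0 else
    bump x * frechet_derivative (radial (X b)) (at x) v + bump' x * (x \<bullet> v) * radial (X b) x)" for b x v
  have der: "(W b has_derivative W' b x) (at x)" for b x
  proof (cases "x = 0")
    case True
    have "(W b has_derivative (\<lambda>v. 0)) (at x)"
      by (rule has_derivative_transform_within_open[OF has_derivative_const, of "ball 0 1"])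
        (auto simp: True W_def bump_eq_0)
    then show ?thesis by (simp add: W'_def [abs_def] True)
  next
    case False
    show ?thesis
      using has_derivative_mult[OF bump_has_derivative radial_has_derivative[OF sm False], of b] False
      by (simp add: W_def [abs_def] W'_def [abs_def])
  qed
  have W'eq: "W' b x v = swt x * sderiv v (X b) (sgn x) + bump' x * (x \<bullet> v) * radial (X b) x"
    for b x v
    by (cases "x = 0") (simp_all add: W'_def swt_def bump_eq_0 frechet_derivative_radial[OF sm])
  have cont: "continuous_on UNIV (\<lambda>x. W' b x v)" for b v
    unfolding W'eq
  proof (rule continuous_on_glue)
    show "continuous_on (- {0}) (\<lambda>x. swt x * sderiv v (X b) (sgn x)
        + bump' x * (x \<bullet> v) * radial (X b) x)"
      using smooth_continuous_on_radial[OF smooth_on_sphere_sderiv[OF sm], of v b]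
        smooth_continuous_on_radial[OF sm, of b]
      by (intro continuous_intros continuous_on_bump continuous_on_swt) (auto simp: radial_def[abs_def])
  qed (simp add: bump_eq_0 swt_eq_0)
  have supp: "W b x = 0" if "norm x > 2" for b x
    using that by (simp add: W_def bump_eq_0)
  have int: "integrable lborel (\<lambda>x. W' b x v)" for b v
    by (rule integrable_compact_support[OF cont, of 2]) (simp add: W'eq bump_eq_0 swt_eq_0)
  have "(\<Sum>b\<in>Basis. W' b x b) = swt x * (\<Sum>b\<in>Basis. sderiv b (X b) (sgn x))" for x
  proof (cases "x = 0")
    case False
    have "(\<Sum>b\<in>Basis. (x \<bullet> b) * radial (X b) x) = norm x * (\<Sum>b\<in>Basis. (sgn x \<bullet> b) * X b (sgn x))"
    proof -
      have "x \<bullet> b = norm x * (sgn x \<bullet> b)" for b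
        using False by (simp add: sgn_div_norm)
      then show ?thesis by (simp only: radial_def sum_distrib_left mult.assoc)
    qed
    also have "\<dots> = 0" using tang[of "sgn x"] False by (simp add: norm_sgn)
    finally have "(\<Sum>b\<in>Basis. bump' x * (x \<bullet> b) * radial (X b) x) = 0"
      by (simp add: mult.assoc flip: sum_distrib_left)
    then show ?thesis by (simp add: W'eq sum.distrib sum_distrib_left)
  qed (simp add: W'_def swt_eq_0)
  then have "sint (\<lambda>x. \<Sum>b\<in>Basis. sderiv b (X b) x) = (\<integral>x. (\<Sum>b\<in>Basis. W' b x b) \<partial>lborel)"
    by (simp add: sint_def)
  also have "\<dots> = (\<Sum>b\<in>Basis. \<integral>x. W' b x b \<partial>lborel)"
    using int by simp
  also have "\<dots> = 0"
    using integral_directional_derivative[OF der cont supp] by simp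
  finally show ?thesis .
qed

text \<open>Green's identity: the tangential field \<open>f grad g - g grad f\<close> has divergence
  \<open>f slap g - g slap f\<close>, since the gradient products cancel.\<close>

lemma slap_symmetric:
  fixes f g :: "'a::euclidean_space \<Rightarrow> real"
  assumes "smooth_on_sphere f" "smooth_on_sphere g"
  shows "sint (\<lambda>x. f x * slap g x) = sint (\<lambda>x. slap f x * g x)"
proof -
  define X where "X b x = f x * sderiv b g x - sderiv b f x * g x" for b x
  have sm: "smooth_on_sphere (X b)" for b
    unfolding X_def [abs_def] using assms
    by (intro smooth_on_sphere_diff smooth_on_sphere_mult smooth_on_sphere_sderiv)
  have "sint (\<lambda>x. \<Sum>b\<in>Basis. sderiv b (X b) x) = 0"
  proof (rule sint_divergence[OF sm])
    fix x :: 'a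
    have "(\<Sum>b\<in>Basis. (x \<bullet> b) * X b x)
      = f x * (\<Sum>b\<in>Basis. (x \<bullet> b) * sderiv b g x) - g x * (\<Sum>b\<in>Basis. (x \<bullet> b) * sderiv b f x)"
      by (simp add: X_def sum_distrib_left algebra_simps sum_subtractf)
    then show "(\<Sum>b\<in>Basis. (x \<bullet> b) * X b x) = 0"
      using assms by (simp add: sderiv_tangential)
  qed
  also have "(\<lambda>x. \<Sum>b\<in>Basis. sderiv b (X b) x) = (\<lambda>x. f x * slap g x - slap f x * g x)"
  proof
    fix x
    have "sderiv b (X b) x = f x * sderiv b (sderiv b g) x - sderiv b (sderiv b f) x * g x" for b
      unfolding X_def [abs_def] using assms
      by (simp add: sderiv_diff sderiv_mult smooth_on_sphere_mult smooth_on_sphere_sderiv)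
    then show "(\<Sum>b\<in>Basis. sderiv b (X b) x) = f x * slap g x - slap f x * g x"
      by (simp add: slap_def sum_subtractf sum_distrib_left sum_distrib_right)
  qed
  also have "sint (\<lambda>x. f x * slap g x - slap f x * g x)
    = sint (\<lambda>x. f x * slap g x) - sint (\<lambda>x. slap f x * g x)"
    using assms by (intro sint_diff smooth_on_sphere_mult smooth_on_sphere_slap)
  finally show ?thesis by simp
qed

section \<open>Dimensions of function spaces and orthogonal projections\<close>

interpretation fsp: vector_space_pair fun_scale fun_scale
  by (simp add: vector_space_pair_def vector_space_fun_scale)

text \<open>Since \<open>dim\<close> is 0 in infinite dimension, monotonicity requires a finite
  spanning set.\<close>

lemma fs_dim_mono:
  assumes "A \<subseteq> B" "B \<subseteq> fs.span S" "finite S"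
  shows "fs.dim A \<le> fs.dim B"
proof -
  obtain C where C: "C \<subseteq> B" "fs.independent C" "B \<subseteq> fs.span C" "card C = fs.dim B"
    by (rule fs.basis_exists)
  have "finite C" using fs.independent_span_bound[OF assms(3) C(2)] C(1) assms(2) by auto
  moreover have "A \<subseteq> fs.span C" using assms(1) C(3) by auto
  ultimately show ?thesis using fs.dim_le_card[of A C] C(4) by simp
qed

lemma fs_dim_image:
  assumes "Vector_Spaces.linear fun_scale fun_scale \<phi>" "fs.subspace A" "inj_on \<phi> A"
  shows "fs.dim (\<phi> ` A) = fs.dim A"
proof -
  obtain B where B: "B \<subseteq> A" "fs.independent B" "A \<subseteq> fs.span B" "card B = fs.dim A"
    by (rule fs.basis_exists)
  have sp: "fs.span B = A" using B(1,3) assms(2) fs.span_minimal by blast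
  have ind: "fs.independent (\<phi> ` B)"
    using fsp.linear_independent_injective_image[OF assms(1) B(2)] assms(3) sp by simp
  have span: "fs.span (\<phi> ` B) = \<phi> ` A"
    using fsp.linear_span_image[OF assms(1), of B] sp by simp
  have "fs.dim (\<phi> ` A) = card (\<phi> ` B)"
    using fs.dim_eq_card[of "\<phi> ` B" "\<phi> ` A"] ind span fs.span_span by metis
  also have "\<dots> = card B"
    using assms(3) B(1) by (intro card_image) (auto intro: inj_on_subset)
  finally show ?thesis using B(4) by simp
qed

lemma fs_dim_direct_sum:
  assumes "fs.subspace A" "fs.subspace B"
    and "\<And>f. f \<in> A \<Longrightarrow> f \<in> B \<Longrightarrow> f = (\<lambda>x. 0)"
    and "A \<subseteq> fs.span S" "finite S" "B \<subseteq> fs.span T" "finite T"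
    and C: "C = {\<lambda>x. a x + b x | a b. a \<in> A \<and> b \<in> B}"
  shows "fs.dim C = fs.dim A + fs.dim B"
proof -
  obtain P where P: "P \<subseteq> A" "fs.independent P" "A \<subseteq> fs.span P" "card P = fs.dim A"
    by (rule fs.basis_exists)
  obtain Q where Q: "Q \<subseteq> B" "fs.independent Q" "B \<subseteq> fs.span Q" "card Q = fs.dim B"
    by (rule fs.basis_exists)
  have fin: "finite P" "finite Q"
    using fs.independent_span_bound[OF assms(5) P(2)] fs.independent_span_bound[OF assms(7) Q(2)]
      P Q assms by auto
  have sp: "fs.span P = A" "fs.span Q = B"
    using P Q assms(1,2) fs.span_minimal by blast+
  \<comment> \<open>The basis of \<open>B\<close> is added one vector at a time: a dependence would
    produce a common vector of \<open>A\<close> and \<open>B\<close>, which is 0, and so a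
    dependence within \<open>Q\<close>.\<close>
  have ind: "fs.independent (P \<union> R) \<and> card (P \<union> R) = card P + card R" if "R \<subseteq> Q" for R
  proof -
    have "finite R" using that fin finite_subset by blast
    then show ?thesis using that
    proof (induction R rule: finite_induct)
      case empty
      then show ?case using P by simp
    next
      case (insert f R)
      have "f \<notin> fs.span (P \<union> R)"
      proof
        assume "f \<in> fs.span (P \<union> R)"
        then obtain a r where ar: "f = a + r" "a \<in> fs.span P" "r \<in> fs.span R"
          unfolding fs.span_Un by auto
        then have "a = f - r" by simp
        moreover have "f \<in> fs.span Q" "r \<in> fs.span Q"
          using insert ar fs.span_base fs.span_mono[of R Q] by auto
        ultimately have "a \<in> fs.span Q" by (simp add: fs.span_diff)
        then have "a = (\<lambda>x. 0)" using assms(3) ar sp by simp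
        then have "f = r" using ar by (simp add: fun_eq_iff)
        then have "f \<in> fs.span R" using ar by simp
        moreover have "fs.independent (insert f R)"
          using fs.independent_mono[OF Q(2)] insert.prems by blast
        ultimately show False using insert.hyps by (simp add: fs.independent_insert)
      qed
      moreover have "f \<notin> P \<union> R" using calculation fs.span_base by blast
      moreover have "fs.independent (insert f (P \<union> R))"
        using calculation(1) insert by (intro fs.independent_insertI) auto
      ultimately show ?case using insert fin by simp
    qed
  qed
  have "fs.span (P \<union> Q) = C"
    unfolding fs.span_Un C sp by (auto simp: plus_fun_def)
  then have "fs.span (P \<union> Q) = fs.span C" by (metis fs.span_span)
  then have "fs.dim C = card (P \<union> Q)"
    using ind[of Q] by (intro fs.dim_eq_card) auto
  then show ?thesis using ind[of Q] P Q by simp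
qed

text \<open>Exponent functions are arbitrary off \<open>Basis\<close>, but \<open>smono\<close> only
  sees their restriction; there each exponent is below \<open>m\<close>, which gives the
  bound.\<close>

lemma spoly_finite_span:
  "\<exists>S. finite S \<and> card S \<le> m ^ DIM('a::euclidean_space)
    \<and> spoly m = fs.span S \<and> (\<forall>s\<in>S. smooth_on_sphere (s :: 'a \<Rightarrow> real))"
proof (intro exI conjI)
  let ?S = "{smono e | e :: 'a \<Rightarrow> nat. (\<Sum>b\<in>Basis. e b) < m}"
  have sub: "?S \<subseteq> smono ` (Basis \<rightarrow>\<^sub>E {..<m})"
  proof clarify
    fix e :: "'a \<Rightarrow> nat" assume e: "(\<Sum>b\<in>Basis. e b) < m"
    have "smono e = smono (restrict e Basis)" by (simp add: smono_def fun_eq_iff)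
    moreover have "e b < m" if "b \<in> Basis" for b
      using e member_le_sum[of b Basis e] that by simp
    ultimately show "smono e \<in> smono ` (Basis \<rightarrow>\<^sub>E {..<m})" by (intro image_eqI) auto
  qed
  have f: "finite ((Basis :: 'a set) \<rightarrow>\<^sub>E {..<m})" by (intro finite_PiE) auto
  then show "finite ?S" using sub finite_subset by blast
  have "card ?S \<le> card ((Basis :: 'a set) \<rightarrow>\<^sub>E {..<m})"
    using sub f by (meson card_image_le card_mono finite_imageI le_trans)
  then show "card ?S \<le> m ^ DIM('a)" by (simp add: card_PiE)
  show "spoly m = fs.span ?S" by (simp add: spoly_def)
  show "\<forall>s\<in>?S. smooth_on_sphere s" by (auto intro: smooth_smono)
qed

lemma fs_dim_subset_spoly:
  fixes A B :: "('a::euclidean_space \<Rightarrow> real) set"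
  assumes "A \<subseteq> B" "B \<subseteq> spoly m"
  shows "fs.dim A \<le> fs.dim B"
proof -
  obtain S :: "('a \<Rightarrow> real) set" where "finite S" "spoly m = fs.span S" using spoly_finite_span[of m] by blast
  then show ?thesis using fs_dim_mono[of A B S] assms by simp
qed

lemma fs_dim_spoly_le:
  fixes A :: "('a::euclidean_space \<Rightarrow> real) set"
  assumes "A \<subseteq> spoly m"
  shows "fs.dim A \<le> m ^ DIM('a)"
proof -
  obtain S :: "('a \<Rightarrow> real) set" where S: "finite S" "card S \<le> m ^ DIM('a)" "spoly m = fs.span S"
    using spoly_finite_span[of m] by blast
  then have "fs.dim A \<le> card S" using fs.dim_le_card[of A S] assms by simp
  with S(2) show ?thesis by simp
qed

lemma sint_orthogonal_span:
  assumes f: "smooth_on_sphere f"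
    and S: "\<And>s. s \<in> S \<Longrightarrow> smooth_on_sphere s" "\<And>s. s \<in> S \<Longrightarrow> sint (\<lambda>x. f x * s x) = 0"
    and t: "t \<in> fs.span S"
  shows "smooth_on_sphere t \<and> sint (\<lambda>x. f x * t x) = 0"
  using t
proof (induction rule: fs.span_induct_alt)
  case base
  then show ?case by (simp add: zero_fun_def smooth_on_sphere_const sint_def)
next
  case (step c s t)
  have "fun_scale c s + t = (\<lambda>x. c * s x + t x)" by (auto simp: fun_scale_def)
  moreover have "sint (\<lambda>x. c * (f x * s x) + f x * t x) = 0"
    using step S f by (subst sint_add) (auto simp: sint_cmult intro!: smooth_on_sphere_mult smooth_on_sphere_const)
  moreover have "(\<lambda>x. f x * (c * s x + t x)) = (\<lambda>x. c * (f x * s x) + f x * t x)"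
    by (simp add: algebra_simps)
  ultimately show ?case
    using step S by (auto intro!: smooth_on_sphere_add smooth_on_sphere_mult smooth_on_sphere_const)
qed

text \<open>Gram-Schmidt, one generator at a time: \<open>a2\<close>, the part of the new generator
  orthogonal to the span of the old ones, supplies the correction.\<close>

lemma sint_projection:
  fixes f :: "'a::euclidean_space \<Rightarrow> real"
  assumes "finite S" "\<And>s. s \<in> S \<Longrightarrow> smooth_on_sphere s" "smooth_on_sphere f"
  shows "\<exists>h\<in>fs.span S. smooth_on_sphere h \<and> (\<forall>s\<in>S. sint (\<lambda>x. (f x - h x) * s x) = 0)"
  using assms
proof (induction S arbitrary: f rule: finite_induct)
  case empty
  then show ?case by (auto simp: zero_fun_def smooth_on_sphere_const)
next
  case (insert a S)
  have sm: "smooth_on_sphere a" "\<And>s. s \<in> S \<Longrightarrow> smooth_on_sphere s" using insert.prems by auto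
  obtain h where h: "h \<in> fs.span S" "smooth_on_sphere h" "\<And>s. s \<in> S \<Longrightarrow> sint (\<lambda>x. (f x - h x) * s x) = 0"
    using insert.IH[OF sm(2) insert.prems(2)] by blast
  obtain a1 where a1: "a1 \<in> fs.span S" "smooth_on_sphere a1"
    "\<And>s. s \<in> S \<Longrightarrow> sint (\<lambda>x. (a x - a1 x) * s x) = 0"
    using insert.IH[OF sm(2,1)] by blast
  define a2 where "a2 x = a x - a1 x" for x
  have sma2: "smooth_on_sphere a2" unfolding a2_def [abs_def] by (intro smooth_on_sphere_diff sm a1)
  \<comment> \<open>If \<open>a2\<close> has norm 0, then \<open>c\<close> is 0 because of the
    division by 0, and \<open>a2\<close> vanishes on the sphere anyway.\<close>
  define c where "c = sint (\<lambda>x. (f x - h x) * a2 x) / sint (\<lambda>x. a2 x * a2 x)"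
  define h' where "h' x = h x + c * a2 x" for x
  have smh': "smooth_on_sphere h'" unfolding h'_def [abs_def]
    by (intro smooth_on_sphere_add smooth_on_sphere_mult smooth_on_sphere_const h sma2)
  have smfh: "smooth_on_sphere (\<lambda>x. f x - h x)" and smfh': "smooth_on_sphere (\<lambda>x. f x - h' x)"
    using insert.prems h smh' by (auto intro: smooth_on_sphere_diff)
  have diff: "sint (\<lambda>x. (f x - h' x) * s x) = sint (\<lambda>x. (f x - h x) * s x) - c * sint (\<lambda>x. a2 x * s x)"
    if "smooth_on_sphere s" for s
  proof -
    have "sint (\<lambda>x. (f x - h x) * s x - c * (a2 x * s x))
      = sint (\<lambda>x. (f x - h x) * s x) - sint (\<lambda>x. c * (a2 x * s x))"
      using that smfh sma2 by (intro sint_diff smooth_on_sphere_mult smooth_on_sphere_const)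
    then show ?thesis by (simp add: h'_def sint_cmult algebra_simps)
  qed
  have 1: "sint (\<lambda>x. (f x - h' x) * s x) = 0" if "s \<in> S" for s
    using diff[of s] sm that h a1 by (simp add: a2_def)
  have 2: "sint (\<lambda>x. (f x - h' x) * a2 x) = 0"
  proof (cases "sint (\<lambda>x. a2 x * a2 x) = 0")
    case True
    have "sint (\<lambda>x. (f x - h' x) * a2 x) = sint (\<lambda>x::'a. 0)"
      by (rule sint_cong) (use sint_square_eq_0[OF sma2 True] in auto)
    then show ?thesis by (simp add: sint_def)
  next
    case False
    then show ?thesis using diff[OF sma2] by (simp add: c_def)
  qed
  have "sint (\<lambda>x. (f x - h' x) * a1 x) = 0"
    using sint_orthogonal_span[OF smfh' sm(2) 1 a1(1)] by blast
  moreover have "sint (\<lambda>x. (f x - h' x) * a x) = sint (\<lambda>x. (f x - h' x) * a1 x) + sint (\<lambda>x. (f x - h' x) * a2 x)"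
    using sint_add[OF smooth_on_sphere_mult[OF smfh' a1(2)] smooth_on_sphere_mult[OF smfh' sma2]]
    by (simp add: a2_def algebra_simps)
  ultimately have 3: "sint (\<lambda>x. (f x - h' x) * a x) = 0" using 2 by simp
  have "h' = h + fun_scale c (a - a1)" by (auto simp: h'_def a2_def fun_scale_def)
  moreover have "h \<in> fs.span (insert a S)" "a1 \<in> fs.span (insert a S)" "a \<in> fs.span (insert a S)"
    using h(1) a1(1) fs.span_mono[of S "insert a S"] fs.span_base[of a "insert a S"] by auto
  ultimately have "h' \<in> fs.span (insert a S)"
    by (simp add: fs.span_add fs.span_scale fs.span_diff)
  then show ?case using 1 3 smh' by blast
qed

text \<open>Connects the polynomial functions of the Stone-Weierstrass theorem with the span of
  monomials.\<close>

lemma real_polynomial_in_spoly: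
  assumes "real_polynomial_function p"
  shows "\<exists>m. (\<lambda>x::'a::euclidean_space. if norm x = 1 then p x else 0) \<in> spoly (Suc m)"
  using assms
proof induction
  case (linear f)
  define a where "a = (\<Sum>b\<in>Basis. f b *\<^sub>R b)"
  have eq: "f x = x \<bullet> a" for x
  proof -
    have "f x = f (\<Sum>b\<in>Basis. (x \<bullet> b) *\<^sub>R b)" by (simp add: euclidean_representation)
    also have "\<dots> = (\<Sum>b\<in>Basis. (x \<bullet> b) * f b)"
      using linear by (simp add: linear_sum linear_scale bounded_linear.linear)
    finally show ?thesis by (simp add: a_def inner_sum_right mult.commute)
  qed
  show ?case unfolding eq by (intro exI[of _ "Suc 0"] spoly_inner)
next
  case (const c)
  show ?case by (intro exI[of _ 0] spoly_const)
next
  case (add f g)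
  then obtain m n where "(\<lambda>x. if norm x = 1 then f x else 0) \<in> spoly (Suc m)"
    "(\<lambda>x. if norm x = 1 then g x else 0) \<in> spoly (Suc n)" by blast
  then have "(\<lambda>x. if norm x = 1 then f x else 0) \<in> spoly (Suc (max m n))"
    "(\<lambda>x. if norm x = 1 then g x else 0) \<in> spoly (Suc (max m n))"
    using spoly_mono[of "Suc m" "Suc (max m n)"] spoly_mono[of "Suc n" "Suc (max m n)"] by auto
  from spoly_add[OF this] have "(\<lambda>x. if norm x = 1 then f x + g x else 0) \<in> spoly (Suc (max m n))"
    by (rule back_subst[of "\<lambda>h. h \<in> _"]) auto
  then show ?case ..
next
  case (mult f g)
  then obtain m n where "(\<lambda>x. if norm x = 1 then f x else 0) \<in> spoly (Suc m)"
    "(\<lambda>x. if norm x = 1 then g x else 0) \<in> spoly (Suc n)" by blast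
  from spoly_mult[OF this] have "(\<lambda>x. if norm x = 1 then f x * g x else 0) \<in> spoly (Suc (m + n))"
    by (rule back_subst[of "\<lambda>h. h \<in> _"]) auto
  then show ?case ..
qed

text \<open>For a polynomial \<open>p\<close> within \<open>e\<close> of \<open>f\<close> on the
  sphere, orthogonality turns the integral of \<open>f * f\<close> into that of
  \<open>f * (f - p)\<close>, which is at most a constant times \<open>e\<close>.\<close>

lemma orthogonal_spoly_eq_0:
  fixes f :: "'a::euclidean_space \<Rightarrow> real"
  assumes f: "smooth_on_sphere f"
    and orth: "\<And>m v. v \<in> spoly m \<Longrightarrow> sint (\<lambda>x. f x * v x) = 0"
    and x: "norm x = 1"
  shows "f x = 0"
proof -
  obtain B where B: "\<And>x. norm x = 1 \<Longrightarrow> \<bar>f x\<bar> \<le> B" "0 \<le> B"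
  proof -
    have "compact (f ` sphere 0 1)"
      using smooth_continuous_on_sphere[OF f] by (intro compact_continuous_image) auto
    then obtain B where "\<And>x. x \<in> sphere 0 1 \<Longrightarrow> \<bar>f x\<bar> \<le> B"
      using compact_imp_bounded by (force simp: bounded_iff)
    then have "\<bar>f x\<bar> \<le> max B 0" if "norm x = 1" for x
      using that by (auto simp: le_max_iff_disj)
    then show ?thesis using that by (metis max.cobounded2)
  qed
  define C where "C = B * \<bar>sint (\<lambda>x::'a. 1)\<bar>"
  have C: "0 \<le> C" using B(2) by (simp add: C_def)
  have le: "\<bar>sint (\<lambda>x. f x * f x)\<bar> \<le> e * C" if e: "0 < e" for e
  proof -
    obtain p where p: "real_polynomial_function p" "\<And>x. x \<in> sphere 0 1 \<Longrightarrow> \<bar>f x - p x\<bar> < e"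
      using Stone_Weierstrass_real_polynomial_function[OF _ smooth_continuous_on_sphere[OF f] e] by auto
    obtain m where m: "(\<lambda>x. if norm x = 1 then p x else 0) \<in> spoly (Suc m)" (is "?p \<in> _")
      using real_polynomial_in_spoly[OF p(1)] by blast
    have smp: "smooth_on_sphere ?p" using m by (rule smooth_spoly)
    have "sint (\<lambda>x. f x * (f x - ?p x)) = sint (\<lambda>x. f x * f x) - sint (\<lambda>x. f x * ?p x)"
      unfolding right_diff_distrib using f smp by (intro sint_diff smooth_on_sphere_mult)
    then have "sint (\<lambda>x. f x * f x) = sint (\<lambda>x. f x * (f x - ?p x))"
      using orth[OF m] by simp
    moreover have "\<bar>sint (\<lambda>x. f x * (f x - ?p x))\<bar> \<le> (B * e) * sint (\<lambda>x::'a. 1)"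
    proof (rule sint_bound)
      show "smooth_on_sphere (\<lambda>x. f x * (f x - ?p x))"
        using f smp by (intro smooth_on_sphere_mult smooth_on_sphere_diff)
      show "\<bar>f x * (f x - ?p x)\<bar> \<le> B * e" if "norm x = 1" for x
        unfolding abs_mult by (rule mult_mono) (use that B p(2)[of x] in auto)
    qed
    moreover have "(B * e) * sint (\<lambda>x::'a. 1) \<le> (B * e) * \<bar>sint (\<lambda>x::'a. 1)\<bar>"
      using B(2) that by (intro mult_left_mono) auto
    ultimately show ?thesis by (simp add: C_def mult.commute mult.left_commute)
  qed
  have "\<bar>sint (\<lambda>x. f x * f x)\<bar> \<le> 0"
  proof (rule field_le_epsilon)
    fix e :: real assume "0 < e"
    \<comment> \<open>\<open>C\<close> may be 0, hence the division by \<open>C + 1\<close>.\<close>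
    have "e / (C + 1) * C \<le> e" using C \<open>0 < e\<close> by (simp add: field_simps)
    then show "\<bar>sint (\<lambda>x. f x * f x)\<bar> \<le> 0 + e"
      using le[of "e / (C + 1)"] C \<open>0 < e\<close> by simp
  qed
  then show ?thesis using sint_square_eq_0[OF f _ x] by simp
qed

section \<open>Eigenfunctions of the sphere Laplacian\<close>

text \<open>Arbitrary smooth eigenfunctions; that they are polynomial is a theorem below.\<close>

definition seig :: "nat \<Rightarrow> ('a::euclidean_space \<Rightarrow> real) set" where
  "seig k = {f. (\<forall>x. norm x \<noteq> 1 \<longrightarrow> f x = 0) \<and> smooth_on_sphere f \<and>
     (\<forall>x. slap f x = - sev TYPE('a) k * f x)}"

text \<open>In dimension 1 the degrees 0 and 1 would share the eigenvalue 0.\<close>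

lemma sev_strict_mono:
  assumes "DIM('a::euclidean_space) \<ge> 2" "j < k"
  shows "sev TYPE('a) j < sev TYPE('a) k"
proof -
  have "real j * (real j + real DIM('a) - 2) \<le> real j * (real k + real DIM('a) - 2)"
    using assms by (intro mult_left_mono) auto
  also have "\<dots> < real k * (real k + real DIM('a) - 2)"
    using assms by (intro mult_strict_right_mono) auto
  finally show ?thesis by (simp add: sev_def)
qed

lemma sev_eq_iff:
  assumes "DIM('a::euclidean_space) \<ge> 2"
  shows "sev TYPE('a) j = sev TYPE('a) k \<longleftrightarrow> j = k"
  using sev_strict_mono[OF assms, of j k] sev_strict_mono[OF assms, of k j] by fastforce

text \<open>Modulo \<open>spoly m\<close> the Laplacian multiplies \<open>f\<close> by both
  \<open>- sev m\<close> and \<open>- sev k\<close>; these scalars differ, so \<open>f\<close> is 0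
  there.\<close>

lemma spoly_eigen_lower:
  fixes f :: "'a::euclidean_space \<Rightarrow> real"
  assumes "DIM('a) \<ge> 2" "f \<in> spoly (Suc m)" "m \<noteq> k" "\<And>x. slap f x = - sev TYPE('a) k * f x"
  shows "f \<in> spoly m"
proof -
  define c where "c = sev TYPE('a) m - sev TYPE('a) k"
  have "c \<noteq> 0" using sev_eq_iff[OF assms(1)] assms(3) by (simp add: c_def)
  have "(\<lambda>x. slap f x + sev TYPE('a) m * f x) = (\<lambda>x. c * f x)"
    by (simp add: assms(4) c_def algebra_simps)
  with slap_spoly[OF assms(2)] have "(\<lambda>x. inverse c * (c * f x)) \<in> spoly m"
    by (metis spoly_scale)
  then show ?thesis using \<open>c \<noteq> 0\<close> by (simp flip: mult.assoc)
qed

lemma spoly_eigen_degree_le: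
  fixes f :: "'a::euclidean_space \<Rightarrow> real"
  assumes "DIM('a) \<ge> 2" "f \<in> spoly m" "\<And>x. slap f x = - sev TYPE('a) k * f x"
  shows "f \<in> spoly (Suc k)"
  using assms(2)
proof (induction m)
  case 0
  then show ?case using spoly_mono[of 0 "Suc k"] by auto
next
  case (Suc m)
  then show ?case
    using spoly_eigen_lower[OF assms(1) Suc.prems _ assms(3)] by (cases "m = k") auto
qed

lemma spoly_eigen_eq_0:
  fixes f :: "'a::euclidean_space \<Rightarrow> real"
  assumes "DIM('a) \<ge> 2" "f \<in> spoly m" "m \<le> k" "\<And>x. slap f x = - sev TYPE('a) k * f x"
  shows "f = (\<lambda>x. 0)"
  using assms(2,3)
proof (induction m)
  case 0
  then show ?case by (simp add: spoly_0)
next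
  case (Suc m)
  then show ?case
    using spoly_eigen_lower[OF assms(1) Suc.prems(1) _ assms(4)] by simp
qed

text \<open>The projection of an eigenfunction to a space of polynomials that the Laplacian preserves is
  again an eigenfunction, hence has degree \<open>k\<close>, whatever space was chosen. So the remainder is
  orthogonal to all polynomials.\<close>

lemma seig_subset_spoly:
  assumes dim: "DIM('a::euclidean_space) \<ge> 2"
  shows "(seig k :: ('a \<Rightarrow> real) set) \<subseteq> spoly (Suc k)"
proof
  fix f :: "'a \<Rightarrow> real" assume "f \<in> seig k"
  then have f: "\<And>x. norm x \<noteq> 1 \<Longrightarrow> f x = 0" "smooth_on_sphere f"
    "\<And>x. slap f x = - sev TYPE('a) k * f x"
    by (auto simp: seig_def)
  let ?\<nu> = "sev TYPE('a) k"
  have proj: "\<exists>h\<in>spoly (Suc k). \<forall>v\<in>spoly (Suc m). sint (\<lambda>x. (f x - h x) * v x) = 0"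
    if "k \<le> m" for m
  proof -
    obtain S :: "('a \<Rightarrow> real) set" where S: "finite S" "spoly (Suc m) = fs.span S"
      "\<And>s. s \<in> S \<Longrightarrow> smooth_on_sphere s"
      using spoly_finite_span[of "Suc m"] by blast
    obtain h where h: "h \<in> fs.span S" "smooth_on_sphere h"
      "\<And>s. s \<in> S \<Longrightarrow> sint (\<lambda>x. (f x - h x) * s x) = 0"
      using sint_projection[OF S(1,3) f(2)] by blast
    have smfh: "smooth_on_sphere (\<lambda>x. f x - h x)" using f h by (intro smooth_on_sphere_diff)
    have orth: "sint (\<lambda>x. (f x - h x) * v x) = 0" if "v \<in> spoly (Suc m)" for v
      using sint_orthogonal_span[OF smfh S(3) h(3)] that S(2) by blast
    \<comment> \<open>The failure of \<open>h\<close> to be an eigenfunction. As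
      \<open>slap u + ?\<nu> u\<close> lies in the projection space, \<open>f - h\<close> is
      orthogonal to it; by symmetry the operator moves to \<open>f - h\<close>, which it sends to
      \<open>- u\<close>. Hence \<open>u\<close> has norm 0.\<close>
    define u where "u x = slap h x + ?\<nu> * h x" for x
    have shift: "(\<lambda>x. slap v x + ?\<nu> * v x) \<in> spoly (Suc m)" if "v \<in> spoly (Suc m)" for v :: "'a \<Rightarrow> real"
    proof -
      have "(\<lambda>x. slap v x + sev TYPE('a) m * v x) \<in> spoly (Suc m)"
        using slap_spoly[OF that] spoly_mono[of m "Suc m"] by auto
      then have "(\<lambda>x. (slap v x + sev TYPE('a) m * v x) + (?\<nu> - sev TYPE('a) m) * v x) \<in> spoly (Suc m)"
        by (rule spoly_add[OF _ spoly_scale[OF that]])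
      then show ?thesis by (simp add: algebra_simps)
    qed
    have u: "u \<in> spoly (Suc m)" unfolding u_def [abs_def] using h(1) S(2) by (intro shift) simp
    have smu: "smooth_on_sphere u" using u by (rule smooth_spoly)
    have "sint (\<lambda>x. u x * u x) = 0"
    proof -
      have sl: "slap (\<lambda>x. f x - h x) x = - ?\<nu> * (f x - h x) - u x" for x
        using f h by (simp add: slap_diff u_def algebra_simps)
      have "0 = sint (\<lambda>x. (f x - h x) * (slap u x + ?\<nu> * u x))"
        using orth[OF shift[OF u]] by simp
      also have "\<dots> = sint (\<lambda>x. (f x - h x) * slap u x) + sint (\<lambda>x. (f x - h x) * (?\<nu> * u x))"
        unfolding distrib_left
        by (intro sint_add smooth_on_sphere_mult smooth_on_sphere_slap smooth_on_sphere_const smfh smu)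
      also have "sint (\<lambda>x. (f x - h x) * slap u x) = sint (\<lambda>x. slap (\<lambda>x. f x - h x) x * u x)"
        by (rule slap_symmetric[OF smfh smu])
      also have "\<dots> + sint (\<lambda>x. (f x - h x) * (?\<nu> * u x))
        = sint (\<lambda>x. slap (\<lambda>x. f x - h x) x * u x + (f x - h x) * (?\<nu> * u x))"
        by (intro sint_add[symmetric] smooth_on_sphere_mult smooth_on_sphere_slap smooth_on_sphere_const smfh smu)
      also have "\<dots> = sint (\<lambda>x. -1 * (u x * u x))"
        unfolding sl by (simp add: algebra_simps)
      also have "\<dots> = - sint (\<lambda>x. u x * u x)" by (subst sint_cmult) simp
      finally show ?thesis by simp
    qed
    then have u0: "u x = 0" if "norm x = 1" for x using sint_square_eq_0[OF smu _ that] by blast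
    have "slap h x = - ?\<nu> * h x" for x
      using u0[of x] spoly_off_sphere[of h "Suc m" x] h(1) S(2)
      by (cases "norm x = 1") (auto simp: u_def)
    then have "h \<in> spoly (Suc k)"
      using spoly_eigen_degree_le[OF dim] h(1) S(2) by blast
    then show ?thesis using orth by blast
  qed
  obtain h where h: "h \<in> spoly (Suc k)" "\<And>v. v \<in> spoly (Suc k) \<Longrightarrow> sint (\<lambda>x. (f x - h x) * v x) = 0"
    using proj[of k] by blast
  have smfh: "smooth_on_sphere (\<lambda>x. f x - h x)"
    using f smooth_spoly[OF h(1)] by (intro smooth_on_sphere_diff)
  have "f x - h x = 0" if x: "norm x = 1" for x
  proof (rule orthogonal_spoly_eq_0[OF smfh _ x])
    fix m v assume v: "v \<in> (spoly m :: ('a \<Rightarrow> real) set)"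
    \<comment> \<open>Large enough to apply \<open>proj\<close> and to contain
      \<open>v\<close>.\<close>
    define l where "l = max k m"
    obtain h' where h': "h' \<in> spoly (Suc k)" "\<And>v. v \<in> spoly (Suc l) \<Longrightarrow> sint (\<lambda>x. (f x - h' x) * v x) = 0"
      using proj[of l] by (auto simp: l_def)
    \<comment> \<open>The difference of the two projections has degree at most \<open>k\<close> and
      is also the difference of the two remainders, each of which is orthogonal to it; so it has
      norm 0.\<close>
    have "(\<lambda>x. h x - h' x) \<in> spoly (Suc k)" (is "?d \<in> _") using h h' by (intro spoly_diff)
    then have smd: "smooth_on_sphere ?d" and d: "sint (\<lambda>x. (f x - h x) * ?d x) = 0"
      "sint (\<lambda>x. (f x - h' x) * ?d x) = 0"
      using smooth_spoly h(2) h'(2) spoly_mono[of "Suc k" "Suc l"] by (auto simp: l_def)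
    have smfh': "smooth_on_sphere (\<lambda>x. f x - h' x)"
      using f smooth_spoly[OF h'(1)] by (intro smooth_on_sphere_diff)
    have "sint (\<lambda>x. (f x - h' x) * ?d x - (f x - h x) * ?d x) = 0"
      using d sint_diff[OF smooth_on_sphere_mult[OF smfh' smd] smooth_on_sphere_mult[OF smfh smd]] by simp
    then have "sint (\<lambda>x. ?d x * ?d x) = 0" by (simp add: algebra_simps)
    then have "h x = h' x" if "norm x = 1" for x using sint_square_eq_0[OF smd _ that] by simp
    then have "sint (\<lambda>x. (f x - h x) * v x) = sint (\<lambda>x. (f x - h' x) * v x)" by (intro sint_cong) simp
    also have "\<dots> = 0"
    proof (rule h'(2))
      have "m \<le> Suc l" by (simp add: l_def)
      then show "v \<in> spoly (Suc l)" using v spoly_mono by blast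
    qed
    finally show "sint (\<lambda>x. (f x - h x) * v x) = 0" .
  qed
  then have "f x = h x" for x
    using f(1) spoly_off_sphere[OF h(1)] by (cases "norm x = 1") auto
  then have "f = h" by auto
  then show "f \<in> spoly (Suc k)" using h(1) by simp
qed

section \<open>Invariance under orthogonal transformations\<close>

lemma sgn_orthogonal_transformation:
  "orthogonal_transformation g \<Longrightarrow> sgn (g x) = g (sgn x)"
  by (simp add: sgn_div_norm orthogonal_transformation_norm linear_scale orthogonal_transformation_linear)

lemma orthogonal_transformation_sum_Basis:
  fixes g :: "'a::euclidean_space \<Rightarrow> 'a"
  assumes g: "orthogonal_transformation g"
  shows "(\<Sum>c\<in>Basis. (b \<bullet> g c) *\<^sub>R g c) = b"
proof -
  obtain y where y: "b = g y" using orthogonal_transformation_surj[OF g] by blast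
  have "g y \<bullet> g c = y \<bullet> c" for c using g by (simp add: orthogonal_transformation_def)
  moreover have "g (\<Sum>c\<in>Basis. (y \<bullet> c) *\<^sub>R c) = (\<Sum>c\<in>Basis. (y \<bullet> c) *\<^sub>R g c)"
    using orthogonal_transformation_linear[OF g] by (simp add: linear_sum linear_scale)
  ultimately show ?thesis by (simp add: y euclidean_representation)
qed

text \<open>The chain rule for the linear map \<open>g\<close>, with \<open>b\<close> expanded in
  the orthonormal basis of the images \<open>g c\<close>.\<close>

lemma sderiv_orthogonal_transformation:
  fixes g :: "'a::euclidean_space \<Rightarrow> 'a"
  assumes g: "orthogonal_transformation g" and f: "smooth_on_sphere f"
  shows "sderiv b f (g x) = (\<Sum>c\<in>Basis. (b \<bullet> g c) * sderiv c (\<lambda>x. f (g x)) x)"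
proof (cases "norm x = 1")
  case True
  have ng: "norm (g x) = 1" using g True by (simp add: orthogonal_transformation_norm)
  have "(g has_derivative g) (at x)"
    using g by (intro linear_imp_has_derivative orthogonal_transformation_linear)
  from diff_chain_at[OF this radial_has_sderiv[OF f ng]]
  have "((\<lambda>x. radial f (g x)) has_derivative (\<lambda>v. sderiv (g v) f (g x))) (at x)"
    by (simp add: comp_def)
  then have c: "sderiv c (\<lambda>x. f (g x)) x = sderiv (g c) f (g x)" for c
    by (rule sderivI[OF _ True]) (simp add: radial_def sgn_orthogonal_transformation[OF g])
  have "sderiv b f (g x) = sderiv (\<Sum>c\<in>Basis. (b \<bullet> g c) *\<^sub>R g c) f (g x)"
    by (simp add: orthogonal_transformation_sum_Basis[OF g])
  also have "\<dots> = (\<Sum>c\<in>Basis. (b \<bullet> g c) * sderiv (g c) f (g x))"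
    using linear_sum[OF linear_sderiv[OF f, of "g x"], of "\<lambda>c. (b \<bullet> g c) *\<^sub>R g c" Basis]
      linear_scale[OF linear_sderiv[OF f, of "g x"]] by simp
  finally show ?thesis by (simp add: c)
next
  case False
  then show ?thesis using g by (simp add: orthogonal_transformation_norm)
qed

text \<open>After two changes of basis the coefficients combine to
  \<open>g c \<bullet> g d = c \<bullet> d\<close>, which leaves the trace again.\<close>

lemma slap_orthogonal_transformation:
  fixes g :: "'a::euclidean_space \<Rightarrow> 'a"
  assumes g: "orthogonal_transformation g" and f: "smooth_on_sphere f"
    and inv: "\<And>x. f (g x) = f x"
  shows "slap f (g x) = slap f x"
proof -
  have 1: "sderiv b f (g x) = (\<Sum>d\<in>Basis. (b \<bullet> g d) * sderiv d f x)" for b x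
    using sderiv_orthogonal_transformation[OF g f] inv by simp
  have "sderiv b (sderiv b f) (g x)
      = (\<Sum>c\<in>Basis. \<Sum>d\<in>Basis. ((b \<bullet> g c) * (b \<bullet> g d)) * sderiv c (sderiv d f) x)" for b
  proof -
    have "sderiv b (sderiv b f) (g x) = (\<Sum>c\<in>Basis. (b \<bullet> g c) * sderiv c (\<lambda>x. sderiv b f (g x)) x)"
      by (rule sderiv_orthogonal_transformation[OF g smooth_on_sphere_sderiv[OF f]])
    also have "\<dots> = (\<Sum>c\<in>Basis. (b \<bullet> g c) * (\<Sum>d\<in>Basis. (b \<bullet> g d) * sderiv c (sderiv d f) x))"
      unfolding 1
      by (subst sderiv_sum) (auto simp: sderiv_cmult smooth_on_sphere_sderiv f
          intro!: smooth_on_sphere_mult smooth_on_sphere_const)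
    finally show ?thesis by (simp add: sum_distrib_left mult.assoc)
  qed
  then have "slap f (g x)
    = (\<Sum>b\<in>Basis. \<Sum>c\<in>Basis. \<Sum>d\<in>Basis. ((b \<bullet> g c) * (b \<bullet> g d)) * sderiv c (sderiv d f) x)"
    by (simp add: slap_def)
  also have "\<dots> = (\<Sum>c\<in>Basis. \<Sum>b\<in>Basis. \<Sum>d\<in>Basis. ((b \<bullet> g c) * (b \<bullet> g d)) * sderiv c (sderiv d f) x)"
    by (rule sum.swap)
  also have "\<dots> = (\<Sum>c\<in>Basis. \<Sum>d\<in>Basis. \<Sum>b\<in>Basis. ((b \<bullet> g c) * (b \<bullet> g d)) * sderiv c (sderiv d f) x)"
    by (intro sum.cong refl sum.swap)
  also have "\<dots> = (\<Sum>c\<in>Basis. \<Sum>d\<in>Basis. (c \<bullet> d) * sderiv c (sderiv d f) x)"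
  proof (intro sum.cong refl)
    fix c d :: 'a
    have "(\<Sum>b\<in>Basis. (b \<bullet> g c) * (b \<bullet> g d)) = g c \<bullet> g d"
      by (simp add: euclidean_inner[of "g c"] inner_commute)
    also have "\<dots> = c \<bullet> d" using g by (simp add: orthogonal_transformation_def)
    finally show "(\<Sum>b\<in>Basis. ((b \<bullet> g c) * (b \<bullet> g d)) * sderiv c (sderiv d f) x)
      = (c \<bullet> d) * sderiv c (sderiv d f) x"
      by (simp flip: sum_distrib_right)
  qed
  also have "\<dots> = slap f x"
    unfolding slap_def by (intro sum.cong refl) (simp add: inner_Basis if_distribR if_distrib cong: if_cong)
  finally show ?thesis .
qed

definition inv_spoly :: "('a \<Rightarrow> 'a) \<Rightarrow> nat \<Rightarrow> ('a::euclidean_space \<Rightarrow> real) set" where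
  "inv_spoly g m = {f \<in> spoly m. \<forall>x. f (g x) = f x}"

definition inv_seig :: "('a \<Rightarrow> 'a) \<Rightarrow> nat \<Rightarrow> ('a::euclidean_space \<Rightarrow> real) set" where
  "inv_seig g k = {f \<in> seig k. \<forall>x. f (g x) = f x}"

lemma subspace_inv_spoly: "fs.subspace (inv_spoly g m)"
  by (rule fs_subspaceI) (auto simp: inv_spoly_def intro: spoly_zero spoly_add spoly_scale)

lemma subspace_inv_seig: "fs.subspace (inv_seig g k)"
proof (rule fs_subspaceI)
  show "(\<lambda>x. 0) \<in> inv_seig g k" by (simp add: inv_seig_def seig_def smooth_on_sphere_const)
  show "(\<lambda>x. a x + b x) \<in> inv_seig g k" if "a \<in> inv_seig g k" "b \<in> inv_seig g k" for a b
    using that by (auto simp: inv_seig_def seig_def slap_add algebra_simps intro: smooth_on_sphere_add)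
  show "(\<lambda>x. c * a x) \<in> inv_seig g k" if "a \<in> inv_seig g k" for a c
    using that by (auto simp: inv_seig_def seig_def slap_cmult algebra_simps
        intro: smooth_on_sphere_mult smooth_on_sphere_const)
qed

lemma inv_seig_subset:
  assumes "DIM('a::euclidean_space) \<ge> 2"
  shows "(inv_seig g k :: ('a \<Rightarrow> real) set) \<subseteq> inv_spoly g (Suc k)"
  using seig_subset_spoly[OF assms] by (auto simp: inv_seig_def inv_spoly_def)

lemma inv_spoly_mono: "m \<le> n \<Longrightarrow> inv_spoly g m \<subseteq> inv_spoly g n"
  using spoly_mono by (auto simp: inv_spoly_def)

text \<open>\<open>slap + sev m\<close> lowers the degree and preserves invariance, so by induction
  its value at \<open>f\<close> is a sum of eigenfunctions. Inverting the operator on these leaves a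
  remainder in the eigenspace of \<open>sev m\<close>.\<close>

lemma inv_spoly_decomposition:
  fixes g :: "'a::euclidean_space \<Rightarrow> 'a"
  assumes dim: "DIM('a) \<ge> 2" and g: "orthogonal_transformation g" and "f \<in> inv_spoly g m"
  shows "\<exists>e. (\<forall>j<m. e j \<in> inv_seig g j) \<and> f = (\<lambda>x. \<Sum>j<m. e j x)"
  using assms(3)
proof (induction m arbitrary: f)
  case 0
  then show ?case by (auto simp: inv_spoly_def spoly_0)
next
  case (Suc m)
  let ?\<nu> = "sev TYPE('a)"
  have f: "f \<in> spoly (Suc m)" "smooth_on_sphere f" "\<And>x. f (g x) = f x"
    using Suc.prems smooth_spoly by (auto simp: inv_spoly_def)
  have "(\<lambda>x. slap f x + ?\<nu> m * f x) \<in> inv_spoly g m"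
    using slap_spoly[OF f(1)] slap_orthogonal_transformation[OF g f(2,3)] f(3)
    by (simp add: inv_spoly_def)
  then obtain e where e: "\<And>j. j < m \<Longrightarrow> e j \<in> inv_seig g j"
    "(\<lambda>x. slap f x + ?\<nu> m * f x) = (\<lambda>x. \<Sum>j<m. e j x)"
    using Suc.IH by blast
  \<comment> \<open>On \<open>inv_seig g j\<close> the operator \<open>slap + sev m\<close> is the
    scalar \<open>sev m - sev j\<close>, nonzero for \<open>j < m\<close>.\<close>
  define e' where "e' j x = inverse (?\<nu> m - ?\<nu> j) * e j x" for j x
  define w where "w x = f x - (\<Sum>j<m. e' j x)" for x
  have e': "e' j \<in> inv_seig g j" if "j < m" for j
    unfolding e'_def [abs_def] using e(1)[OF that] subspace_inv_seig fs_subspace_scale by blast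
  have sme': "smooth_on_sphere (e' j)" and sle': "slap (e' j) x = - ?\<nu> j * e' j x" if "j < m" for j x
    using e'[OF that] by (auto simp: inv_seig_def seig_def)
  have sm: "smooth_on_sphere (\<lambda>x. \<Sum>j<m. e' j x)" using sme' by (intro smooth_on_sphere_sum) auto
  have "w \<in> inv_seig g m"
    unfolding inv_seig_def seig_def
  proof (safe)
    show "w x = 0" if "norm x \<noteq> 1" for x
      using that spoly_off_sphere[OF f(1)] e' by (simp add: w_def inv_seig_def seig_def)
    show "smooth_on_sphere w" unfolding w_def [abs_def] using f(2) sm by (rule smooth_on_sphere_diff)
    show "w (g x) = w x" for x using f(3) e' by (simp add: w_def inv_seig_def)
    show "slap w x = - ?\<nu> m * w x" for x
    proof -
      have "slap w x = slap f x - (\<Sum>j<m. slap (e' j) x)"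
        unfolding w_def [abs_def] using f(2) sm sme' slap_sum[of "{..<m}" e' x] by (simp add: slap_diff)
      also have "(\<Sum>j<m. slap (e' j) x) = (\<Sum>j<m. e j x - ?\<nu> m * e' j x)"
      proof (intro sum.cong refl)
        fix j assume "j \<in> {..<m}"
        then have "?\<nu> m - ?\<nu> j \<noteq> 0" using sev_eq_iff[OF dim, of m j] by auto
        then have "e j x = (?\<nu> m - ?\<nu> j) * e' j x" by (simp add: e'_def)
        then show "slap (e' j) x = e j x - ?\<nu> m * e' j x"
          using sle' \<open>j \<in> {..<m}\<close> by (simp add: algebra_simps)
      qed
      also have "\<dots> = (\<Sum>j<m. e j x) - ?\<nu> m * (\<Sum>j<m. e' j x)"
        by (simp add: sum_subtractf sum_distrib_left)
      also have "(\<Sum>j<m. e j x) = slap f x + ?\<nu> m * f x" using fun_cong[OF e(2), of x] by simp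
      finally show ?thesis by (simp add: w_def[of x] algebra_simps)
    qed
  qed
  moreover have "f = (\<lambda>x. \<Sum>j<Suc m. (e'(m := w)) j x)"
    by (simp add: w_def fun_eq_iff)
  ultimately show ?case using e' by (intro exI[of _ "e'(m := w)"]) (auto simp: less_Suc_eq)
qed

lemma dim_inv_spoly_Suc:
  fixes g :: "'a::euclidean_space \<Rightarrow> 'a"
  assumes dim: "DIM('a) \<ge> 2" and g: "orthogonal_transformation g"
  shows "fs.dim (inv_spoly g (Suc m)) = fs.dim (inv_spoly g m) + fs.dim (inv_seig g m)"
proof -
  obtain S T :: "('a \<Rightarrow> real) set" where S: "finite S" "spoly m = fs.span S"
    and T: "finite T" "spoly (Suc m) = fs.span T"
    using spoly_finite_span by metis
  show ?thesis
  proof (rule fs_dim_direct_sum[OF subspace_inv_spoly subspace_inv_seig _ _ S(1) _ T(1)])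
    show "f = (\<lambda>x. 0)" if "f \<in> inv_spoly g m" "f \<in> inv_seig g m" for f
      using that spoly_eigen_eq_0[OF dim, of f m m]
      by (auto simp: inv_spoly_def inv_seig_def seig_def)
    show "inv_spoly g m \<subseteq> fs.span S" using S(2) by (auto simp: inv_spoly_def)
    show "inv_seig g m \<subseteq> fs.span T"
      using inv_seig_subset[OF dim, of g m] T(2) by (auto simp: inv_spoly_def)
    show "inv_spoly g (Suc m) = {\<lambda>x. a x + b x | a b. a \<in> inv_spoly g m \<and> b \<in> inv_seig g m}"
    proof (intro set_eqI iffI)
      fix f assume "f \<in> inv_spoly g (Suc m)"
      then obtain e where e: "\<And>j. j < Suc m \<Longrightarrow> e j \<in> inv_seig g j" "f = (\<lambda>x. \<Sum>j<Suc m. e j x)"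
        using inv_spoly_decomposition[OF dim g] by blast
      have "e j \<in> inv_spoly g m" if "j < m" for j
        using e(1)[of j] that inv_seig_subset[OF dim, of g j] inv_spoly_mono[of "Suc j" m g] by auto
      then have "(\<lambda>x. \<Sum>j<m. e j x) \<in> inv_spoly g m"
        by (intro fs_subspace_sum[OF subspace_inv_spoly]) auto
      then show "f \<in> {\<lambda>x. a x + b x | a b. a \<in> inv_spoly g m \<and> b \<in> inv_seig g m}"
        using e(1)[of m] e(2) by auto
    next
      fix f assume "f \<in> {\<lambda>x. a x + b x | a b. a \<in> inv_spoly g m \<and> b \<in> inv_seig g m}"
      then obtain a b where ab: "f = (\<lambda>x. a x + b x)" "a \<in> inv_spoly g m" "b \<in> inv_seig g m" by blast
      then have "a \<in> inv_spoly g (Suc m)" "b \<in> inv_spoly g (Suc m)"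
        using inv_seig_subset[OF dim, of g m] inv_spoly_mono[of m "Suc m" g] by auto
      then show "f \<in> inv_spoly g (Suc m)"
        unfolding ab(1) by (rule fs_subspace_add[OF subspace_inv_spoly])
    qed
  qed
qed

text \<open>Turns spectral data, the multiplicities, into dimensions of spaces of invariant
  polynomials.\<close>

lemma sum_dim_inv_seig:
  fixes g :: "'a::euclidean_space \<Rightarrow> 'a"
  assumes "DIM('a) \<ge> 2" "orthogonal_transformation g"
  shows "(\<Sum>k<m. fs.dim (inv_seig g k)) = fs.dim (inv_spoly g m)"
proof (induction m)
  case 0
  have "inv_spoly g 0 \<subseteq> fs.span {}" by (auto simp: inv_spoly_def spoly_0 zero_fun_def)
  then show ?case using fs.dim_le_card[of "inv_spoly g 0" "{}"] by simp
qed (simp add: dim_inv_spoly_Suc[OF assms])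

section \<open>Invariant polynomials of a cyclic group\<close>

text \<open>A nonzero polynomial of degree below \<open>q\<close> cannot have \<open>q\<close>
  roots.\<close>

lemma vandermonde_coeffs_eq_0:
  fixes t :: "nat \<Rightarrow> real"
  assumes "inj_on t {..<q}" "\<And>l. l < q \<Longrightarrow> (\<Sum>r<q. c r * t l ^ r) = 0" "r < q"
  shows "c r = 0"
proof (rule ccontr)
  assume "c r \<noteq> 0"
  obtain n where n: "q = Suc n" using assms(3) by (cases q) auto
  have "finite {z. (\<Sum>i\<le>n. c i * z ^ i) = 0} \<and> card {z. (\<Sum>i\<le>n. c i * z ^ i) = 0} \<le> n"
    by (rule polyfun_rootbound) (use \<open>c r \<noteq> 0\<close> assms(3) n in \<open>auto intro!: exI[of _ r]\<close>)
  moreover have "t ` {..<q} \<subseteq> {z. (\<Sum>i\<le>n. c i * z ^ i) = 0}"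
    using assms(2) n by (auto simp: lessThan_Suc_atMost)
  ultimately have "card (t ` {..<q}) \<le> n" by (meson card_mono le_trans)
  then show False using card_image[OF assms(1)] n by simp
qed

text \<open>The transposed system: combining the moments with the coefficients of a polynomial that
  vanishes at all nodes except \<open>t k\<close> isolates \<open>a k\<close>.\<close>

lemma vandermonde_moments_eq_0:
  fixes t a :: "nat \<Rightarrow> real"
  assumes "inj_on t {..<q}" "\<And>r. r < q \<Longrightarrow> (\<Sum>l<q. a l * t l ^ r) = 0" "k < q"
  shows "a k = 0"
proof -
  define P where "P = (\<Prod>l\<in>{..<q} - {k}. [:- t l, 1:])"
  have "degree P \<le> (\<Sum>l\<in>{..<q} - {k}. 1)"
    unfolding P_def by (rule order_trans[OF degree_prod_sum_le]) (auto intro!: sum_mono)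
  then have deg: "degree P < q" using assms(3) by simp
  have P0: "poly P (t l) = 0" if "l < q" "l \<noteq> k" for l
    unfolding P_def poly_prod using that by (intro prod_zero) auto
  have Pk: "poly P (t k) \<noteq> 0"
    unfolding P_def poly_prod using assms(1,3) by (auto simp: inj_on_def)
  have "0 = (\<Sum>r\<le>degree P. coeff P r * (\<Sum>l<q. a l * t l ^ r))"
    using assms(2) deg by simp
  also have "\<dots> = (\<Sum>r\<le>degree P. \<Sum>l<q. a l * (coeff P r * t l ^ r))"
    by (simp add: sum_distrib_left mult.left_commute)
  also have "\<dots> = (\<Sum>l<q. \<Sum>r\<le>degree P. a l * (coeff P r * t l ^ r))" by (rule sum.swap)
  also have "\<dots> = (\<Sum>l<q. a l * poly P (t l))"
    by (simp add: poly_altdef sum_distrib_left)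
  also have "\<dots> = (\<Sum>l\<in>{k}. a l * poly P (t l))"
    using P0 assms(3) by (intro sum.mono_neutral_right) auto
  finally show ?thesis using Pk by simp
qed

lemma negligible_kernel:
  fixes \<phi> :: "'a::euclidean_space \<Rightarrow> real"
  assumes "linear \<phi>" "\<phi> z \<noteq> 0"
  shows "negligible {x. \<phi> x = 0}"
proof -
  define a where "a = (\<Sum>b\<in>Basis. \<phi> b *\<^sub>R b)"
  have eq: "\<phi> x = a \<bullet> x" for x
  proof -
    have "\<phi> x = \<phi> (\<Sum>b\<in>Basis. (x \<bullet> b) *\<^sub>R b)" by (simp add: euclidean_representation)
    also have "\<dots> = (\<Sum>b\<in>Basis. (x \<bullet> b) * \<phi> b)"
      using assms(1) by (simp add: linear_sum linear_scale)
    finally show ?thesis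
      unfolding inner_commute[of a] by (simp add: a_def inner_sum_right mult.commute)
  qed
  have "a \<noteq> 0" using assms(2) eq[of z] by auto
  then have "negligible {x. a \<bullet> x = 0}" by (intro negligible_hyperplane) auto
  then show ?thesis by (simp add: eq)
qed

lemma orthogonal_transformation_funpow:
  fixes g :: "'a::euclidean_space \<Rightarrow> 'a"
  assumes "orthogonal_transformation g"
  shows "orthogonal_transformation (g ^^ l)"
proof (induction l)
  case (Suc l)
  then have "linear (g \<circ> g ^^ l)"
    using assms unfolding orthogonal_transformation_def by (blast intro: linear_compose)
  with Suc assms show ?case by (simp add: orthogonal_transformation_def comp_def)
qed (simp add: orthogonal_transformation_def linear_id id_def[symmetric])

lemma spoly_orthogonal_transformation:
  fixes g :: "'a::euclidean_space \<Rightarrow> 'a"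
  assumes "orthogonal_transformation g" "f \<in> spoly m"
  shows "(\<lambda>x. f (g x)) \<in> spoly m"
  using assms(2)
proof (induction rule: spoly_induct)
  case zero
  show ?case by (rule spoly_zero)
next
  case (step c e f)
  define k where "k = sum e Basis"
  have "(\<lambda>x. smono e (g x)) \<in> spoly (Suc k)"
  proof (rule smono_degree_induct[where P = "\<lambda>k h. (\<lambda>x. h (g x)) \<in> spoly (Suc k)"])
    show "sum e Basis = k" by (simp add: k_def)
    have "(\<lambda>x::'a. if norm x = 1 then 1 else 0) \<in> spoly (Suc 0)" by (rule spoly_const)
    then show "(\<lambda>x. if norm (g x) = 1 then 1 else 0) \<in> spoly (Suc 0)"
      using assms(1) by (simp add: orthogonal_transformation_norm)
  next
    fix m c and e :: "'a \<Rightarrow> nat"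
    assume *: "(\<lambda>x. smono e (g x)) \<in> spoly (Suc m)"
    have "(\<lambda>x. (x \<bullet> adjoint g c) * smono e (g x)) \<in> spoly (Suc (Suc m))"
      by (rule spoly_inner_mult[OF *])
    then show "(\<lambda>x. (g x \<bullet> c) * smono e (g x)) \<in> spoly (Suc (Suc m))"
      using orthogonal_transformation_linear[OF assms(1)] by (simp add: adjoint_works)
  qed
  then have "(\<lambda>x. smono e (g x)) \<in> spoly m"
    using step(1) spoly_mono[of "Suc k" m] by (auto simp: k_def)
  from spoly_add[OF spoly_scale[OF this] step(3)] show ?case .
qed

text \<open>The power \<open>V^q\<close> encoded as a space of real functions, so that
  \<open>fs.dim\<close> applies to it; the value 0 from index \<open>q\<close> on makes the encoding
  unique.\<close>

definition tuples :: "nat \<Rightarrow> ('a \<Rightarrow> real) set \<Rightarrow> ('a \<times> nat \<Rightarrow> real) set" where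
  "tuples q V = {F. (\<forall>r<q. (\<lambda>x. F (x, r)) \<in> V) \<and> (\<forall>r x. q \<le> r \<longrightarrow> F (x, r) = 0)}"

lemma fs_linearI:
  assumes "\<And>f g. \<phi> (\<lambda>x. f x + g x) = (\<lambda>y. \<phi> f y + \<phi> g y)" "\<And>c f. \<phi> (\<lambda>x. c * f x) = (\<lambda>y. c * \<phi> f y)"
  shows "Vector_Spaces.linear fun_scale fun_scale \<phi>"
  unfolding Vector_Spaces.linear_iff using assms by (simp add: vector_space_fun_scale plus_fun_def fun_scale_def)

lemma fs_inj_onI:
  assumes "Vector_Spaces.linear fun_scale fun_scale \<phi>" "fs.subspace A"
    "\<And>f. f \<in> A \<Longrightarrow> \<phi> f = (\<lambda>x. 0) \<Longrightarrow> f = (\<lambda>x. 0)"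
  shows "inj_on \<phi> A"
  using assms fsp.linear_inj_on_iff_eq_0[OF assms(1,2)] by (simp add: zero_fun_def)

lemma subspace_tuples: "fs.subspace V \<Longrightarrow> fs.subspace (tuples q V)"
  by (rule fs_subspaceI)
    (auto simp: tuples_def intro: fs_subspace_zero fs_subspace_add fs_subspace_scale)

text \<open>The finite spanning set is carried through the induction because
  \<open>fs_dim_direct_sum\<close> asks for one.\<close>

lemma dim_tuples:
  assumes V: "fs.subspace V" "V \<subseteq> fs.span S" "finite S"
  shows "fs.dim (tuples q V) = q * fs.dim V \<and> (\<exists>T. finite T \<and> tuples q V \<subseteq> fs.span T)"
proof (induction q)
  case 0
  have "tuples 0 V \<subseteq> fs.span {}" by (auto simp: tuples_def zero_fun_def fun_eq_iff)
  then have "finite ({} :: ('a \<times> nat \<Rightarrow> real) set) \<and> tuples 0 V \<subseteq> fs.span {}" by simp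
  moreover from this have "fs.dim (tuples 0 V) = 0" using fs.dim_le_card[of "tuples 0 V" "{}"] by simp
  ultimately show ?case by (metis mult_0)
next
  case (Suc q)
  then obtain T where T: "finite T" "tuples q V \<subseteq> fs.span T" by blast
  define \<phi> :: "('a \<Rightarrow> real) \<Rightarrow> 'a \<times> nat \<Rightarrow> real" where
    "\<phi> f = (\<lambda>(x, r). if r = q then f x else 0)" for f
  have lin: "Vector_Spaces.linear fun_scale fun_scale \<phi>"
    by (rule fs_linearI) (auto simp: \<phi>_def fun_eq_iff)
  have inj: "inj_on \<phi> V"
  proof (rule inj_onI)
    fix f g assume "\<phi> f = \<phi> g"
    then have "\<phi> f (x, q) = \<phi> g (x, q)" for x by simp
    then show "f = g" by (auto simp: \<phi>_def)
  qed
  have span: "\<phi> ` V \<subseteq> fs.span (\<phi> ` S)"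
    using fsp.linear_span_image[OF lin, of S] V(2) by auto
  have eq: "tuples (Suc q) V = {\<lambda>x. a x + b x | a b. a \<in> tuples q V \<and> b \<in> \<phi> ` V}"
  proof (intro set_eqI iffI)
    fix F assume F: "F \<in> tuples (Suc q) V"
    define a where "a = (\<lambda>(x, r). if r < q then F (x, r) else 0)"
    have "a \<in> tuples q V" using F by (auto simp: tuples_def a_def)
    moreover have "(\<lambda>x. F (x, q)) \<in> V" using F by (auto simp: tuples_def)
    moreover have "F = (\<lambda>x. a x + \<phi> (\<lambda>x. F (x, q)) x)"
      using F by (auto simp: a_def \<phi>_def tuples_def fun_eq_iff not_less less_Suc_eq)
    ultimately show "F \<in> {\<lambda>x. a x + b x | a b. a \<in> tuples q V \<and> b \<in> \<phi> ` V}" by blast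
  next
    fix F assume "F \<in> {\<lambda>x. a x + b x | a b. a \<in> tuples q V \<and> b \<in> \<phi> ` V}"
    then show "F \<in> tuples (Suc q) V"
      by (auto simp: tuples_def \<phi>_def less_Suc_eq)
  qed
  have "fs.dim (tuples (Suc q) V) = fs.dim (tuples q V) + fs.dim (\<phi> ` V)"
  proof (rule fs_dim_direct_sum[OF subspace_tuples[OF V(1)] _ _ T(2,1) span _ eq])
    show "fs.subspace (\<phi> ` V)" by (rule fsp.linear_subspace_image[OF lin V(1)])
    show "f = (\<lambda>x. 0)" if "f \<in> tuples q V" "f \<in> \<phi> ` V" for f
    proof
      fix y :: "'a \<times> nat"
      obtain x r where y: "y = (x, r)" by (cases y)
      show "f y = 0" using that by (cases "r < q") (auto simp: y tuples_def \<phi>_def)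
    qed
  qed (use V in auto)
  moreover have "fs.dim (\<phi> ` V) = fs.dim V" by (rule fs_dim_image[OF lin V(1) inj])
  moreover have "tuples (Suc q) V \<subseteq> fs.span (T \<union> \<phi> ` S)"
  proof
    fix F assume "F \<in> tuples (Suc q) V"
    then obtain a b where "F = a + b" "a \<in> tuples q V" "b \<in> \<phi> ` V"
      unfolding eq by (auto simp: plus_fun_def)
    then show "F \<in> fs.span (T \<union> \<phi> ` S)"
      unfolding fs.span_Un using T(2) span by blast
  qed
  ultimately show ?case using Suc T(1) V(3) by (intro conjI exI[of _ "T \<union> \<phi> ` S"]) auto
qed


text \<open>The coordinate along \<open>c\<close> takes distinct values on the first
  \<open>q\<close> iterates of a generic point. In particular \<open>separated\<close> forces
  \<open>q\<close> to be the exact order of \<open>g\<close>.\<close>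

locale separated_cyclic_action =
  fixes g :: "'a::euclidean_space \<Rightarrow> 'a" and q :: nat and c :: 'a
  assumes orth: "orthogonal_transformation g"
    and order: "g ^^ q = id" and q_pos: "0 < q"
    and separated: "\<And>l l'. l < l' \<Longrightarrow> l' < q \<Longrightarrow> \<exists>z. (g ^^ l) z \<bullet> c \<noteq> (g ^^ l') z \<bullet> c"
begin

lemma orth_funpow: "orthogonal_transformation (g ^^ l)"
  by (rule orthogonal_transformation_funpow[OF orth])

text \<open>Non-generic points lie in finitely many hyperplanes, a null set, whereas the set off the
  origin where the radial extension of \<open>f\<close> is nonzero is open; an open null set is
  empty.\<close>

lemma spoly_eq_0_if_generic:
  assumes f: "f \<in> spoly m"
    and gen: "\<And>x. norm x = 1 \<Longrightarrow> inj_on (\<lambda>l. (g ^^ l) x \<bullet> c) {..<q} \<Longrightarrow> f x = 0"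
  shows "f = (\<lambda>x. 0)"
proof -
  let ?P = "{(l, l'). l < l' \<and> l' < q}"
  define Z where "Z = (\<Union>(l, l')\<in>?P. {x. (g ^^ l) x \<bullet> c - (g ^^ l') x \<bullet> c = 0})"
  have "finite ?P" by (rule finite_subset[of _ "{..<q} \<times> {..<q}"]) auto
  moreover have "negligible {x. (g ^^ l) x \<bullet> c - (g ^^ l') x \<bullet> c = 0}" if l: "l < l'" "l' < q" for l l'
  proof -
    obtain z where "(g ^^ l) z \<bullet> c - (g ^^ l') z \<bullet> c \<noteq> 0" using separated[OF l] by auto
    moreover have "linear (\<lambda>x. (g ^^ l) x \<bullet> c - (g ^^ l') x \<bullet> c)"
      using orthogonal_transformation_linear[OF orth_funpow[of l]]
        orthogonal_transformation_linear[OF orth_funpow[of l']]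
      by (intro linearI) (simp_all add: linear_add linear_scale inner_add_left algebra_simps)
    ultimately show ?thesis by (rule negligible_kernel[rotated])
  qed
  ultimately have Z: "negligible Z" unfolding Z_def by (intro negligible_Union) auto
  have sm: "continuous_on (- {0}) (radial f)"
    by (rule smooth_continuous_on_radial[OF smooth_spoly[OF f]])
  have "open (- {0} \<inter> radial f -` (- {0}))"
    by (rule continuous_open_preimage[OF sm]) auto
  moreover have sub: "- {0} \<inter> radial f -` (- {0}) \<subseteq> Z"
  proof
    fix x assume "x \<in> - {0} \<inter> radial f -` (- {0})"
    then have x: "radial f x \<noteq> 0" "x \<noteq> 0" by auto
    show "x \<in> Z"
    proof (rule ccontr)
      assume "x \<notin> Z"
      have "(g ^^ l) (sgn x) \<bullet> c = ((g ^^ l) x \<bullet> c) / norm x" for l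
        unfolding sgn_orthogonal_transformation[OF orth_funpow, symmetric]
        by (simp add: sgn_div_norm orthogonal_transformation_norm[OF orth_funpow] divide_inverse mult.commute)
      then have "(g ^^ l) (sgn x) \<bullet> c \<noteq> (g ^^ l') (sgn x) \<bullet> c" if "l < l'" "l' < q" for l l'
        using \<open>x \<notin> Z\<close> that x(2) by (auto simp: Z_def)
      then have "inj_on (\<lambda>l. (g ^^ l) (sgn x) \<bullet> c) {..<q}"
        by (intro linorder_inj_onI) auto
      then have "f (sgn x) = 0" using x(2) by (intro gen) (auto simp: norm_sgn)
      then show False using x(1) by (simp add: radial_def)
    qed
  qed
  ultimately have "- {0} \<inter> radial f -` (- {0}) = {}"
    using open_not_negligible negligible_subset[OF Z sub] by blast
  then have *: "x \<noteq> 0 \<Longrightarrow> radial f x = 0" for x by blast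
  show ?thesis
  proof
    fix x
    show "f x = 0"
    proof (cases "norm x = 1")
      case True
      then have "radial f x = 0" by (intro *) auto
      then show ?thesis using True by (simp add: radial_def sgn_div_norm)
    next
      case False
      then show ?thesis using f spoly_off_sphere by blast
    qed
  qed
qed

lemma inv_funpow: "(\<And>x. f (g x) = f x) \<Longrightarrow> f ((g ^^ l) x) = f x"
  by (induction l) auto

lemma inv_spoly_finite_span: "\<exists>S. finite S \<and> inv_spoly g m \<subseteq> fs.span S"
  using spoly_finite_span[where m = m and 'a = 'a] by (auto simp: inv_spoly_def)

lemma spoly_power_mult:
  assumes "f \<in> spoly (Suc m)"
  shows "(\<lambda>x. f x * (x \<bullet> c) ^ r) \<in> spoly (Suc (m + r))"
proof (induction r)
  case (Suc r)
  from spoly_inner_mult[OF Suc, of c] show ?case by (simp add: algebra_simps)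
qed (simp add: assms)

lemma dim_inv_spoly_le:
  "q * fs.dim (inv_spoly g (Suc m)) \<le> fs.dim (spoly (Suc (m + q)) :: ('a \<Rightarrow> real) set)"
proof -
  let ?V = "inv_spoly g (Suc m)"
  obtain S where S: "finite S" "?V \<subseteq> fs.span S" using inv_spoly_finite_span by blast
  define \<phi> where "\<phi> F = (\<lambda>x. \<Sum>r<q. F (x, r) * (x \<bullet> c) ^ r)" for F :: "'a \<times> nat \<Rightarrow> real"
  have lin: "Vector_Spaces.linear fun_scale fun_scale \<phi>"
    by (rule fs_linearI) (auto simp: \<phi>_def fun_eq_iff distrib_right sum.distrib sum_distrib_left mult.assoc)
  have sub: "\<phi> ` tuples q ?V \<subseteq> spoly (Suc (m + q))"
  proof clarify
    fix F assume F: "F \<in> tuples q ?V"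
    have "(\<lambda>x. F (x, r) * (x \<bullet> c) ^ r) \<in> spoly (Suc (m + q))" if "r < q" for r
      using F that spoly_power_mult[of "\<lambda>x. F (x, r)" m r] spoly_mono[of "Suc (m + r)" "Suc (m + q)"]
      by (auto simp: tuples_def inv_spoly_def)
    then show "\<phi> F \<in> spoly (Suc (m + q))" unfolding \<phi>_def by (intro spoly_sum) auto
  qed
  have inj: "inj_on \<phi> (tuples q ?V)"
  proof (rule fs_inj_onI[OF lin subspace_tuples[OF subspace_inv_spoly]])
    fix F assume F: "F \<in> tuples q ?V" and 0: "\<phi> F = (\<lambda>x. 0)"
    have "(\<lambda>x. F (x, r)) = (\<lambda>x. 0)" if r: "r < q" for r
    proof (rule spoly_eq_0_if_generic)
      show "(\<lambda>x. F (x, r)) \<in> spoly (Suc m)" using F r by (auto simp: tuples_def inv_spoly_def)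
      fix x assume inj: "inj_on (\<lambda>l. (g ^^ l) x \<bullet> c) {..<q}"
      show "F (x, r) = 0"
      proof (rule vandermonde_coeffs_eq_0[OF inj _ r])
        fix l
        \<comment> \<open>The coefficients are constant along the orbit, so one polynomial of degree
          below \<open>q\<close> has roots at all \<open>q\<close> nodes.\<close>
        have "F ((g ^^ l) x, r) = F (x, r)" if "r < q" for r
          using F that inv_funpow[of "\<lambda>x. F (x, r)"] by (auto simp: tuples_def inv_spoly_def)
        then show "(\<Sum>r<q. F (x, r) * ((g ^^ l) x \<bullet> c) ^ r) = 0"
          using fun_cong[OF 0, of "(g ^^ l) x"] by (simp add: \<phi>_def)
      qed
    qed
    then have "F (x, r) = 0" for x r
      using F by (cases "r < q") (auto simp: tuples_def dest: fun_cong)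
    then show "F = (\<lambda>x. 0)" by auto
  qed
  have "q * fs.dim ?V = fs.dim (tuples q ?V)"
    using dim_tuples[OF subspace_inv_spoly S(2,1)] by simp
  also have "\<dots> = fs.dim (\<phi> ` tuples q ?V)"
    by (rule fs_dim_image[OF lin subspace_tuples[OF subspace_inv_spoly] inj, symmetric])
  also have "\<dots> \<le> fs.dim (spoly (Suc (m + q)) :: ('a \<Rightarrow> real) set)"
    by (rule fs_dim_subset_spoly[OF sub order_refl])
  finally show ?thesis .
qed

text \<open>On a generic orbit the weighted sums over the group are the moments of the values of
  \<open>f\<close> at distinct nodes, and \<open>q\<close> moments at \<open>q\<close> nodes
  determine these values.\<close>

lemma dim_spoly_le:
  "fs.dim (spoly (Suc m) :: ('a \<Rightarrow> real) set) \<le> q * fs.dim (inv_spoly g (Suc (m + q)))"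
proof -
  let ?V = "inv_spoly g (Suc (m + q))"
  obtain S where S: "finite S" "?V \<subseteq> fs.span S" using inv_spoly_finite_span by blast
  obtain T where T: "finite T" "tuples q ?V \<subseteq> fs.span T"
    using dim_tuples[OF subspace_inv_spoly S(2,1)] by blast
  define \<psi> :: "('a \<Rightarrow> real) \<Rightarrow> 'a \<times> nat \<Rightarrow> real" where
    "\<psi> f = (\<lambda>(x, r). if r < q then \<Sum>l<q. f ((g ^^ l) x) * ((g ^^ l) x \<bullet> c) ^ r else 0)" for f
  have lin: "Vector_Spaces.linear fun_scale fun_scale \<psi>"
    by (rule fs_linearI) (auto simp: \<psi>_def fun_eq_iff distrib_right sum.distrib sum_distrib_left mult.assoc)
  have sub: "\<psi> ` spoly (Suc m) \<subseteq> tuples q ?V"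
  proof clarify
    fix f :: "'a \<Rightarrow> real" assume f: "f \<in> spoly (Suc m)"
    have "(\<lambda>x. \<Sum>l<q. f ((g ^^ l) x) * ((g ^^ l) x \<bullet> c) ^ r) \<in> ?V" if r: "r < q" for r
    proof -
      define h where "h x = f x * (x \<bullet> c) ^ r" for x
      have h: "h \<in> spoly (Suc (m + q))"
        using spoly_power_mult[OF f, of r] r spoly_mono[of "Suc (m + r)" "Suc (m + q)"]
        by (auto simp: h_def [abs_def])
      have "(\<Sum>l<q. h ((g ^^ l) (g x))) = (\<Sum>l<q. h ((g ^^ l) x))" for x
      proof -
        \<comment> \<open>Applying \<open>g\<close> shifts the summation by one; the extra term at
          \<open>q\<close> is the missing term at 0, as \<open>g\<close> has order
          \<open>q\<close>.\<close>
        have "h x + (\<Sum>l<q. h ((g ^^ Suc l) x)) = (\<Sum>l<Suc q. h ((g ^^ l) x))"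
          by (subst sum.lessThan_Suc_shift) simp
        also have "\<dots> = (\<Sum>l<q. h ((g ^^ l) x)) + h x" using order by simp
        finally show ?thesis by (simp add: funpow_swap1)
      qed
      moreover have "(\<lambda>x. \<Sum>l<q. h ((g ^^ l) x)) \<in> spoly (Suc (m + q))"
        by (intro spoly_sum spoly_orthogonal_transformation[OF orth_funpow h])
      ultimately show ?thesis by (simp add: inv_spoly_def h_def)
    qed
    then show "\<psi> f \<in> tuples q ?V" by (auto simp: tuples_def \<psi>_def)
  qed
  have inj: "inj_on \<psi> (spoly (Suc m))"
  proof (rule fs_inj_onI[OF lin subspace_spoly])
    fix f :: "'a \<Rightarrow> real" assume f: "f \<in> spoly (Suc m)" and 0: "\<psi> f = (\<lambda>x. 0)"
    show "f = (\<lambda>x. 0)"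
    proof (rule spoly_eq_0_if_generic[OF f])
      fix x assume inj: "inj_on (\<lambda>l. (g ^^ l) x \<bullet> c) {..<q}"
      have "(\<Sum>l<q. f ((g ^^ l) x) * ((g ^^ l) x \<bullet> c) ^ r) = 0" if "r < q" for r
        using fun_cong[OF 0, of "(x, r)"] that by (simp add: \<psi>_def)
      \<comment> \<open>Index 0 is the point \<open>x\<close> itself.\<close>
      from vandermonde_moments_eq_0[OF inj this, of 0] show "f x = 0" using q_pos by simp
    qed
  qed
  have "fs.dim (spoly (Suc m) :: ('a \<Rightarrow> real) set) = fs.dim (\<psi> ` spoly (Suc m))"
    by (rule fs_dim_image[OF lin subspace_spoly inj, symmetric])
  also have "\<dots> \<le> fs.dim (tuples q ?V)" by (rule fs_dim_mono[OF sub T(2,1)])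
  also have "\<dots> = q * fs.dim ?V" using dim_tuples[OF subspace_inv_spoly S(2,1)] by simp
  finally show ?thesis .
qed

text \<open>The constants are invariant; this starts the iteration in the comparison of the
  orders.\<close>

lemma dim_inv_spoly_pos: "1 \<le> fs.dim (inv_spoly g (Suc m))"
proof -
  have one: "(\<lambda>x. if norm x = 1 then 1 else 0) \<in> inv_spoly g (Suc m)" (is "?h \<in> _")
    using spoly_const orthogonal_transformation_norm[OF orth] by (simp add: inv_spoly_def)
  obtain b :: 'a where "b \<in> Basis" using nonempty_Basis by blast
  then have "norm b = 1" by simp
  then have "fs.independent {?h}" by (auto simp: fs.independent_insert fun_eq_iff)
  then have "fs.dim {?h} = 1" using fs.dim_eq_card_independent[of "{?h}"] by simp
  moreover have "fs.dim {?h} \<le> fs.dim (inv_spoly g (Suc m))"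
    by (rule fs_dim_subset_spoly[of _ _ "Suc m"]) (use one in \<open>auto simp: inv_spoly_def\<close>)
  ultimately show ?thesis by simp
qed

end

lemma polynomial_over_exponential_tendsto_0:
  fixes a s :: real
  assumes "1 < a" "0 < s"
  shows "(\<lambda>k. (real k * s + 1) ^ n / a ^ k) \<longlonglongrightarrow> 0"
  using assms by real_asymp

text \<open>Equal dimensions of the invariant spaces force \<open>q1 ^ k\<close> to be at most \<open>q2 ^ k\<close> times a
  polynomial in \<open>k\<close>.\<close>

lemma separated_cyclic_action_order_le:
  fixes g1 g2 :: "'a::euclidean_space \<Rightarrow> 'a"
  assumes "separated_cyclic_action g1 q1 c1" "separated_cyclic_action g2 q2 c2"
    and dim: "\<And>m. fs.dim (inv_spoly g1 m) = fs.dim (inv_spoly g2 m)"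
  shows "q1 \<le> q2"
proof (rule ccontr)
  interpret A: separated_cyclic_action g1 q1 c1 by fact
  interpret B: separated_cyclic_action g2 q2 c2 by fact
  assume "\<not> q1 \<le> q2"
  \<comment> \<open>One round raises the degree by \<open>q1\<close> on passing from invariants of
    \<open>g1\<close> to all polynomials and by \<open>q2\<close> on returning to invariants of
    \<open>g2\<close>.\<close>
  define s where "s = q1 + q2"
  define x where "x k = fs.dim (inv_spoly g1 (Suc (k * s)))" for k
  have step: "q1 * x k \<le> q2 * x (Suc k)" for k
  proof -
    have "q1 * x k \<le> fs.dim (spoly (Suc (k * s + q1)) :: ('a \<Rightarrow> real) set)"
      unfolding x_def by (rule A.dim_inv_spoly_le)
    also have "\<dots> \<le> q2 * fs.dim (inv_spoly g2 (Suc (k * s + q1 + q2)))"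
      by (rule B.dim_spoly_le)
    also have "\<dots> = q2 * x (Suc k)" by (simp add: x_def dim s_def add_ac)
    finally show ?thesis .
  qed
  have pow: "q1 ^ k \<le> q2 ^ k * x k" for k
  proof (induction k)
    case 0
    then show ?case using A.dim_inv_spoly_pos[of 0] by (simp add: x_def)
  next
    case (Suc k)
    have "q1 ^ Suc k \<le> q2 ^ k * (q1 * x k)" using mult_left_mono[OF Suc, of q1] by (simp add: ac_simps)
    also have "\<dots> \<le> q2 ^ k * (q2 * x (Suc k))" using step by (intro mult_left_mono) auto
    finally show ?case by (simp add: ac_simps)
  qed
  have x_le: "x k \<le> (k * s + 1) ^ DIM('a)" for k
    using fs_dim_spoly_le[of "inv_spoly g1 (Suc (k * s))" "Suc (k * s)"]
    by (auto simp: x_def inv_spoly_def)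
  define a where "a = real q1 / real q2"
  have a: "1 < a" using \<open>\<not> q1 \<le> q2\<close> B.q_pos by (simp add: a_def)
  have "1 \<le> (real k * real s + 1) ^ DIM('a) / a ^ k" for k
  proof -
    have "real (q1 ^ k) \<le> real (q2 ^ k * (k * s + 1) ^ DIM('a))"
      using pow[of k] x_le[of k] by (meson le_trans mult_le_mono2 of_nat_mono)
    then have "a ^ k \<le> (real k * real s + 1) ^ DIM('a)"
      using B.q_pos by (simp add: a_def power_divide pos_divide_le_eq mult.commute add.commute)
    then show ?thesis using a by simp
  qed
  moreover have "(\<lambda>k. (real k * real s + 1) ^ DIM('a) / a ^ k) \<longlonglongrightarrow> 0"
    using a A.q_pos by (intro polynomial_over_exponential_tendsto_0) (auto simp: s_def)
  ultimately have "1 \<le> (0 :: real)" by (intro LIMSEQ_le_const) auto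
  then show False by simp
qed

section \<open>The spectrum of a lens space determines its order\<close>

lemma rot_mult_nth:
  "(rot t *v x) $ 1 = cos t * x $ 1 - sin t * x $ 2"
  "(rot t *v x) $ 2 = sin t * x $ 1 + cos t * x $ 2"
  by (simp_all add: rot_def matrix_vector_mult_def sum_2)

lemma rot_add: "rot s *v (rot t *v x) = rot (s + t) *v x"
  by (simp add: vec_eq_iff forall_2 rot_mult_nth cos_add sin_add algebra_simps)

lemma rot_inner: "(rot t *v x) \<bullet> (rot t *v y) = x \<bullet> y"
  unfolding inner_vec_def sum_2 rot_mult_nth inner_real_def
  using sin_cos_squared_add[of t] by algebra

lemma orthogonal_transformation_lens_gen: "orthogonal_transformation (lens_gen p q)"
  unfolding orthogonal_transformation_def
proof (intro conjI allI)
  show "linear (lens_gen p q)"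
    by (rule linearI) (simp_all add: lens_gen_def vec_eq_iff matrix_vector_right_distrib
        matrix_vector_mult_scaleR)
  show "lens_gen p q x \<bullet> lens_gen p q y = x \<bullet> y" for x y
  proof -
    have "lens_gen p q x \<bullet> lens_gen p q y = (\<Sum>j\<in>UNIV. lens_gen p q x $ j \<bullet> lens_gen p q y $ j)"
      by (rule inner_vec_def)
    also have "\<dots> = (\<Sum>j\<in>UNIV. x $ j \<bullet> y $ j)" by (simp add: lens_gen_def rot_inner)
    also have "\<dots> = x \<bullet> y" by (rule inner_vec_def[symmetric])
    finally show ?thesis .
  qed
qed

lemma lens_gen_funpow:
  "(lens_gen p q ^^ k) x = (\<chi> j. rot (real k * (2 * pi * of_int (p j) / of_nat q)) *v (x $ j))"
proof (induction k)
  case 0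
  show ?case by (simp add: vec_eq_iff[of x] vec_eq_iff forall_2 rot_mult_nth)
next
  case (Suc k)
  have "(lens_gen p q ^^ Suc k) x = lens_gen p q ((lens_gen p q ^^ k) x)" by simp
  also have "\<dots> = (\<chi> j. rot (real (Suc k) * (2 * pi * of_int (p j) / of_nat q)) *v (x $ j))"
    unfolding Suc lens_gen_def by (simp add: rot_add add_divide_distrib distrib_right)
  finally show ?case .
qed

lemma lens_gen_order:
  assumes "0 < q"
  shows "lens_gen p q ^^ q = id"
proof
  fix x :: "real^2^'a"
  have "real q * (2 * pi * of_int (p j) / of_nat q) = 2 * pi * of_int (p j)" for j
    using assms by simp
  then show "(lens_gen p q ^^ q) x = id x"
    by (simp only: lens_gen_funpow id_apply)
      (simp add: vec_eq_iff forall_2 rot_mult_nth cos_int_2pin sin_int_2pin)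
qed

text \<open>Any plane \<open>j\<close> serves: \<open>p j\<close> is invertible modulo
  \<open>q\<close>, so the multiples of its rotation angle by 0 up to \<open>q - 1\<close> are
  distinct modulo \<open>2 pi\<close>.\<close>

lemma lens_gen_separated:
  fixes p :: "'n::finite \<Rightarrow> int"
  assumes "0 < q" "\<And>j. coprime (p j) (int q)"
  shows "separated_cyclic_action (lens_gen p q) q (axis j (axis 1 1))"
proof
  show "orthogonal_transformation (lens_gen p q)" by (rule orthogonal_transformation_lens_gen)
  show "lens_gen p q ^^ q = id" "0 < q" using lens_gen_order[OF assms(1)] assms(1) by auto
  fix l l' assume l: "l < l'" "l' < q"
  define t where "t = 2 * pi * of_int (p j) / real q"
  have inner: "(lens_gen p q ^^ k) (axis j v) \<bullet> axis j (axis 1 1)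
    = cos (real k * t) * v $ 1 - sin (real k * t) * v $ 2" for k v
    by (simp add: lens_gen_funpow inner_axis inner_axis rot_mult_nth t_def)
  show "\<exists>z. (lens_gen p q ^^ l) z \<bullet> axis j (axis 1 1) \<noteq> (lens_gen p q ^^ l') z \<bullet> axis j (axis 1 1)"
  proof (rule ccontr)
    assume "\<not> ?thesis"
    then have eq: "(lens_gen p q ^^ l') z \<bullet> axis j (axis 1 1) = (lens_gen p q ^^ l) z \<bullet> axis j (axis 1 1)" for z
      by metis
    \<comment> \<open>The two unit vectors of the plane recover cosine and sine, hence the angle
      modulo \<open>2 pi\<close>.\<close>
    have "cos (real l' * t) = cos (real l * t)"
      using eq[of "axis j (axis 1 1)"] unfolding inner by (simp add: axis_def)
    moreover have "sin (real l' * t) = sin (real l * t)"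
      using eq[of "axis j (axis 2 1)"] unfolding inner by (simp add: axis_def)
    ultimately obtain n :: int where n: "real l' * t = real l * t + 2 * pi * n"
      using sin_cos_eq_iff by blast
    then have "2 * pi * (real (l' - l) * of_int (p j)) = 2 * pi * (of_int n * real q)"
      using l assms(1) by (simp add: t_def field_simps of_nat_diff)
    then have "real (l' - l) * of_int (p j) = of_int n * real q" by simp
    then have "real_of_int (int (l' - l) * p j) = real_of_int (n * int q)"
      by (simp only: of_int_mult of_int_of_nat_eq)
    then have "int (l' - l) * p j = n * int q" by (simp only: of_int_eq_iff)
    then have "int q dvd int (l' - l) * p j" by simp
    then have "int q dvd int (l' - l)"
      using assms(2)[of j] by (simp add: coprime_commute coprime_dvd_mult_left_iff)
    then have "q dvd l' - l" by (simp only: int_dvd_int_iff)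
    then show False using l by (auto dest: dvd_imp_le)
  qed
qed

lemma lens_orbit_gen:
  assumes "0 < q"
  shows "lens_orbit p q (lens_gen p q x) = lens_orbit p q x"
proof -
  let ?g = "lens_gen p q"
  \<comment> \<open>Orbits use natural exponents only; \<open>q - 1\<close> further steps act as the
    inverse of the generator.\<close>
  have "(?g ^^ k) x = (?g ^^ (k + q - 1)) (?g x)" for k
  proof -
    have "(?g ^^ (k + q - 1)) (?g x) = (?g ^^ Suc (k + q - 1)) x" by (simp add: funpow_swap1)
    also have "Suc (k + q - 1) = k + q" using assms by simp
    also have "(?g ^^ (k + q)) x = (?g ^^ k) x" by (simp add: funpow_add lens_gen_order[OF assms])
    finally show ?thesis ..
  qed
  moreover have "(?g ^^ k) (?g x) = (?g ^^ Suc k) x" for k by (simp add: funpow_swap1)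
  ultimately show ?thesis unfolding lens_orbit_def by blast
qed

text \<open>The generator preserves norms. Thus vanishing outside the quotient pulls back to
  vanishing off the sphere.\<close>

lemma lens_orbit_in_lens_space_iff: "lens_orbit p q x \<in> lens_space p q \<longleftrightarrow> norm x = 1"
proof
  assume "lens_orbit p q x \<in> lens_space p q"
  then obtain y where y: "norm y = 1" "lens_orbit p q x = lens_orbit p q y"
    by (auto simp: lens_space_def)
  have "(lens_gen p q ^^ 0) x \<in> lens_orbit p q x" unfolding lens_orbit_def by blast
  then obtain k where "x = (lens_gen p q ^^ k) y" using y(2) by (auto simp: lens_orbit_def)
  then show "norm x = 1"
    using y(1) orthogonal_transformation_norm[OF
        orthogonal_transformation_funpow[OF orthogonal_transformation_lens_gen[of p q]], of k y] by simp
qed (auto simp: lens_space_def)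

lemma lens_eigenspace_iff:
  fixes p :: "'n::finite \<Rightarrow> int"
  assumes "0 < q"
  shows "F \<in> lens_eigenspace p q (sev TYPE(real^2^'n) k) \<longleftrightarrow>
    (\<forall>X. X \<notin> lens_space p q \<longrightarrow> F X = 0) \<and> (\<lambda>x. F (lens_orbit p q x)) \<in> inv_seig (lens_gen p q) k"
proof -
  have "(\<forall>x. norm x \<noteq> 1 \<longrightarrow> F (lens_orbit p q x) = 0)" if "\<forall>X. X \<notin> lens_space p q \<longrightarrow> F X = 0"
    using that lens_orbit_in_lens_space_iff by blast
  moreover have "(\<forall>x\<in>sphere 0 1. - sphere_laplacian (\<lambda>x. F (lens_orbit p q x)) x
      = sev TYPE(real^2^'n) k * F (lens_orbit p q x)) \<longleftrightarrow>
    (\<forall>x. slap (\<lambda>x. F (lens_orbit p q x)) x = - sev TYPE(real^2^'n) k * F (lens_orbit p q x))"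
    if "smooth_on_sphere (\<lambda>x. F (lens_orbit p q x))" "\<forall>x. norm x \<noteq> 1 \<longrightarrow> F (lens_orbit p q x) = 0"
  proof -
    have "slap (\<lambda>x. F (lens_orbit p q x)) x = - sev TYPE(real^2^'n) k * F (lens_orbit p q x)
      \<longleftrightarrow> (norm x = 1 \<longrightarrow> - sphere_laplacian (\<lambda>x. F (lens_orbit p q x)) x
      = sev TYPE(real^2^'n) k * F (lens_orbit p q x))" for x
      using that by (cases "norm x = 1") (auto simp: sphere_laplacian_eq_slap)
    then show ?thesis by auto
  qed
  ultimately show ?thesis
    using lens_orbit_gen[OF assms, of p]
    by (auto simp: lens_eigenspace_def inv_seig_def seig_def comp_def)
qed

text \<open>Pulling back along \<open>lens_orbit p q\<close> is a linear bijection from the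
  eigenspace to the invariant eigenfunctions.\<close>

lemma eigenvalue_multiplicity_eq_dim:
  fixes p :: "'n::finite \<Rightarrow> int"
  assumes "0 < q"
  shows "eigenvalue_multiplicity p q (sev TYPE(real^2^'n) k) = fs.dim (inv_seig (lens_gen p q) k)"
proof -
  let ?E = "lens_eigenspace p q (sev TYPE(real^2^'n) k)" and ?g = "lens_gen p q"
  define \<phi> :: "((real^2^'n) set \<Rightarrow> real) \<Rightarrow> real^2^'n \<Rightarrow> real" where
    "\<phi> F = (\<lambda>x. F (lens_orbit p q x))" for F
  note iff = lens_eigenspace_iff[OF assms, of _ p k, folded \<phi>_def]
  have lin: "Vector_Spaces.linear fun_scale fun_scale \<phi>"
    by (rule fs_linearI) (auto simp: \<phi>_def)
  have sub: "fs.subspace ?E"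
  proof (rule fs_subspaceI)
    show "(\<lambda>X. 0) \<in> ?E"
      using fs_subspace_zero[OF subspace_inv_seig, of ?g k] by (simp add: iff \<phi>_def)
    show "(\<lambda>X. F X + F' X) \<in> ?E" if "F \<in> ?E" "F' \<in> ?E" for F F'
      using that fs_subspace_add[OF subspace_inv_seig, of "\<phi> F" ?g k "\<phi> F'"]
      by (simp add: iff) (simp add: \<phi>_def)
    show "(\<lambda>X. c * F X) \<in> ?E" if "F \<in> ?E" for F c
      using that fs_subspace_scale[OF subspace_inv_seig, of "\<phi> F" ?g k c]
      by (simp add: iff) (simp add: \<phi>_def)
  qed
  have inj: "inj_on \<phi> ?E"
  proof (rule inj_onI)
    fix F F' assume F: "F \<in> ?E" "F' \<in> ?E" "\<phi> F = \<phi> F'"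
    show "F = F'"
    proof
      fix X
      show "F X = F' X"
      proof (cases "X \<in> lens_space p q")
        case True
        then obtain x where "X = lens_orbit p q x" by (auto simp: lens_space_def)
        then show ?thesis using fun_cong[OF F(3), of x] by (simp add: \<phi>_def)
      qed (use F in \<open>simp add: iff\<close>)
    qed
  qed
  have "\<phi> ` ?E = inv_seig ?g k"
  proof (intro set_eqI iffI)
    fix f assume "f \<in> \<phi> ` ?E"
    then show "f \<in> inv_seig ?g k" by (auto simp: iff)
  next
    fix f assume f: "f \<in> inv_seig ?g k"
    \<comment> \<open>By invariance of \<open>f\<close> the value does not depend on the chosen
      representative.\<close>
    define F where "F X = (if X \<in> lens_space p q then f (SOME x. x \<in> X) else 0)" for X
    have "\<phi> F x = f x" for x
    proof (cases "norm x = 1")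
      case True
      have "(?g ^^ 0) x \<in> lens_orbit p q x" unfolding lens_orbit_def by blast
      then have "(SOME y. y \<in> lens_orbit p q x) \<in> lens_orbit p q x" by (rule someI)
      then obtain l where "(SOME y. y \<in> lens_orbit p q x) = (?g ^^ l) x" by (auto simp: lens_orbit_def)
      moreover have "f ((?g ^^ l) x) = f x" using f by (induction l) (auto simp: inv_seig_def)
      ultimately show ?thesis using True by (simp add: \<phi>_def F_def lens_orbit_in_lens_space_iff)
    next
      case False
      then show ?thesis
        using f by (simp add: \<phi>_def F_def lens_orbit_in_lens_space_iff inv_seig_def seig_def)
    qed
    then have eq: "\<phi> F = f" by auto
    moreover have "F \<in> ?E" using f by (simp add: iff eq) (simp add: F_def)
    ultimately show "f \<in> \<phi> ` ?E" by blast
  qed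
  then show ?thesis
    using fs_dim_image[OF lin sub inj] by (simp add: eigenvalue_multiplicity_def)
qed

lemma isospectral_imp_order_eq:
  fixes p1 p2 :: "'n::finite \<Rightarrow> int"
  assumes "0 < q1" "\<And>j. coprime (p1 j) (int q1)" "0 < q2" "\<And>j. coprime (p2 j) (int q2)"
    and "isospectral p1 q1 p2 q2"
  shows "q1 = q2"
proof -
  have dim2: "2 \<le> DIM(real^2^'n)" by (simp add: Suc_le_eq)
  have "fs.dim (inv_seig (lens_gen p1 q1) k) = fs.dim (inv_seig (lens_gen p2 q2) k)" for k
    using assms(5) unfolding isospectral_def
    by (metis eigenvalue_multiplicity_eq_dim assms(1,3))
  then have "fs.dim (inv_spoly (lens_gen p1 q1) m) = fs.dim (inv_spoly (lens_gen p2 q2) m)" for m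
    using sum_dim_inv_seig[OF dim2 orthogonal_transformation_lens_gen, of p1 q1 m]
      sum_dim_inv_seig[OF dim2 orthogonal_transformation_lens_gen, of p2 q2 m] by simp
  note dims = this
  \<comment> \<open>\<open>undefined\<close> stands for an arbitrary plane.\<close>
  note sep = lens_gen_separated[OF assms(1,2), where j = undefined] lens_gen_separated[OF assms(3,4), where j = undefined]
  show ?thesis
    using separated_cyclic_action_order_le[OF sep dims]
      separated_cyclic_action_order_le[OF sep(2,1) dims[symmetric]] by simp
qed

section \<open>Counting lattice points\<close>

definition int_vec :: "('n::finite \<Rightarrow> int) \<Rightarrow> real^'n" where
  "int_vec a = (\<chi> j. of_int (a j))"

lemma int_vec_nth [simp]: "int_vec a $ j = of_int (a j)"
  by (simp add: int_vec_def)

lemma int_vec_eq_iff [simp]: "int_vec a = int_vec b \<longleftrightarrow> a = b"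
  by (auto simp: vec_eq_iff)

lemma int_vec_add: "int_vec a + int_vec b = int_vec (\<lambda>j. a j + b j)"
  by (simp add: vec_eq_iff)

lemma mem_scaleR_image_iff: "s > 0 \<Longrightarrow> y \<in> (*\<^sub>R) s ` A \<longleftrightarrow> inverse s *\<^sub>R y \<in> A"
  for A :: "'a::real_vector set"
  by (auto simp: image_iff intro!: bexI[of _ "inverse s *\<^sub>R y"])

lemma finite_int_vec_scaled:
  fixes A :: "(real^'n::finite) set"
  assumes "bounded A" "0 < s"
  shows "finite (range int_vec \<inter> (*\<^sub>R) s ` A)"
proof -
  obtain R where R: "\<And>x. x \<in> A \<Longrightarrow> norm x \<le> R" using assms(1) by (auto simp: bounded_iff)
  define M where "M = \<lceil>s * R\<rceil>"
  have "range int_vec \<inter> (*\<^sub>R) s ` A \<subseteq> int_vec ` (UNIV \<rightarrow>\<^sub>E {-M..M})"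
  proof
    fix y assume "y \<in> range int_vec \<inter> (*\<^sub>R) s ` A"
    then obtain a x where y: "y = int_vec a" "y = s *\<^sub>R x" "x \<in> A" by blast
    have "a j \<in> {-M..M}" for j
    proof -
      have "\<bar>y $ j\<bar> \<le> norm y" by (rule component_le_norm_cart)
      also have "\<dots> \<le> s * R" using y(2) R[OF y(3)] assms(2) by simp
      finally have "\<bar>of_int (a j)\<bar> \<le> s * R" using y(1) by simp
      then show ?thesis unfolding M_def by (simp add: abs_le_iff) linarith
    qed
    then show "y \<in> int_vec ` (UNIV \<rightarrow>\<^sub>E {-M..M})" using y(1) by auto
  qed
  moreover have "finite ((UNIV :: 'n set) \<rightarrow>\<^sub>E {-M..M})" by (intro finite_PiE) auto
  ultimately show ?thesis using finite_subset by blast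
qed

text \<open>The lattice points counted here are within distance \<open>norm v\<close> of the frontier of \<open>s A\<close>, so the
  unit cubes at these points, scaled down by \<open>s\<close>, lie in a small neighbourhood of the frontier of \<open>A\<close>.\<close>

lemma exit_count_tendsto_0:
  fixes A :: "(real^'n::finite) set"
  assumes "bounded A" "negligible (frontier A)"
  shows "((\<lambda>s::real. real (card {y \<in> range int_vec. y \<in> (*\<^sub>R) s ` A \<and> y + v \<notin> (*\<^sub>R) s ` A})
    / s ^ CARD('n)) \<longlongrightarrow> 0) at_top"
proof (rule tendstoI)
  fix e :: real assume "0 < e"
  let ?K = "frontier A" and ?n = "CARD('n)"
  have "?K \<in> sets lebesgue" using assms(2) negligible_imp_sets by blast
  \<comment> \<open>Outer regularity encloses the null frontier in an open set of small
    measure.\<close>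
  then obtain U where U: "open U" "?K \<subseteq> U" "emeasure lebesgue (U - ?K) < ennreal e"
    using sets_lebesgue_outer_open[OF _ \<open>0 < e\<close>] by metis
  have "emeasure lebesgue U \<le> emeasure lebesgue (U - ?K) + emeasure lebesgue ?K"
    using U(1,2) \<open>?K \<in> sets lebesgue\<close> by (subst plus_emeasure) (auto simp: Un_absorb2 intro!: borel_open sets_completionI_sets)
  also have "emeasure lebesgue ?K = 0"
    using assms(2) by (simp add: negligible_iff_null_sets null_setsD1)
  finally have "emeasure lebesgue U < ennreal e" using U(3) by simp
  then have mU: "emeasure lborel U < ennreal e" using U(1) by simp
  have "compact ?K" using assms(1) by (simp add: compact_frontier_bounded)
  then obtain \<delta> where "0 < \<delta>" "(\<Union>k\<in>?K. ball k \<delta>) \<subseteq> U"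
    using compact_subset_open_imp_ball_epsilon_subset[OF _ U(1,2)] by blast
  then have \<delta>: "0 < \<delta>" "\<And>x k. k \<in> ?K \<Longrightarrow> dist k x < \<delta> \<Longrightarrow> x \<in> U"
    by (simp, meson UN_I mem_ball subsetD)
  show "\<forall>\<^sub>F s in at_top. dist (real (card {y \<in> range int_vec. y \<in> (*\<^sub>R) s ` A \<and> y + v \<notin> (*\<^sub>R) s ` A})
    / s ^ ?n) 0 < e"
    \<comment> \<open>After scaling, \<open>norm v / s\<close> bounds the distance of a counted
      point from some frontier point and \<open>CARD('n) / s\<close> the diameter of its cube;
      beyond this threshold their sum is below \<open>\<delta>\<close>.\<close>
    using eventually_gt_at_top[of 0] eventually_gt_at_top[of "(norm v + real ?n) / \<delta>"]
  proof eventually_elim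
    case (elim s)
    define Y where "Y = {y \<in> range int_vec. y \<in> (*\<^sub>R) s ` A \<and> y + v \<notin> (*\<^sub>R) s ` A}"
    \<comment> \<open>Open boxes, so that cubes at distinct integer points are disjoint and the
      normalised count is a volume.\<close>
    define Q where "Q y = box (inverse s *\<^sub>R y) (inverse s *\<^sub>R (y + 1))" for y :: "real^'n"
    have s: "0 < s" "(norm v + real ?n) / s < \<delta>" using elim \<delta>(1) by (auto simp: field_simps)
    have "finite Y"
      by (rule finite_subset[OF _ finite_int_vec_scaled[OF assms(1) s(1)]]) (auto simp: Y_def)
    have Q_sub: "Q y \<subseteq> U" if "y \<in> Y" for y
    proof
      fix x assume x: "x \<in> Q y"
      have "inverse s *\<^sub>R y \<in> A" "inverse s *\<^sub>R (y + v) \<notin> A"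
        using that s(1) by (auto simp: Y_def mem_scaleR_image_iff)
      \<comment> \<open>A segment from a point of \<open>A\<close> to a point outside
        \<open>A\<close> meets the frontier.\<close>
      then have "closed_segment (inverse s *\<^sub>R y) (inverse s *\<^sub>R (y + v)) \<inter> ?K \<noteq> {}"
        by (intro connected_Int_frontier) auto
      then obtain k where k: "k \<in> ?K" "k \<in> closed_segment (inverse s *\<^sub>R y) (inverse s *\<^sub>R (y + v))" by blast
      have "norm (k - inverse s *\<^sub>R y) \<le> norm (inverse s *\<^sub>R (y + v) - inverse s *\<^sub>R y)"
        using segment_bound(1)[OF k(2)] by simp
      also have "\<dots> = norm v / s" using s(1) by (simp add: scaleR_add_right divide_inverse mult.commute)
      finally have 1: "norm (k - inverse s *\<^sub>R y) \<le> norm v / s" .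
      have "norm (x - inverse s *\<^sub>R y) \<le> (\<Sum>i\<in>UNIV. \<bar>(x - inverse s *\<^sub>R y) $ i\<bar>)" by (rule norm_le_l1_cart)
      also have "\<dots> \<le> (\<Sum>i\<in>(UNIV::'n set). inverse s)"
      proof (rule sum_mono)
        fix i
        have "(inverse s *\<^sub>R y) $ i < x $ i" "x $ i < (inverse s *\<^sub>R (y + 1)) $ i"
          using x by (auto simp: Q_def mem_box_cart)
        then show "\<bar>(x - inverse s *\<^sub>R y) $ i\<bar> \<le> inverse s" by (simp add: distrib_left)
      qed
      also have "\<dots> = real ?n / s" by (simp add: divide_inverse)
      finally have 2: "norm (x - inverse s *\<^sub>R y) \<le> real ?n / s" .
      have "dist k x \<le> norm (k - inverse s *\<^sub>R y) + norm (x - inverse s *\<^sub>R y)"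
        using norm_triangle_ineq4[of "k - inverse s *\<^sub>R y" "x - inverse s *\<^sub>R y"] by (simp add: dist_norm)
      also have "\<dots> < \<delta>" using 1 2 s(2) by (simp add: add_divide_distrib)
      finally show "x \<in> U" using \<delta>(2) k(1) by blast
    qed
    have disj: "disjoint_family_on Q Y"
      unfolding disjoint_family_on_def
    proof (intro ballI impI)
      fix y y' assume y: "y \<in> Y" "y' \<in> Y" "y \<noteq> y'"
      obtain a a' where a: "y = int_vec a" "y' = int_vec a'" using y by (auto simp: Y_def)
      show "Q y \<inter> Q y' = {}"
      proof (rule ccontr)
        assume "Q y \<inter> Q y' \<noteq> {}"
        then obtain x where x: "x \<in> Q y" "x \<in> Q y'" by blast
        have "a j = a' j" for j
        proof -
          have "inverse s * a j < x $ j" "x $ j < inverse s * (a j + 1)"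
            "inverse s * a' j < x $ j" "x $ j < inverse s * (a' j + 1)"
            using x by (auto simp: Q_def mem_box_cart a)
          then have "inverse s * a j < inverse s * (a' j + 1)" "inverse s * a' j < inverse s * (a j + 1)"
            by linarith+
          then have "real_of_int (a j) < a' j + 1" "real_of_int (a' j) < a j + 1"
            using s(1) by (simp_all only: mult_less_cancel_left_pos positive_imp_inverse_positive)
          then show ?thesis by linarith
        qed
        then show False using y(3) a by auto
      qed
    qed
    have setsQ: "Q y \<in> sets lborel" and finQ: "emeasure lborel (Q y) \<noteq> \<infinity>" for y
      using emeasure_lborel_box_finite[of "inverse s *\<^sub>R y" "inverse s *\<^sub>R (y + 1)"]
      by (auto simp: Q_def)
    have mQ: "measure lborel (Q y) = inverse (s ^ ?n)" for y
    proof -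
      have "measure lborel (Q y) = (\<Prod>b\<in>Basis. (inverse s *\<^sub>R (y + 1) - inverse s *\<^sub>R y) \<bullet> b)"
        unfolding Q_def measure_lborel_box_eq
        using s(1) by (auto simp: Basis_vec_def inner_axis distrib_left)
      also have "\<dots> = (\<Prod>b\<in>(Basis :: (real^'n) set). inverse s)"
        by (intro prod.cong refl) (auto simp: Basis_vec_def inner_axis distrib_left)
      finally show ?thesis by (simp add: power_inverse)
    qed
    have "real (card Y) / s ^ ?n = (\<Sum>y\<in>Y. measure lborel (Q y))" by (simp add: mQ divide_inverse)
    also have "\<dots> = measure lborel (\<Union>y\<in>Y. Q y)"
      using \<open>finite Y\<close> disj setsQ finQ by (intro measure_finite_Union[symmetric]) auto
    also have "\<dots> \<le> measure lborel U"
    proof (rule measure_mono_fmeasurable)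
      show "(\<Union>y\<in>Y. Q y) \<subseteq> U" using Q_sub by blast
      show "(\<Union>y\<in>Y. Q y) \<in> sets lborel" using \<open>finite Y\<close> setsQ by blast
      have "emeasure lborel U < \<infinity>" using less_trans[OF mU ennreal_less_top] by simp
      then show "U \<in> fmeasurable lborel" using U(1) by (intro fmeasurableI) auto
    qed
    also have "\<dots> < e"
    proof -
      have "emeasure lborel U \<noteq> top" using less_trans[OF mU ennreal_less_top] by simp
      then have "ennreal (measure lborel U) < ennreal e" using mU by (simp add: emeasure_eq_ennreal_measure)
      then show ?thesis by (simp add: ennreal_less_iff)
    qed
    finally show ?case using s(1) by (simp add: Y_def)
  qed
qed

text \<open>For \<open>q > 0\<close> and some \<open>p j\<close> coprime to \<open>q\<close>, the
  classes with \<open>r\<close> from 0 to \<open>q - 1\<close> are the cosets of the lens lattice in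
  the integer lattice.\<close>

definition lattice_class :: "('n::finite \<Rightarrow> int) \<Rightarrow> nat \<Rightarrow> int \<Rightarrow> (real^'n) set" where
  "lattice_class p q r = {int_vec a | a. [(\<Sum>j\<in>UNIV. a j * p j) = r] (mod int q)}"

lemma lens_lattice_eq_class: "lens_lattice p q = lattice_class p q 0"
  by (simp add: lens_lattice_def lattice_class_def int_vec_def)

text \<open>With \<open>w\<close> the inverse of \<open>p j\<close> modulo \<open>q\<close>, adding
  \<open>w * d\<close> to coordinate \<open>j\<close> changes the weighted sum by \<open>d\<close>
  modulo \<open>q\<close>.\<close>

lemma lattice_class_shift:
  fixes p :: "'n::finite \<Rightarrow> int"
  assumes "coprime (p j) (int q)"
  obtains v where "\<And>y r. y \<in> lattice_class p q r \<Longrightarrow> y + v \<in> lattice_class p q (r + d)"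
proof -
  obtain w where w: "[p j * w = 1] (mod int q)" using cong_solve_coprime_int[OF assms] by blast
  define u where "u = (\<lambda>i. if i = j then w * d else 0)"
  show ?thesis
  proof (rule that)
    fix y r assume "y \<in> lattice_class p q r"
    then obtain a where a: "y = int_vec a" "[(\<Sum>j\<in>UNIV. a j * p j) = r] (mod int q)"
      by (auto simp: lattice_class_def)
    have "[p j * w * d = 1 * d] (mod int q)" by (intro cong_mult w cong_refl)
    then have "[(\<Sum>j\<in>UNIV. a j * p j) + p j * w * d = r + 1 * d] (mod int q)" by (intro cong_add a(2))
    moreover have "(a i + u i) * p i = a i * p i + (if i = j then p j * w * d else 0)" for i
      by (simp add: u_def algebra_simps)
    then have "(\<Sum>i\<in>UNIV. (a i + u i) * p i) = (\<Sum>j\<in>UNIV. a j * p j) + p j * w * d"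
      by (simp add: sum.distrib)
    ultimately show "y + int_vec u \<in> lattice_class p q (r + d)"
      unfolding lattice_class_def a(1) int_vec_add by auto
  qed
qed

text \<open>Translation by \<open>v\<close> is injective, so only the points of \<open>Y\<close>
  that it moves out of the scaled set have to be counted extra.\<close>

lemma card_shift_le:
  fixes A :: "(real^'n::finite) set"
  assumes "bounded A" "0 < s" "Y \<subseteq> range int_vec" "Z \<subseteq> range int_vec" "\<And>y. y \<in> Y \<Longrightarrow> y + v \<in> Z"
  shows "card (Y \<inter> (*\<^sub>R) s ` A) \<le> card (Z \<inter> (*\<^sub>R) s ` A)
    + card {y \<in> range int_vec. y \<in> (*\<^sub>R) s ` A \<and> y + v \<notin> (*\<^sub>R) s ` A}"
proof -
  let ?S = "(*\<^sub>R) s ` A" and ?B = "{y \<in> range int_vec. y \<in> (*\<^sub>R) s ` A \<and> y + v \<notin> (*\<^sub>R) s ` A}"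
  let ?Y1 = "{y \<in> Y \<inter> ?S. y + v \<in> ?S}"
  have fin: "finite (range int_vec \<inter> ?S)" by (rule finite_int_vec_scaled[OF assms(1,2)])
  have finB: "finite ?B" by (rule finite_subset[OF _ fin]) auto
  have finY: "finite ?Y1" by (rule finite_subset[OF _ fin]) (use assms(3) in auto)
  have finZ: "finite (Z \<inter> ?S)" by (rule finite_subset[OF _ fin]) (use assms(4) in auto)
  have "Y \<inter> ?S \<subseteq> ?Y1 \<union> ?B" using assms(3) by auto
  then have "card (Y \<inter> ?S) \<le> card (?Y1 \<union> ?B)" using finB finY by (intro card_mono) auto
  also have "\<dots> \<le> card ?Y1 + card ?B" by (rule card_Un_le)
  also have "card ?Y1 = card ((\<lambda>y. y + v) ` ?Y1)" by (rule card_image[symmetric]) simp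
  also have "\<dots> \<le> card (Z \<inter> ?S)" using assms(5) finZ by (intro card_mono) auto
  finally show ?thesis by simp
qed

text \<open>Translating class 0 to class \<open>r\<close> and back bounds the difference of the
  counts by two exit counts.\<close>

lemma lattice_class_count_diff:
  fixes A :: "(real^'n::finite) set"
  assumes A: "bounded A" "negligible (frontier A)" and p: "coprime (p j) (int q)"
  shows "((\<lambda>s::real. (real (card (lattice_class p q r \<inter> (*\<^sub>R) s ` A))
    - real (card (lattice_class p q 0 \<inter> (*\<^sub>R) s ` A))) / s ^ CARD('n)) \<longlongrightarrow> 0) at_top"
proof -
  let ?T = "\<lambda>r. lattice_class p q r" and ?n = "CARD('n)"
  obtain v where v: "\<And>y. y \<in> ?T 0 \<Longrightarrow> y + v \<in> ?T r"
    using lattice_class_shift[where p = p and j = j and d = r, OF p] by (metis add_0)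
  obtain w where w: "\<And>y. y \<in> ?T r \<Longrightarrow> y + w \<in> ?T 0"
    using lattice_class_shift[where p = p and j = j and d = "- r", OF p] by (metis add.right_inverse)
  define B where "B v s = real (card {y \<in> range int_vec. y \<in> (*\<^sub>R) s ` A \<and> y + v \<notin> (*\<^sub>R) s ` A})"
    for v and s :: real
  have B: "((\<lambda>s. B v s / s ^ ?n) \<longlongrightarrow> 0) at_top" for v
    unfolding B_def by (rule exit_count_tendsto_0[OF A])
  have sub: "?T r \<subseteq> range int_vec" for r by (auto simp: lattice_class_def)
  have bound: "\<forall>\<^sub>F s in at_top. norm ((real (card (?T r \<inter> (*\<^sub>R) s ` A)) - real (card (?T 0 \<inter> (*\<^sub>R) s ` A))) / s ^ ?n)
    \<le> B v s / s ^ ?n + B w s / s ^ ?n"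
    using eventually_gt_at_top[of 0]
  proof eventually_elim
    case (elim s)
    have "real (card (?T r \<inter> (*\<^sub>R) s ` A)) \<le> real (card (?T 0 \<inter> (*\<^sub>R) s ` A)) + B w s"
      unfolding B_def of_nat_add[symmetric] of_nat_le_iff
      by (rule card_shift_le[OF A(1) elim sub sub w])
    moreover have "real (card (?T 0 \<inter> (*\<^sub>R) s ` A)) \<le> real (card (?T r \<inter> (*\<^sub>R) s ` A)) + B v s"
      unfolding B_def of_nat_add[symmetric] of_nat_le_iff
      by (rule card_shift_le[OF A(1) elim sub sub v])
    moreover have "0 \<le> B v s" "0 \<le> B w s" by (simp_all add: B_def)
    ultimately have "\<bar>real (card (?T r \<inter> (*\<^sub>R) s ` A)) - real (card (?T 0 \<inter> (*\<^sub>R) s ` A))\<bar> \<le> B v s + B w s"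
      by linarith
    then show ?case
      using elim by (simp add: abs_divide divide_right_mono flip: add_divide_distrib)
  qed
  have "((\<lambda>s. B v s / s ^ ?n + B w s / s ^ ?n) \<longlongrightarrow> 0) at_top"
    using tendsto_add[OF B B] by simp
  then show ?thesis by (rule Lim_null_comparison[OF bound])
qed

lemma card_int_vec_eq_sum:
  fixes A :: "(real^'n::finite) set"
  assumes "bounded A" "0 < s" "0 < q"
  shows "card (range int_vec \<inter> (*\<^sub>R) s ` A) = (\<Sum>r<q. card (lattice_class p q (int r) \<inter> (*\<^sub>R) s ` A))"
proof -
  let ?S = "(*\<^sub>R) s ` A"
  have "range int_vec \<inter> ?S = (\<Union>r<q. lattice_class p q (int r) \<inter> ?S)"
  proof (intro set_eqI iffI)
    fix y assume "y \<in> range int_vec \<inter> ?S"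
    then obtain a where a: "y = int_vec a" "y \<in> ?S" by auto
    define r where "r = nat ((\<Sum>j\<in>UNIV. a j * p j) mod int q)"
    have "int r = (\<Sum>j\<in>UNIV. a j * p j) mod int q" using assms(3) by (simp add: r_def)
    moreover from this have "r < q" using assms(3) by (metis of_nat_0_less_iff of_nat_less_iff pos_mod_bound)
    ultimately have "y \<in> lattice_class p q (int r)" "r \<in> {..<q}"
      using a by (auto simp: lattice_class_def cong_def)
    then show "y \<in> (\<Union>r<q. lattice_class p q (int r) \<inter> ?S)" using a(2) by blast
  qed (auto simp: lattice_class_def)
  also have "card \<dots> = (\<Sum>r<q. card (lattice_class p q (int r) \<inter> ?S))"
  proof (rule card_UN_disjoint)
    show "\<forall>r\<in>{..<q}. finite (lattice_class p q (int r) \<inter> ?S)"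
      using finite_int_vec_scaled[OF assms(1,2)]
      by (auto intro!: finite_subset[of _ "range int_vec \<inter> ?S"] simp: lattice_class_def)
    show "\<forall>r\<in>{..<q}. \<forall>r'\<in>{..<q}. r \<noteq> r' \<longrightarrow>
      lattice_class p q (int r) \<inter> ?S \<inter> (lattice_class p q (int r') \<inter> ?S) = {}"
    proof (intro ballI impI equals0I)
      fix r r' y assume r: "r \<in> {..<q}" "r' \<in> {..<q}" "r \<noteq> r'"
        and "y \<in> lattice_class p q (int r) \<inter> ?S \<inter> (lattice_class p q (int r') \<inter> ?S)"
      then obtain a a' where "y = int_vec a" "[(\<Sum>j\<in>UNIV. a j * p j) = int r] (mod int q)"
        "y = int_vec a'" "[(\<Sum>j\<in>UNIV. a' j * p j) = int r'] (mod int q)"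
        by (auto simp: lattice_class_def)
      then show False using r by (auto simp: cong_def)
    qed
  qed simp
  finally show ?thesis .
qed

text \<open>The lattice has index \<open>q\<close> in the integer lattice.\<close>

lemma lens_lattice_count:
  fixes A :: "(real^'n::finite) set"
  assumes A: "bounded A" "negligible (frontier A)" and "0 < q" "coprime (p j) (int q)"
  shows "((\<lambda>s::real. real (card (range int_vec \<inter> (*\<^sub>R) s ` A)) / (real q * s ^ CARD('n))
    - real (card (lens_lattice p q \<inter> (*\<^sub>R) s ` A)) / s ^ CARD('n)) \<longlongrightarrow> 0) at_top"
proof -
  let ?c = "\<lambda>r s. real (card (lattice_class p q r \<inter> (*\<^sub>R) s ` A))" and ?n = "CARD('n)"
  \<comment> \<open>The counts of the \<open>q\<close> classes add up to the count of integer
    points; their deviations from class 0 are averaged.\<close>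
  have "((\<lambda>s. (\<Sum>r<q. (?c (int r) s - ?c 0 s) / s ^ ?n) / real q) \<longlongrightarrow> (\<Sum>r<q. 0) / real q) at_top"
    by (intro tendsto_intros lattice_class_count_diff[where p = p and j = j, OF A assms(4)]) (use assms(3) in auto)
  then have "((\<lambda>s. (\<Sum>r<q. (?c (int r) s - ?c 0 s) / s ^ ?n) / real q) \<longlongrightarrow> 0) at_top"
    by simp
  moreover have "\<forall>\<^sub>F s in at_top. (\<Sum>r<q. (?c (int r) s - ?c 0 s) / s ^ ?n) / real q
    = real (card (range int_vec \<inter> (*\<^sub>R) s ` A)) / (real q * s ^ ?n)
    - real (card (lens_lattice p q \<inter> (*\<^sub>R) s ` A)) / s ^ ?n"
    using eventually_gt_at_top[of 0]
  proof eventually_elim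
    case (elim s)
    have "(\<Sum>r<q. (?c (int r) s - ?c 0 s) / s ^ ?n) = ((\<Sum>r<q. ?c (int r) s) - real q * ?c 0 s) / s ^ ?n"
      by (simp add: sum_subtractf flip: sum_divide_distrib)
    also have "(\<Sum>r<q. ?c (int r) s) = real (card (range int_vec \<inter> (*\<^sub>R) s ` A))"
      by (simp add: card_int_vec_eq_sum[OF A(1) elim assms(3), of p])
    finally show ?case
      using assms(3) by (simp add: lens_lattice_eq_class diff_divide_distrib mult.commute)
  qed
  ultimately show ?thesis by (rule Lim_transform_eventually)
qed

text \<open>The ball is convex, and convex sets have negligible frontier.\<close>

lemma l1_cball_regular:
  "bounded (l1_cball :: (real^'n::finite) set)" "negligible (frontier (l1_cball :: (real^'n) set))"
proof -
  show "bounded (l1_cball :: (real^'n) set)"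
    using norm_le_l1_cart order_trans unfolding bounded_iff l1_cball_def by blast
  have "convex (l1_cball :: (real^'n) set)"
  proof (rule convexI)
    fix x y :: "real^'n" and u v :: real
    assume *: "x \<in> l1_cball" "y \<in> l1_cball" "0 \<le> u" "0 \<le> v" "u + v = 1"
    have "(\<Sum>j\<in>UNIV. \<bar>(u *\<^sub>R x + v *\<^sub>R y) $ j\<bar>) \<le> (\<Sum>j\<in>UNIV. u * \<bar>x $ j\<bar> + v * \<bar>y $ j\<bar>)"
      using * by (intro sum_mono) (auto simp: abs_mult intro!: order_trans[OF abs_triangle_ineq])
    also have "\<dots> = u * (\<Sum>j\<in>UNIV. \<bar>x $ j\<bar>) + v * (\<Sum>j\<in>UNIV. \<bar>y $ j\<bar>)"
      by (simp add: sum.distrib sum_distrib_left)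
    also have "\<dots> \<le> u * 1 + v * 1"
      using * by (intro add_mono mult_left_mono) (auto simp: l1_cball_def)
    finally show "u *\<^sub>R x + v *\<^sub>R y \<in> l1_cball" using * by (simp add: l1_cball_def)
  qed
  then show "negligible (frontier (l1_cball :: (real^'n) set))" by (rule negligible_convex_frontier)
qed

text \<open>Both normalised counts are asymptotic to the integer count over \<open>q s^n\<close>, so
  one converges to a value iff the other does. Hence the defining predicates agree on every
  \<open>M\<close>, and so do the measures they describe.\<close>

lemma lattice_counting_measure_eq:
  fixes p1 p2 :: "'n::finite \<Rightarrow> int"
  assumes "0 < q" "\<And>j. coprime (p1 j) (int q)" "\<And>j. coprime (p2 j) (int q)"
  shows "lattice_counting_measure (lens_lattice p1 q) = lattice_counting_measure (lens_lattice p2 q)"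
proof -
  let ?c = "\<lambda>p U s::real. real (card (lens_lattice p q \<inter> (*\<^sub>R) s ` (pos_cone U \<inter> l1_cball))) / s ^ CARD('n)"
  have "(?c p1 U \<longlongrightarrow> L) at_top \<longleftrightarrow> (?c p2 U \<longlongrightarrow> L) at_top"
    if U: "negligible (frontier (pos_cone U))" for U :: "(real^'n) set" and L
  proof -
    let ?A = "pos_cone U \<inter> l1_cball"
    have A: "bounded ?A" "negligible (frontier ?A)"
      using l1_cball_regular[where 'n = 'n] U bounded_Int negligible_subset[OF _ frontier_Int_subset]
      by (blast intro: negligible_Un)+
    have "((\<lambda>s. ?c p2 U s - ?c p1 U s) \<longlongrightarrow> 0) at_top"
      using tendsto_diff[OF lens_lattice_count[where p = p1, OF A assms(1,2)] lens_lattice_count[where p = p2, OF A assms(1,3)]]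
      by simp
    moreover from tendsto_minus[OF this] have "((\<lambda>s. ?c p1 U s - ?c p2 U s) \<longlongrightarrow> 0) at_top" by simp
    ultimately show ?thesis using Lim_transform[of "?c p1 U" L at_top "?c p2 U"]
      Lim_transform[of "?c p2 U" L at_top "?c p1 U"] by blast
  qed
  then have "is_lattice_counting_measure (lens_lattice p1 q) M
      \<longleftrightarrow> is_lattice_counting_measure (lens_lattice p2 q) M" for M
    unfolding is_lattice_counting_measure_def by blast
  then show ?thesis by (simp add: lattice_counting_measure_def)
qed

theorem theorem3:
  fixes p1 p2 :: "'n::finite \<Rightarrow> int" and q1 q2 :: nat
  assumes "0 < q1" and "\<And>j. coprime (p1 j) (int q1)"
    and "0 < q2" and "\<And>j. coprime (p2 j) (int q2)"
    and "isospectral p1 q1 p2 q2"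
  shows "lattice_counting_measure (lens_lattice p1 q1) = lattice_counting_measure (lens_lattice p2 q2)"
proof -
  have "q1 = q2" by (rule isospectral_imp_order_eq[OF assms])
  with lattice_counting_measure_eq[OF assms(3), of p1 p2] show ?thesis using assms(2,4) by simp
qed

end
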